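(* Let $G$ be a second countable locally compact Abelian group, let $1\leqslant p<\infty$, let $K\subseteq G$ be a measurable precompact set with non-empty interior, and let $f\in L^p_{\mathrm{loc}}(G)$. Then the following statements are equivalent. (1) $f$ is Stepanov $p$-almost periodic, i.e. for every $\varepsilon>0$ the set $\{t\in G : \|f-T_tf\|_{S^p}<\varepsilon\}$ is relatively dense in $G$. (2) $f$ is the $\|\cdot\|_{S^p}$-limit of a sequence of trigonometric polynomials. (3) The orbit $\{T_tf : t\in G\}$ is precompact in the $\|\cdot\|_{S^p}$-topology.
   Context: $\theta_G$ is Haar measure on $G$, and functions in $L^p_{\mathrm{loc}}(G)$ are complex valued and identified when equal almost everywhere. For $f\in L^p_{\mathrm{loc}}(G)$, $$\|f\|_{S^p}:=\|f\|_{S^p_K}:=\sup_{y\in G}\left(\frac{1}{\theta_G(K)}\int_{y+K}|f(x)|^p\,d\theta_G(x)\right)^{1/p}\in[0,\infty].$$ $T_tf(x):=f(x-t)$. A set $R\subseteq G$ is relatively dense if there is a compact set $K'\subseteq G$ with $R+K'=G$. A trigonometric polynomial is a finite complex linear combination of continuous characters $\chi\in\widehat G$. The $\|\cdot\|_{S^p}$-topology is the one given by the (possibly infinite-valued) metric $(g,h)\mapsto\|g-h\|_{S^p}$; precompact is equivalent to totally bounded, i.e. for every $\varepsilon>0$ the set is covered by finitely many $\|\cdot\|_{S^p}$-balls of radius $\varepsilon$. *)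

theory Defs
  imports "HOL-Analysis.Analysis"
begin

(* On a second countable locally compact Hausdorff group every Borel measure that is finite on
   compact sets is regular, so regularity is not listed. *)
definition haar_measure ::
    "'a::{topological_ab_group_add, second_countable_topology, t2_space} measure \<Rightarrow> bool" where
  "haar_measure \<theta> \<longleftrightarrow>
     sets \<theta> = sets borel \<and>
     emeasure \<theta> UNIV \<noteq> 0 \<and>
     (\<forall>C. compact C \<longrightarrow> emeasure \<theta> C < \<infinity>) \<and>
     (\<forall>t. \<forall>A\<in>sets borel. emeasure \<theta> ((+) t ` A) = emeasure \<theta> A)"

(* Elements are functions, not classes modulo equality almost everywhere; all notions below that
   involve such a function depend on its class only. *)
definition Lp_loc :: "'a::topological_space measure \<Rightarrow> real \<Rightarrow> ('a \<Rightarrow> complex) set" where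
  "Lp_loc \<theta> p = {f. f \<in> borel_measurable \<theta> \<and>
     (\<forall>C. compact C \<longrightarrow> (\<integral>\<^sup>+x\<in>C. ennreal (cmod (f x) powr p) \<partial>\<theta>) < \<infinity>)}"

definition translate :: "'a::ab_group_add \<Rightarrow> ('a \<Rightarrow> complex) \<Rightarrow> 'a \<Rightarrow> complex" where
  "translate t f = (\<lambda>x. f (x - t))"

(* x powr a for a > 0 on [0, \<infinity>], with \<infinity> powr a = \<infinity> *)
definition ennreal_powr :: "ennreal \<Rightarrow> real \<Rightarrow> ennreal" where
  "ennreal_powr x a = (if x = \<infinity> then \<infinity> else ennreal (enn2real x powr a))"

definition stepanov_norm ::
    "'a::ab_group_add measure \<Rightarrow> real \<Rightarrow> 'a set \<Rightarrow> ('a \<Rightarrow> complex) \<Rightarrow> ennreal" where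
  "stepanov_norm \<theta> p K f =
     (SUP y. ennreal_powr
        ((1 / emeasure \<theta> K) * (\<integral>\<^sup>+x \<in> (+) y ` K. ennreal (cmod (f x) powr p) \<partial>\<theta>)) (1 / p))"

definition relatively_dense :: "'a::{topological_space, ab_group_add} set \<Rightarrow> bool" where
  "relatively_dense R \<longleftrightarrow> (\<exists>C. compact C \<and> {r + c | r c. r \<in> R \<and> c \<in> C} = UNIV)"

definition continuous_character :: "('a::{topological_space, ab_group_add} \<Rightarrow> complex) \<Rightarrow> bool" where
  "continuous_character \<gamma> \<longleftrightarrow>
     continuous_on UNIV \<gamma> \<and> (\<forall>x. cmod (\<gamma> x) = 1) \<and> (\<forall>x y. \<gamma> (x + y) = \<gamma> x * \<gamma> y)"

definition trig_polynomial :: "('a::{topological_space, ab_group_add} \<Rightarrow> complex) \<Rightarrow> bool" where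
  "trig_polynomial g \<longleftrightarrow>
     (\<exists>X c. finite X \<and> (\<forall>\<gamma>\<in>X. continuous_character \<gamma>) \<and> g = (\<lambda>x. \<Sum>\<gamma>\<in>X. c \<gamma> * \<gamma> x))"

definition stepanov_almost_periodic ::
    "'a::{topological_space, ab_group_add} measure \<Rightarrow> real \<Rightarrow> 'a set \<Rightarrow> ('a \<Rightarrow> complex) \<Rightarrow> bool" where
  "stepanov_almost_periodic \<theta> p K f \<longleftrightarrow>
     (\<forall>\<epsilon>>0. relatively_dense
        {t. stepanov_norm \<theta> p K (\<lambda>x. f x - translate t f x) < ennreal \<epsilon>})"

(* Precompactness for the [0, \<infinity>]-valued pseudometric on Lp_loc given by the Stepanov norm of the
   difference, in the form of total boundedness. *)
definition stepanov_precompact ::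
    "'a::{topological_space, ab_group_add} measure \<Rightarrow> real \<Rightarrow> 'a set \<Rightarrow> ('a \<Rightarrow> complex) set \<Rightarrow> bool" where
  "stepanov_precompact \<theta> p K F \<longleftrightarrow>
     (\<forall>\<epsilon>>0. \<exists>H. finite H \<and> H \<subseteq> Lp_loc \<theta> p \<and>
        F \<subseteq> (\<Union>h\<in>H. {g \<in> Lp_loc \<theta> p. stepanov_norm \<theta> p K (\<lambda>x. g x - h x) < ennreal \<epsilon>}))"

end

theory Submission
  imports Defs
begin

text \<open>Write \<open>N F\<close> for the supremum over \<open>y\<close> of the integral of \<open>|F|\<^sup>p\<close> over \<open>y + K\<close> and
  \<open>osc f t = N (f - T\<^sub>t f)\<close>. All three statements are equivalent to: for every \<open>\<eta> > 0\<close> there is a finite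
  \<open>T\<close> such that each \<open>t\<close> has an \<open>s \<in> T\<close> with \<open>osc f (t - s) \<le> \<eta>\<close>. Relative density gives this with a
  compact set in place of \<open>T\<close>, and also transports the continuity of translation in \<open>L\<^sup>p\<close> over a
  compact set to the continuity of \<open>osc f\<close> at \<open>0\<close>; a finite set is then obtained by compactness.

  For the approximation by trigonometric polynomials, replace \<open>f\<close> by the averages \<open>g\<close> of \<open>f\<close> over small
  translates \<open>x + U\<close>. The pseudonorm \<open>\<rho> t = sup |g - T\<^sub>t g|\<close> is totally bounded, so it remains to prove
  Bohr's approximation theorem for functions that are uniformly continuous with respect to a totally
  bounded pseudonorm. This is done with the mean value \<open>M\<close> and the convolution algebra it defines:
  power iteration on a hermitian element yields an idempotent, an idempotent that is not a character
  splits off a strictly smaller one, and hence every nonzero hermitian element contains a character.\<close>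

section \<open>Means of functions on totally bounded groups\<close>

text \<open>The completion of the group under \<rho> is a compact abelian group; \<open>M\<close>,
  \<open>uc\<close> and \<open>chars\<close> describe its Haar integral, continuous functions and
  characters without leaving the original group. Uniform limits stand in for spectral theory: the
  power iteration is Cauchy in mean square, and one further convolution makes it uniformly Cauchy by
  Cauchy-Schwarz. The splitting of idempotents terminates because a nonzero idempotent has
  \<open>n2 P \<ge> 1\<close> and \<open>n2\<close> is additive on orthogonal sums, so it behaves
  like a dimension. The obstacle on the measure side is that a finite Stepanov norm does not make
  translation continuous: for a general locally integrable \<open>f\<close>, \<open>osc f\<close>
  need not tend to 0 at 0. Continuity has to come from almost periodicity, and it is also what makes
  the characters found through \<rho> continuous in the topology of the group. All estimates use
  \<open>p\<close>-th powers without the root, so each triangle inequality costs a factor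
  \<open>2\<^sup>p\<close>; only smallness matters, and the constants obtained from
  \<open>c2_half\<close> absorb that factor.\<close>

definition avg :: "'a::ab_group_add list \<Rightarrow> ('a \<Rightarrow> 'b::real_vector) \<Rightarrow> 'a \<Rightarrow> 'b" where
  "avg ts F x = (\<Sum>t\<leftarrow>ts. F (x + t)) /\<^sub>R real (length ts)"

lemma avg_add: "avg ts (\<lambda>x. F x + H x) x = avg ts F x + avg ts H x"
  by (simp add: avg_def sum_list_addf scaleR_right_distrib)

lemma avg_linear:
  assumes "linear h"
  shows "avg ts (\<lambda>x. h (F x)) x = h (avg ts F x)"
proof -
  have "(\<Sum>t\<leftarrow>ts. h (F (x + t))) = h (\<Sum>t\<leftarrow>ts. F (x + t))"
    by (induction ts) (auto simp: linear_0[OF assms] linear_add[OF assms])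
  then show ?thesis
    by (simp add: avg_def linear_scale[OF assms])
qed

lemma avg_diff: "avg ts (\<lambda>x. F x - H x) x = avg ts F x - avg ts H x"
  by (simp add: avg_def sum_list_subtractf scaleR_right_diff_distrib)

lemma avg_const:
  assumes "ts \<noteq> []"
  shows "avg ts (\<lambda>_. c) x = c"
proof -
  have "(\<Sum>t\<leftarrow>ts. c) = real (length ts) *\<^sub>R c"
    by (induction ts) (auto simp: scaleR_left_distrib)
  with assms show ?thesis by (simp add: avg_def)
qed

lemma avg_mono:
  fixes F :: "'a::ab_group_add \<Rightarrow> real"
  assumes "\<And>x. F x \<le> H x"
  shows "avg ts F x \<le> avg ts H x"
  unfolding avg_def by (intro scaleR_left_mono sum_list_mono assms) auto

lemma norm_avg_le:
  assumes "ts \<noteq> []" "\<And>x. norm (F x) \<le> B"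
  shows "norm (avg ts F x) \<le> B"
proof -
  have "norm (\<Sum>t\<leftarrow>ts. F (x + t)) \<le> (\<Sum>t\<leftarrow>ts. norm (F (x + t)))"
    by (induction ts) (auto intro: order_trans[OF norm_triangle_ineq])
  also have "\<dots> \<le> (\<Sum>t\<leftarrow>ts. B)"
    by (intro sum_list_mono assms)
  also have "\<dots> = real (length ts) * B"
    by (simp add: sum_list_triv)
  finally show ?thesis
    using assms(1) by (simp add: avg_def divide_simps mult.commute)
qed

lemma avg_shift: "avg ts (\<lambda>x. F (x + a)) x = avg ts F (x + a)"
  by (simp add: avg_def algebra_simps)

text \<open>Lists keep the multiplicity of coinciding sums, so averaging twice is exactly one
  average over \<open>list_sums\<close>.\<close>

definition list_sums :: "'a::ab_group_add list \<Rightarrow> 'a list \<Rightarrow> 'a list" where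
  "list_sums ts ss = map (\<lambda>(t, s). t + s) (List.product ts ss)"

lemma list_sums_neq_Nil: "ts \<noteq> [] \<Longrightarrow> ss \<noteq> [] \<Longrightarrow> list_sums ts ss \<noteq> []"
  by (cases ts; cases ss) (auto simp: list_sums_def)

lemma sum_list_list_sums:
  fixes f :: "'a::ab_group_add \<Rightarrow> 'b::comm_monoid_add"
  shows "(\<Sum>u\<leftarrow>list_sums ts ss. f (x + u)) = (\<Sum>t\<leftarrow>ts. \<Sum>s\<leftarrow>ss. f (x + t + s))"
  unfolding list_sums_def
  by (induction ts) (auto simp: o_def add.assoc intro!: arg_cong[where f = sum_list])

lemma avg_list_sums: "avg (list_sums ts ss) F x = avg ts (avg ss F) x"
proof -
  have "(\<Sum>t\<leftarrow>ts. (\<Sum>s\<leftarrow>ss. F (x + t + s)) /\<^sub>R real (length ss)) =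
      (\<Sum>t\<leftarrow>ts. \<Sum>s\<leftarrow>ss. F (x + t + s)) /\<^sub>R real (length ss)"
    by (induction ts) (auto simp: scaleR_right_distrib)
  then show ?thesis
    by (simp add: avg_def sum_list_list_sums) (simp add: list_sums_def)
qed

text \<open>Commutativity of the group makes the order of two averages irrelevant; additivity of
  means rests on this.\<close>

lemma avg_commute: "avg ts (avg ss F) x = avg ss (avg ts F) x"
proof -
  have "(\<Sum>t\<leftarrow>ts. \<Sum>s\<leftarrow>ss. F (x + t + s)) = (\<Sum>s\<leftarrow>ss. \<Sum>t\<leftarrow>ts. F (x + s + t))"
    by (induction ts) (auto simp: sum_list_addf add_ac)
  then have "(\<Sum>u\<leftarrow>list_sums ts ss. F (x + u)) = (\<Sum>u\<leftarrow>list_sums ss ts. F (x + u))"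
    by (simp only: sum_list_list_sums)
  then show ?thesis
    unfolding avg_list_sums[symmetric]
    by (simp add: avg_def) (simp add: list_sums_def mult.commute)
qed

text \<open>On a totally bounded group every uniformly continuous function has exactly one such
  \<open>c\<close>, and it is the integral with respect to the normalised Haar measure of the
  completion.\<close>

definition is_mean :: "('a::ab_group_add \<Rightarrow> 'b::real_normed_vector) \<Rightarrow> 'b \<Rightarrow> bool" where
  "is_mean F c \<longleftrightarrow> (\<forall>e>0. \<exists>ts. ts \<noteq> [] \<and> (\<forall>x. norm (avg ts F x - c) \<le> e))"

lemma is_meanD:
  assumes "is_mean F c" "e > 0"
  obtains ts where "ts \<noteq> []" "\<And>x. norm (avg ts F x - c) \<le> e"
  using assms unfolding is_mean_def by blast

text \<open>Lists that are good for \<open>F\<close> and for \<open>H\<close> combine into one that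
  is good for both: a further average of a function within \<open>e / 2\<close> of a constant stays
  within \<open>e / 2\<close>.\<close>

lemma is_mean_add:
  assumes "is_mean F c" "is_mean H d"
  shows "is_mean (\<lambda>x. F x + H x) (c + d)"
  unfolding is_mean_def
proof (intro allI impI)
  fix e :: real assume "e > 0"
  then have "e / 2 > 0" by simp
  obtain ts where ts: "ts \<noteq> []" "\<And>x. norm (avg ts F x - c) \<le> e / 2"
    using is_meanD[OF assms(1) \<open>e / 2 > 0\<close>] by blast
  obtain ss where ss: "ss \<noteq> []" "\<And>x. norm (avg ss H x - d) \<le> e / 2"
    using is_meanD[OF assms(2) \<open>e / 2 > 0\<close>] by blast
  have "norm (avg (list_sums ss ts) (\<lambda>x. F x + H x) x - (c + d)) \<le> e" for x
  proof -
    have 1: "avg (list_sums ss ts) F x - c = avg ss (\<lambda>x. avg ts F x - c) x"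
      by (simp add: avg_list_sums avg_diff avg_const ss(1))
    have 2: "avg (list_sums ss ts) H x - d = avg ts (\<lambda>x. avg ss H x - d) x"
      by (simp add: avg_list_sums avg_diff avg_const ts(1) avg_commute[of ss])
    have "norm (avg (list_sums ss ts) (\<lambda>x. F x + H x) x - (c + d)) \<le>
        norm (avg (list_sums ss ts) F x - c) + norm (avg (list_sums ss ts) H x - d)"
      unfolding avg_add by (rule norm_diff_triangle_ineq)
    also have "\<dots> \<le> e / 2 + e / 2"
      unfolding 1 2 by (intro add_mono norm_avg_le ts ss)
    finally show ?thesis by simp
  qed
  then show "\<exists>ts. ts \<noteq> [] \<and> (\<forall>x. norm (avg ts (\<lambda>x. F x + H x) x - (c + d)) \<le> e)"
    using list_sums_neq_Nil[OF ss(1) ts(1)] by blast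
qed

lemma is_mean_bounded_linear:
  assumes "bounded_linear h" "is_mean F c"
  shows "is_mean (\<lambda>x. h (F x)) (h c)"
  unfolding is_mean_def
proof (intro allI impI)
  interpret h: bounded_linear h by fact
  fix e :: real assume "e > 0"
  obtain K where K: "K > 0" "\<And>x. norm (h x) \<le> norm x * K"
    using h.pos_bounded by blast
  obtain ts where ts: "ts \<noteq> []" "\<And>x. norm (avg ts F x - c) \<le> e / K"
    using is_meanD[OF assms(2), of "e / K"] \<open>e > 0\<close> K(1) by auto
  have "norm (avg ts (\<lambda>x. h (F x)) x - h c) \<le> e" for x
  proof -
    have "norm (avg ts (\<lambda>x. h (F x)) x - h c) = norm (h (avg ts F x - c))"
      by (simp add: avg_linear[OF h.linear] h.diff)
    also have "\<dots> \<le> e / K * K"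
      using K ts(2)[of x] by (meson mult_right_mono less_imp_le order_trans)
    finally show ?thesis using K by simp
  qed
  then show "\<exists>ts. ts \<noteq> [] \<and> (\<forall>x. norm (avg ts (\<lambda>x. h (F x)) x - h c) \<le> e)"
    using ts(1) by blast
qed

lemma is_mean_const: "is_mean (\<lambda>_. c) c"
  unfolding is_mean_def
proof (intro allI impI)
  fix e :: real assume "e > 0"
  then show "\<exists>ts. ts \<noteq> [] \<and> (\<forall>x::'a. norm (avg ts (\<lambda>_. c) x - c) \<le> e)"
    by (intro exI[of _ "[0]"]) (auto simp: avg_const)
qed

lemma is_mean_shift: "is_mean F c \<Longrightarrow> is_mean (\<lambda>x. F (x + a)) c"
  unfolding is_mean_def avg_shift by blast

lemma is_mean_reflect:
  assumes "is_mean F c"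
  shows "is_mean (\<lambda>x. F (- x)) c"
  unfolding is_mean_def
proof (intro allI impI)
  fix e :: real assume "e > 0"
  obtain ts where ts: "ts \<noteq> []" "\<And>x. norm (avg ts F x - c) \<le> e"
    using is_meanD[OF assms \<open>e > 0\<close>] by blast
  have "avg (map uminus ts) (\<lambda>x. F (- x)) x = avg ts F (- x)" for x
    by (simp add: avg_def o_def)
  with ts show "\<exists>ts. ts \<noteq> [] \<and> (\<forall>x. norm (avg ts (\<lambda>x. F (- x)) x - c) \<le> e)"
    by (intro exI[of _ "map uminus ts"]) auto
qed

lemma is_mean_norm_le:
  assumes "is_mean F c" "\<And>x. norm (F x) \<le> B"
  shows "norm c \<le> B"
proof (rule field_le_epsilon)
  fix e :: real assume "e > 0"
  obtain ts where ts: "ts \<noteq> []" "\<And>x. norm (avg ts F x - c) \<le> e"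
    using is_meanD[OF assms(1) \<open>e > 0\<close>] by blast
  have "norm c \<le> norm (avg ts F 0) + norm (avg ts F 0 - c)"
    by (metis norm_minus_commute norm_triangle_sub)
  also have "\<dots> \<le> B + e"
    by (intro add_mono norm_avg_le ts assms(2))
  finally show "norm c \<le> B + e" .
qed

lemma is_mean_diff:
  assumes "is_mean F c" "is_mean H d"
  shows "is_mean (\<lambda>x. F x - H x) (c - d)"
  using is_mean_add[OF assms(1) is_mean_bounded_linear[OF bounded_linear_minus[OF bounded_linear_ident] assms(2)]]
  by simp

lemma is_mean_unique:
  assumes "is_mean F c" "is_mean F d"
  shows "c = d"
  using is_mean_norm_le[OF is_mean_diff[OF assms], of 0] by simp

lemma is_mean_nonneg:
  fixes c :: real
  assumes "is_mean F c" "\<And>x. F x \<ge> 0"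
  shows "c \<ge> 0"
proof (rule field_le_epsilon)
  fix e :: real assume "e > 0"
  obtain ts where ts: "ts \<noteq> []" "\<And>x. norm (avg ts F x - c) \<le> e"
    using is_meanD[OF assms(1) \<open>e > 0\<close>] by blast
  have "0 \<le> avg ts F 0"
    using avg_mono[of "\<lambda>_. 0" F ts 0] assms(2) unfolding avg_const[OF ts(1)] by blast
  with ts(2)[of 0] show "0 \<le> c + e" by auto
qed

text \<open>Degenerate directions are allowed: in the application \<rho> vanishes at every period of
  the regularised function. The finite nets replace compactness throughout.\<close>

locale tb_pseudonorm =
  fixes \<rho> :: "'a::ab_group_add \<Rightarrow> real"
  assumes \<rho>_0: "\<rho> 0 = 0"
    and \<rho>_minus: "\<rho> (- x) = \<rho> x"
    and \<rho>_triangle: "\<rho> (x + y) \<le> \<rho> x + \<rho> y"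
    and \<rho>_totally_bounded: "e > 0 \<Longrightarrow> \<exists>T. finite T \<and> (\<forall>x. \<exists>t\<in>T. \<rho> (x - t) < e)"
begin

lemma \<rho>_nonneg: "\<rho> x \<ge> 0"
  using \<rho>_triangle[of x "- x"] \<rho>_0 \<rho>_minus[of x] by simp

lemma \<rho>_net:
  assumes "e > 0"
  obtains ts where "ts \<noteq> []" "\<And>x. \<exists>t\<in>set ts. \<rho> (x - t) < e"
proof -
  obtain T where "finite T" and T: "\<forall>x. \<exists>t\<in>T. \<rho> (x - t) < e"
    using \<rho>_totally_bounded[OF assms] by blast
  obtain ts where "set ts = T" using finite_list[OF \<open>finite T\<close>] by blast
  with T have "ts \<noteq> []" "\<And>x. \<exists>t\<in>set ts. \<rho> (x - t) < e" by fastforce+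
  then show ?thesis using that by blast
qed

section \<open>Functions uniformly continuous with respect to a totally bounded pseudonorm\<close>

definition uc :: "('a \<Rightarrow> 'b::real_normed_vector) set" where
  "uc = {F. \<forall>e>0. \<exists>d>0. \<forall>x y. \<rho> (x - y) < d \<longrightarrow> norm (F x - F y) \<le> e}"

lemma ucI: "(\<And>e. e > 0 \<Longrightarrow> \<exists>d>0. \<forall>x y. \<rho> (x - y) < d \<longrightarrow> norm (F x - F y) \<le> e) \<Longrightarrow> F \<in> uc"
  unfolding uc_def by blast

lemma ucD:
  assumes "F \<in> uc" "e > 0"
  obtains d where "d > 0" "\<And>x y. \<rho> (x - y) < d \<Longrightarrow> norm (F x - F y) \<le> e"
  using assms unfolding uc_def by blast

lemma uc_bounded:
  assumes "F \<in> uc"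
  obtains B where "B > 0" "\<And>x. norm (F x) \<le> B"
proof -
  obtain d where d: "d > 0" "\<And>x y. \<rho> (x - y) < d \<Longrightarrow> norm (F x - F y) \<le> 1"
    using ucD[OF assms, of 1] by auto
  obtain ts where ts: "ts \<noteq> []" "\<And>x. \<exists>t\<in>set ts. \<rho> (x - t) < d"
    using \<rho>_net[OF d(1)] by blast
  define B where "B = 1 + Max ((\<lambda>t. norm (F t)) ` set ts)"
  have B: "norm (F x) \<le> B" for x
  proof -
    obtain t where t: "t \<in> set ts" "\<rho> (x - t) < d" using ts(2) by blast
    have "norm (F x) \<le> norm (F t) + norm (F x - F t)" by (rule norm_triangle_sub)
    also have "\<dots> \<le> Max ((\<lambda>t. norm (F t)) ` set ts) + 1"
      using t d(2)[OF t(2)] by (intro add_mono) (auto intro: Max_ge)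
    finally show ?thesis by (simp add: B_def)
  qed
  have "norm (F x) \<le> max 1 B" for x using B[of x] by simp
  then show ?thesis using that[of "max 1 B"] by simp
qed

lemma uc_dominated:
  assumes "H \<in> uc" and le: "\<And>x y. norm (F x - F y) \<le> norm (H x - H y) * B" and "B > 0"
  shows "F \<in> uc"
proof (rule ucI)
  fix e :: real assume "e > 0"
  obtain d where d: "d > 0" "\<And>x y. \<rho> (x - y) < d \<Longrightarrow> norm (H x - H y) \<le> e / B"
    using ucD[OF assms(1), of "e / B"] \<open>e > 0\<close> \<open>B > 0\<close> by auto
  have "norm (F x - F y) \<le> e" if "\<rho> (x - y) < d" for x y
    using le[of x y] mult_right_mono[OF d(2)[OF that], of B] \<open>B > 0\<close> by simp
  with d(1) show "\<exists>d>0. \<forall>x y. \<rho> (x - y) < d \<longrightarrow> norm (F x - F y) \<le> e" by blast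
qed

lemma uc_bounded_linear:
  assumes "bounded_linear h" "F \<in> uc"
  shows "(\<lambda>x. h (F x)) \<in> uc"
proof -
  interpret h: bounded_linear h by fact
  obtain K where K: "K > 0" "\<And>x. norm (h x) \<le> norm x * K" using h.pos_bounded by blast
  show ?thesis by (rule uc_dominated[OF assms(2) _ K(1)]) (use K(2) in \<open>simp flip: h.diff\<close>)
qed

lemma uc_add:
  assumes "F \<in> uc" "H \<in> uc"
  shows "(\<lambda>x. F x + H x) \<in> uc"
proof (rule ucI)
  fix \<epsilon> :: real assume "\<epsilon> > 0"
  then have e: "\<epsilon> / 2 > 0" by simp
  obtain d where d: "d > 0" "\<And>x y. \<rho> (x - y) < d \<Longrightarrow> norm (F x - F y) \<le> \<epsilon> / 2"
    using ucD[OF assms(1) e] by blast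
  obtain d' where d': "d' > 0" "\<And>x y. \<rho> (x - y) < d' \<Longrightarrow> norm (H x - H y) \<le> \<epsilon> / 2"
    using ucD[OF assms(2) e] by blast
  have "norm (F x + H x - (F y + H y)) \<le> \<epsilon>" if "\<rho> (x - y) < min d d'" for x y
    using norm_diff_triangle_ineq[of "F x" "H x" "F y" "H y"] d(2)[of x y] d'(2)[of x y] that by simp
  with d(1) d'(1) show "\<exists>d>0. \<forall>x y. \<rho> (x - y) < d \<longrightarrow> norm (F x + H x - (F y + H y)) \<le> \<epsilon>"
    by (intro exI[of _ "min d d'"]) auto
qed

lemma uc_diff:
  assumes "F \<in> uc" "H \<in> uc"
  shows "(\<lambda>x. F x - H x) \<in> uc"
  using uc_add[OF assms(1) uc_bounded_linear[OF bounded_linear_minus[OF bounded_linear_ident] assms(2)]] by simp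

lemma uc_mult:
  fixes F :: "'a \<Rightarrow> 'b::real_normed_algebra"
  assumes "F \<in> uc" "H \<in> uc"
  shows "(\<lambda>x. F x * H x) \<in> uc"
proof (rule ucI)
  fix e :: real assume "e > 0"
  obtain B where B: "B > 0" "\<And>x. norm (F x) \<le> B" using uc_bounded[OF assms(1)] by blast
  obtain C where C: "C > 0" "\<And>x. norm (H x) \<le> C" using uc_bounded[OF assms(2)] by blast
  obtain d where d: "d > 0" "\<And>x y. \<rho> (x - y) < d \<Longrightarrow> norm (F x - F y) \<le> e / (2 * C)"
    using ucD[OF assms(1), of "e / (2 * C)"] C(1) \<open>e > 0\<close> by auto
  obtain d' where d': "d' > 0" "\<And>x y. \<rho> (x - y) < d' \<Longrightarrow> norm (H x - H y) \<le> e / (2 * B)"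
    using ucD[OF assms(2), of "e / (2 * B)"] B(1) \<open>e > 0\<close> by auto
  have "norm (F x * H x - F y * H y) \<le> e" if "\<rho> (x - y) < min d d'" for x y
  proof -
    have "F x * H x - F y * H y = (F x - F y) * H x + F y * (H x - H y)"
      by (simp add: algebra_simps)
    also have "norm \<dots> \<le> norm (F x - F y) * norm (H x) + norm (F y) * norm (H x - H y)"
      by (intro order_trans[OF norm_triangle_ineq] add_mono norm_mult_ineq)
    also have "\<dots> \<le> e / (2 * C) * C + B * (e / (2 * B))"
      using that d(2)[of x y] d'(2)[of x y] B C \<open>e > 0\<close>
      by (intro add_mono mult_mono) (auto intro: less_imp_le)
    also have "\<dots> = e" using B(1) C(1) by (simp add: field_simps)
    finally show ?thesis .
  qed
  with d(1) d'(1) show "\<exists>d>0. \<forall>x y. \<rho> (x - y) < d \<longrightarrow> norm (F x * H x - F y * H y) \<le> e"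
    by (intro exI[of _ "min d d'"]) auto
qed

text \<open>Besides shifts and reflections this covers projections and embeddings between the group
  and its square, which is why the two groups may differ in type.\<close>

lemma uc_compose:
  assumes "tb_pseudonorm \<rho>'" "F \<in> uc" "\<And>z w. \<rho> (g z - g w) \<le> \<rho>' (z - w)"
  shows "(\<lambda>z. F (g z)) \<in> tb_pseudonorm.uc \<rho>'"
proof -
  interpret r': tb_pseudonorm \<rho>' by fact
  show ?thesis
  proof (rule r'.ucI)
    fix e :: real assume "e > 0"
    obtain d where d: "d > 0" "\<And>x y. \<rho> (x - y) < d \<Longrightarrow> norm (F x - F y) \<le> e"
      using ucD[OF assms(2) \<open>e > 0\<close>] by blast
    have "norm (F (g z) - F (g w)) \<le> e" if "\<rho>' (z - w) < d" for z w
      using d(2) assms(3)[of z w] that by auto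
    with d(1) show "\<exists>d>0. \<forall>z w. \<rho>' (z - w) < d \<longrightarrow> norm (F (g z) - F (g w)) \<le> e" by blast
  qed
qed

lemma uc_shift: "F \<in> uc \<Longrightarrow> (\<lambda>x. F (x + a)) \<in> uc"
  by (rule uc_compose[OF tb_pseudonorm_axioms]) auto

lemma uc_reflect: "F \<in> uc \<Longrightarrow> (\<lambda>x. F (- x)) \<in> uc"
  by (rule uc_compose[OF tb_pseudonorm_axioms], assumption)
    (metis \<rho>_minus minus_diff_minus order_refl)

lemma uc_limit:
  assumes "\<And>n. u n \<in> uc" "uniform_limit UNIV u F sequentially"
  shows "F \<in> uc"
proof (rule ucI)
  fix e :: real assume "e > 0"
  then have "e / 3 > 0" by simp
  then have "\<forall>\<^sub>F n in sequentially. \<forall>x\<in>UNIV. dist (u n x) (F x) < e / 3"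
    using assms(2) unfolding uniform_limit_iff by blast
  then obtain n where n: "\<And>x. dist (u n x) (F x) < e / 3"
    unfolding eventually_sequentially by auto
  obtain d where d: "d > 0" "\<And>x y. \<rho> (x - y) < d \<Longrightarrow> norm (u n x - u n y) \<le> e / 3"
    using ucD[OF assms(1) \<open>e / 3 > 0\<close>] by blast
  have "norm (F x - F y) \<le> e" if "\<rho> (x - y) < d" for x y
    using n[of x] n[of y] d(2)[OF that] unfolding dist_norm by norm
  with d(1) show "\<exists>d>0. \<forall>x y. \<rho> (x - y) < d \<longrightarrow> norm (F x - F y) \<le> e" by blast
qed

text \<open>The number \<open>s\<close> is the lowest level to which averaging can push the supremum
  of \<open>F\<close>. Let \<open>h\<close> be an average whose supremum is nearly \<open>s\<close>.
  If \<open>h\<close> fell below \<open>s - e\<close> at some point, uniform continuity would make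
  it low on a ball, and averaging \<open>h\<close> over a finite net, which reaches that ball from
  every point, would push the supremum below \<open>s\<close>.\<close>

lemma is_mean_exists_real:
  fixes F :: "'a \<Rightarrow> real"
  assumes "F \<in> uc"
  shows "\<exists>c. is_mean F c"
proof -
  define S where "S = {b. \<exists>ts. ts \<noteq> [] \<and> (\<forall>x. avg ts F x \<le> b)}"
  obtain B where B: "B > 0" "\<And>x. norm (F x) \<le> B" using uc_bounded[OF assms] by blast
  have "avg [0] F x \<le> B" for x using B(2)[of x] by (simp add: avg_def)
  then have "B \<in> S" unfolding S_def by blast
  have "- B \<le> b" if b: "b \<in> S" for b
  proof -
    obtain ts where "ts \<noteq> []" "avg ts F 0 \<le> b" using b unfolding S_def by blast
    moreover have "norm (avg ts F 0) \<le> B"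
      using calculation(1) B(2) by (rule norm_avg_le)
    ultimately show ?thesis by simp
  qed
  then have bdd: "bdd_below S" by (rule bdd_belowI)
  define s where "s = Inf S"
  have "is_mean F s"
    unfolding is_mean_def
  proof (intro allI impI)
    fix e :: real assume "e > 0"
    then have "e / 2 > 0" by simp
    obtain d where d: "d > 0" "\<And>x y. \<rho> (x - y) < d \<Longrightarrow> norm (F x - F y) \<le> e / 2"
      using ucD[OF assms \<open>e / 2 > 0\<close>] by blast
    obtain ns where ns: "ns \<noteq> []" "\<And>x. \<exists>t\<in>set ns. \<rho> (x - t) < d"
      using \<rho>_net[OF d(1)] by blast
    define n where "n = real (length ns)"
    have "n \<ge> 1" using ns(1) by (cases ns) (auto simp: n_def)
    \<comment> \<open>The tolerance is divided by the size \<open>n\<close> of the net: only one of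
      the \<open>n\<close> terms of an average is known to be low, and the \<open>n - 1\<close>
      others together may exceed their share by at most \<open>e / 2\<close>.\<close>
    obtain b where b: "b \<in> S" "b < s + e / (2 * n)"
      using cInf_lessD[of S "s + e / (2 * n)"] \<open>B \<in> S\<close> \<open>e > 0\<close> \<open>n \<ge> 1\<close> by (auto simp: s_def)
    obtain ts where ts: "ts \<noteq> []" "\<And>x. avg ts F x \<le> b" using b(1) unfolding S_def by blast
    define h where "h = avg ts F"
    have h_uc: "\<bar>h x - h y\<bar> \<le> e / 2" if "\<rho> (x - y) < d" for x y
    proof -
      have "h x - h y = avg ts (\<lambda>z. F (z + x) - F (z + y)) 0"
        by (simp add: h_def avg_diff avg_shift)
      also have "norm \<dots> \<le> e / 2"
        by (rule norm_avg_le[OF ts(1)], rule d(2)) (use that in \<open>simp add: algebra_simps\<close>)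
      finally show ?thesis by simp
    qed
    have low: "s - e \<le> h x0" for x0
    proof -
      have "avg ns h x \<le> (h x0 + e / 2 + (n - 1) * b) / n" for x
      proof -
        obtain t where t: "t \<in> set ns" "\<rho> (x0 - x - t) < d" using ns(2) by blast
        obtain ps qs where ps: "ns = ps @ t # qs" using t(1) by (meson split_list)
        have "(\<Sum>t\<leftarrow>ns. h (x + t)) = (\<Sum>t\<leftarrow>ps @ qs. h (x + t)) + h (x + t)"
          by (simp add: ps)
        also have "\<dots> \<le> (\<Sum>t\<leftarrow>ps @ qs. b) + (h x0 + e / 2)"
        proof (intro add_mono sum_list_mono)
          have "\<bar>h x0 - h (x + t)\<bar> \<le> e / 2" using h_uc[of x0 "x + t"] t(2) by (simp add: diff_diff_eq)
          then show "h (x + t) \<le> h x0 + e / 2" by (simp only: abs_le_iff) linarith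
        qed (use ts(2) in \<open>simp add: h_def\<close>)
        also have "(\<Sum>t\<leftarrow>ps @ qs. b) = (n - 1) * b"
          by (simp only: sum_list_triv n_def ps) (simp add: algebra_simps)
        finally show ?thesis
          using \<open>n \<ge> 1\<close> by (simp add: avg_def n_def divide_simps)
      qed
      then have "\<forall>x. avg (list_sums ns ts) F x \<le> (h x0 + e / 2 + (n - 1) * b) / n"
        by (simp add: avg_list_sums h_def)
      then have "(h x0 + e / 2 + (n - 1) * b) / n \<in> S"
        unfolding S_def using list_sums_neq_Nil[OF ns(1) ts(1)] by blast
      then have "s \<le> (h x0 + e / 2 + (n - 1) * b) / n"
        unfolding s_def using bdd by (rule cInf_lower)
      then have "s * n \<le> h x0 + e / 2 + (n - 1) * b"
        using \<open>n \<ge> 1\<close> by (simp add: pos_le_divide_eq)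
      also have "\<dots> \<le> h x0 + e / 2 + (n - 1) * (s + e / (2 * n))"
        using b(2) \<open>n \<ge> 1\<close> by (intro add_left_mono mult_left_mono) auto
      also have "(n - 1) * (s + e / (2 * n)) = s * n - s + e / 2 - e / (2 * n)"
        using \<open>n \<ge> 1\<close> by (simp add: field_simps)
      finally have "s \<le> h x0 + e - e / (2 * n)" by simp
      also have "\<dots> \<le> h x0 + e" using \<open>n \<ge> 1\<close> \<open>e > 0\<close> by simp
      finally show ?thesis by simp
    qed
    have "e / (2 * n) \<le> e" using \<open>n \<ge> 1\<close> \<open>e > 0\<close> by (simp add: divide_simps)
    then have "h x \<le> s + e" for x using ts(2)[of x] b(2) by (simp add: h_def)
    with low have "\<forall>x. norm (avg ts F x - s) \<le> e"
      by (auto simp: h_def abs_le_iff algebra_simps)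
    with ts(1) show "\<exists>ts. ts \<noteq> [] \<and> (\<forall>x. norm (avg ts F x - s) \<le> e)" by blast
  qed
  then show ?thesis ..
qed

lemma is_mean_exists:
  fixes F :: "'a \<Rightarrow> complex"
  assumes "F \<in> uc"
  shows "\<exists>c. is_mean F c"
proof -
  obtain a where a: "is_mean (\<lambda>x. Re (F x)) a"
    using is_mean_exists_real[OF uc_bounded_linear[OF bounded_linear_Re assms]] by blast
  obtain b where b: "is_mean (\<lambda>x. Im (F x)) b"
    using is_mean_exists_real[OF uc_bounded_linear[OF bounded_linear_Im assms]] by blast
  have "is_mean (\<lambda>x. of_real (Re (F x)) + \<i> * of_real (Im (F x))) (of_real a + \<i> * of_real b)"
    by (intro is_mean_add is_mean_bounded_linear[OF bounded_linear_of_real a]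
        is_mean_bounded_linear[OF bounded_linear_mult_right is_mean_bounded_linear[OF bounded_linear_of_real b]])
  then show ?thesis by (auto simp flip: complex_eq)
qed

end

section \<open>Convolution\<close>

lemma is_mean_sum_list:
  assumes "\<And>a. is_mean (G a) (c a)"
  shows "is_mean (\<lambda>x. \<Sum>a\<leftarrow>us. G a x) (\<Sum>a\<leftarrow>us. c a)"
  by (induction us) (auto intro: is_mean_add is_mean_const assms)

context tb_pseudonorm
begin

abbreviation \<rho>\<rho> :: "'a \<times> 'a \<Rightarrow> real" where
  "\<rho>\<rho> \<equiv> \<lambda>z. \<rho> (fst z) + \<rho> (snd z)"

text \<open>Double means become means on the square group, so that interchanging them is a matter of
  uniqueness of the mean there.\<close>

lemma tb_prod: "tb_pseudonorm \<rho>\<rho>"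
proof
  fix x y :: "'a \<times> 'a" and e :: real
  show "\<rho>\<rho> 0 = 0" by (simp add: \<rho>_0)
  show "\<rho>\<rho> (- x) = \<rho>\<rho> x" by (simp add: \<rho>_minus)
  show "\<rho>\<rho> (x + y) \<le> \<rho>\<rho> x + \<rho>\<rho> y"
    using \<rho>_triangle[of "fst x" "fst y"] \<rho>_triangle[of "snd x" "snd y"] by simp
  assume "e > 0"
  then have "e / 2 > 0" by simp
  then obtain T where T: "finite T" "\<And>x. \<exists>t\<in>T. \<rho> (x - t) < e / 2"
    using \<rho>_totally_bounded by blast
  have "\<exists>t\<in>T \<times> T. \<rho>\<rho> (z - t) < e" for z
  proof -
    obtain t s where "t \<in> T" "\<rho> (fst z - t) < e / 2" "s \<in> T" "\<rho> (snd z - s) < e / 2"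
      using T(2) by blast
    then show ?thesis by (intro bexI[of _ "(t, s)"]) auto
  qed
  with T(1) show "\<exists>T. finite T \<and> (\<forall>x. \<exists>t\<in>T. \<rho>\<rho> (x - t) < e)"
    by (intro exI[of _ "T \<times> T"]) auto
qed

section \<open>The mean value and iterated means\<close>

definition M :: "('a \<Rightarrow> 'b::real_normed_vector) \<Rightarrow> 'b" where
  "M F = (THE c. is_mean F c)"

lemma M_eqI: "is_mean F c \<Longrightarrow> M F = c"
  unfolding M_def by (rule the_equality) (auto intro: is_mean_unique)

lemma M_is_mean: "F \<in> uc \<Longrightarrow> is_mean F (M F)" for F :: "'a \<Rightarrow> complex"
  using is_mean_exists M_eqI by blast

lemma M_is_mean_real: "F \<in> uc \<Longrightarrow> is_mean F (M F)" for F :: "'a \<Rightarrow> real"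
  using is_mean_exists_real M_eqI by blast

lemma M_const: "M (\<lambda>_. c) = c"
  by (intro M_eqI is_mean_const)

lemma M_add:
  fixes F :: "'a \<Rightarrow> complex"
  shows "F \<in> uc \<Longrightarrow> H \<in> uc \<Longrightarrow> M (\<lambda>x. F x + H x) = M F + M H"
  by (intro M_eqI is_mean_add M_is_mean)

lemma M_diff:
  fixes F :: "'a \<Rightarrow> complex"
  shows "F \<in> uc \<Longrightarrow> H \<in> uc \<Longrightarrow> M (\<lambda>x. F x - H x) = M F - M H"
  by (intro M_eqI is_mean_diff M_is_mean)

lemma M_cmult:
  fixes F :: "'a \<Rightarrow> complex"
  shows "F \<in> uc \<Longrightarrow> M (\<lambda>x. c * F x) = c * M F"
  by (intro M_eqI is_mean_bounded_linear[OF bounded_linear_mult_right] M_is_mean)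

lemma M_cnj:
  fixes F :: "'a \<Rightarrow> complex"
  shows "F \<in> uc \<Longrightarrow> M (\<lambda>x. cnj (F x)) = cnj (M F)"
  by (intro M_eqI is_mean_bounded_linear[OF bounded_linear_cnj] M_is_mean)

lemma M_shift:
  fixes F :: "'a \<Rightarrow> complex"
  shows "F \<in> uc \<Longrightarrow> M (\<lambda>x. F (x + a)) = M F"
  by (intro M_eqI is_mean_shift M_is_mean)

lemma M_reflect:
  fixes F :: "'a \<Rightarrow> complex"
  assumes "F \<in> uc"
  shows "M (\<lambda>x. F (a - x)) = M F"
  using M_eqI[OF is_mean_reflect[OF is_mean_shift[OF M_is_mean[OF assms], of a]]]
  by (simp add: add.commute[of "- _" a])

lemma norm_M_le:
  fixes F :: "'a \<Rightarrow> complex"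
  shows "F \<in> uc \<Longrightarrow> (\<And>x. norm (F x) \<le> B) \<Longrightarrow> norm (M F) \<le> B"
  by (rule is_mean_norm_le[OF M_is_mean])

lemma uc_scale: "F \<in> uc \<Longrightarrow> (\<lambda>x. c * F x) \<in> uc" for F :: "'a \<Rightarrow> complex"
  by (rule uc_bounded_linear[OF bounded_linear_mult_right])

lemma uc_cnj: "F \<in> uc \<Longrightarrow> (\<lambda>x. cnj (F x)) \<in> uc"
  by (rule uc_bounded_linear[OF bounded_linear_cnj])

lemma uc_reflect_shift:
  assumes "F \<in> uc"
  shows "(\<lambda>x. F (a - x)) \<in> uc"
  using uc_reflect[OF uc_shift[OF assms, of a]] by (simp add: add.commute[of "- _" a])

text \<open>A list \<open>us\<close> of pairs that is good for \<open>k\<close> on the square yields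
  its first components as a list for the inner mean: the second components only shift the variable
  of that mean, which leaves it unchanged.\<close>

lemma M_iterated:
  fixes k :: "'a \<times> 'a \<Rightarrow> complex"
  assumes k: "k \<in> tb_pseudonorm.uc \<rho>\<rho>" and "is_mean k c"
  shows "M (\<lambda>s. M (\<lambda>t. k (s, t))) = c"
proof (rule M_eqI)
  interpret prod: tb_pseudonorm \<rho>\<rho> by (rule tb_prod)
  have k_uc: "(\<lambda>t. k (s, t)) \<in> uc" for s
    by (rule prod.uc_compose[OF tb_pseudonorm_axioms k]) (simp add: \<rho>_0)
  define H where "H = (\<lambda>s. M (\<lambda>t. k (s, t)))"
  show "is_mean (\<lambda>s. M (\<lambda>t. k (s, t))) c"
    unfolding is_mean_def
  proof (intro allI impI)
    fix e :: real assume "e > 0"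
    obtain us where us: "us \<noteq> []" "\<And>z. norm (avg us k z - c) \<le> e"
      using is_meanD[OF assms(2) \<open>e > 0\<close>] by blast
    have "norm (avg (map fst us) H s - c) \<le> e" for s
    proof -
      have "is_mean (\<lambda>t. k (s + fst u, t + snd u)) (H (s + fst u))" for u
        unfolding H_def by (rule is_mean_shift[OF M_is_mean[OF k_uc]])
      then have "is_mean (\<lambda>t. \<Sum>u\<leftarrow>us. k (s + fst u, t + snd u)) (\<Sum>u\<leftarrow>us. H (s + fst u))"
        by (rule is_mean_sum_list)
      then have "is_mean (\<lambda>t. (\<Sum>u\<leftarrow>us. k (s + fst u, t + snd u)) /\<^sub>R real (length us))
          ((\<Sum>u\<leftarrow>us. H (s + fst u)) /\<^sub>R real (length us))"
        by (rule is_mean_bounded_linear[OF bounded_linear_scaleR_right])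
      then have "is_mean (\<lambda>t. avg us k (s, t)) (avg (map fst us) H s)"
        by (simp add: avg_def o_def plus_prod_def)
      from is_mean_norm_le[OF is_mean_diff[OF this is_mean_const[of c]] us(2)] show ?thesis .
    qed
    with us(1) show "\<exists>ts. ts \<noteq> [] \<and> (\<forall>x. norm (avg ts (\<lambda>s. M (\<lambda>t. k (s, t))) x - c) \<le> e)"
      unfolding H_def by (intro exI[of _ "map fst us"]) auto
  qed
qed

text \<open>Exchanging the coordinates preserves the mean on the square, and
  \<open>M_iterated\<close> identifies both iterated means with that one number.\<close>

lemma M_swap:
  fixes k :: "'a \<times> 'a \<Rightarrow> complex"
  assumes k: "k \<in> tb_pseudonorm.uc \<rho>\<rho>"
  shows "M (\<lambda>s. M (\<lambda>t. k (s, t))) = M (\<lambda>t. M (\<lambda>s. k (s, t)))"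
proof -
  interpret prod: tb_pseudonorm \<rho>\<rho> by (rule tb_prod)
  obtain c where c: "is_mean k c" using prod.is_mean_exists[OF k] by blast
  have "is_mean (\<lambda>z. k (prod.swap z)) c"
    unfolding is_mean_def
  proof (intro allI impI)
    fix e :: real assume "e > 0"
    obtain us where us: "us \<noteq> []" "\<And>z. norm (avg us k z - c) \<le> e"
      using is_meanD[OF c \<open>e > 0\<close>] by blast
    have "avg (map prod.swap us) (\<lambda>z. k (prod.swap z)) z = avg us k (prod.swap z)" for z
      by (simp add: avg_def o_def plus_prod_def)
    with us show "\<exists>us. us \<noteq> [] \<and> (\<forall>z. norm (avg us (\<lambda>z. k (prod.swap z)) z - c) \<le> e)"
      by (intro exI[of _ "map prod.swap us"]) auto
  qed
  moreover have "(\<lambda>z. k (prod.swap z)) \<in> prod.uc"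
    by (rule prod.uc_compose[OF tb_prod k]) simp
  ultimately have "M (\<lambda>s. M (\<lambda>t. k (prod.swap (s, t)))) = c"
    by (intro M_iterated)
  with M_iterated[OF k c] show ?thesis by simp
qed

section \<open>The convolution algebra\<close>

definition conv :: "('a \<Rightarrow> complex) \<Rightarrow> ('a \<Rightarrow> complex) \<Rightarrow> 'a \<Rightarrow> complex" where
  "conv F H x = M (\<lambda>t. F (x - t) * H t)"

lemma uc_conv_integrand:
  fixes F H :: "'a \<Rightarrow> complex"
  shows "F \<in> uc \<Longrightarrow> H \<in> uc \<Longrightarrow> (\<lambda>t. F (x - t) * H t) \<in> uc"
  by (intro uc_mult uc_reflect_shift)

lemma conv_commute:
  assumes "F \<in> uc" "H \<in> uc"
  shows "conv F H = conv H F"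
proof
  fix x
  show "conv F H x = conv H F x"
    using M_reflect[OF uc_conv_integrand[OF assms, of x], of x]
    by (simp add: conv_def mult.commute)
qed

lemma uc_conv:
  assumes F: "F \<in> uc" and H: "H \<in> uc"
  shows "conv F H \<in> uc"
proof (rule ucI)
  fix e :: real assume "e > 0"
  obtain B where B: "B > 0" "\<And>x. norm (H x) \<le> B" using uc_bounded[OF H] by blast
  obtain d where d: "d > 0" "\<And>x y. \<rho> (x - y) < d \<Longrightarrow> norm (F x - F y) \<le> e / B"
    using ucD[OF F, of "e / B"] B(1) \<open>e > 0\<close> by auto
  have "norm (conv F H x - conv F H y) \<le> e" if xy: "\<rho> (x - y) < d" for x y
  proof -
    have "norm (M (\<lambda>t. F (x - t) * H t - F (y - t) * H t)) \<le> e"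
    proof (rule norm_M_le)
      show "(\<lambda>t. F (x - t) * H t - F (y - t) * H t) \<in> uc"
        by (intro uc_diff uc_conv_integrand F H)
      fix t
      have "norm (F (x - t) * H t - F (y - t) * H t) = norm (F (x - t) - F (y - t)) * norm (H t)"
        by (simp add: left_diff_distrib[symmetric] norm_mult)
      also have "\<dots> \<le> e / B * B"
        using B xy \<open>e > 0\<close> by (intro mult_mono d(2)) auto
      finally show "norm (F (x - t) * H t - F (y - t) * H t) \<le> e" using B(1) by simp
    qed
    then show ?thesis by (simp add: conv_def M_diff uc_conv_integrand F H)
  qed
  with d(1) show "\<exists>d>0. \<forall>x y. \<rho> (x - y) < d \<longrightarrow> norm (conv F H x - conv F H y) \<le> e" by blast
qed

lemma conv_add_right:
  "F \<in> uc \<Longrightarrow> H \<in> uc \<Longrightarrow> L \<in> uc \<Longrightarrow>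
    conv F (\<lambda>x. H x + L x) x = conv F H x + conv F L x"
  unfolding conv_def distrib_left by (intro M_add uc_conv_integrand)

lemma conv_diff_right:
  "F \<in> uc \<Longrightarrow> H \<in> uc \<Longrightarrow> L \<in> uc \<Longrightarrow>
    conv F (\<lambda>x. H x - L x) x = conv F H x - conv F L x"
  unfolding conv_def right_diff_distrib by (intro M_diff uc_conv_integrand)

lemma conv_scale_right:
  "F \<in> uc \<Longrightarrow> H \<in> uc \<Longrightarrow> conv F (\<lambda>x. c * H x) x = c * conv F H x"
  unfolding conv_def mult.left_commute[of _ c] by (intro M_cmult uc_conv_integrand)

lemma conv_diff_left:
  "F \<in> uc \<Longrightarrow> H \<in> uc \<Longrightarrow> L \<in> uc \<Longrightarrow>
    conv (\<lambda>x. H x - L x) F x = conv H F x - conv L F x"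
  unfolding conv_def left_diff_distrib by (intro M_diff uc_conv_integrand)

lemma conv_scale_left:
  "F \<in> uc \<Longrightarrow> H \<in> uc \<Longrightarrow> conv (\<lambda>x. c * H x) F x = c * conv H F x"
  unfolding conv_def mult.assoc by (intro M_cmult uc_conv_integrand)

lemma conv_shift_left: "conv (\<lambda>x. F (x + a)) H x = conv F H (x + a)"
  by (simp add: conv_def algebra_simps)

lemma conv_shift_right:
  assumes "F \<in> uc" "H \<in> uc"
  shows "conv F (\<lambda>x. H (x + a)) x = conv F H (x + a)"
  unfolding conv_commute[OF assms(1) uc_shift[OF assms(2)]] conv_commute[OF assms]
  by (rule conv_shift_left)

lemma conv_assoc:
  assumes F: "F \<in> uc" and H: "H \<in> uc" and L: "L \<in> uc"
  shows "conv (conv F H) L = conv F (conv H L)"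
proof
  fix x
  interpret prod: tb_pseudonorm \<rho>\<rho> by (rule tb_prod)
  \<comment> \<open>For fixed \<open>x\<close> both ways of bracketing are iterated means of this
    one kernel; they differ in the order of the variables and in a shift of \<open>s\<close> by
    \<open>t\<close>.\<close>
  define k where "k = (\<lambda>z. F (x - fst z) * (H (fst z - snd z) * L (snd z)))"
  have "k \<in> prod.uc"
    unfolding k_def
  proof (intro prod.uc_mult)
    show "(\<lambda>z. F (x - fst z)) \<in> prod.uc"
      by (rule uc_compose[OF tb_prod uc_reflect_shift[OF F, of x]]) (simp add: \<rho>_nonneg)
    show "(\<lambda>z. L (snd z)) \<in> prod.uc"
      by (rule uc_compose[OF tb_prod L]) (simp add: \<rho>_nonneg)
    show "(\<lambda>z. H (fst z - snd z)) \<in> prod.uc"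
    proof (rule uc_compose[OF tb_prod H])
      fix z w :: "'a \<times> 'a"
      show "\<rho> (fst z - snd z - (fst w - snd w)) \<le> \<rho>\<rho> (z - w)"
        using \<rho>_triangle[of "fst z - fst w" "- (snd z - snd w)"] \<rho>_minus[of "snd z - snd w"]
        by (simp add: algebra_simps)
    qed
  qed
  have "conv F (conv H L) x = M (\<lambda>s. M (\<lambda>t. k (s, t)))"
    by (simp add: conv_def k_def M_cmult uc_conv_integrand[unfolded conv_def] H L)
  also have "\<dots> = M (\<lambda>t. M (\<lambda>s. k (s, t)))"
    by (rule M_swap) fact
  also have "\<dots> = M (\<lambda>t. conv F H (x - t) * L t)"
  proof (rule arg_cong[where f = M], rule ext)
    fix t
    have 1: "(\<lambda>s. F (x - t - s) * H s) \<in> uc" by (rule uc_conv_integrand[OF F H])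
    have "M (\<lambda>s. k (s, t)) = M (\<lambda>s. L t * (F (x - t - (s - t)) * H (s - t)))"
      by (simp add: k_def mult_ac)
    also have "\<dots> = L t * M (\<lambda>s. F (x - t - (s - t)) * H (s - t))"
      using uc_shift[OF 1, of "- t"] by (intro M_cmult) simp
    also have "M (\<lambda>s. F (x - t - (s - t)) * H (s - t)) = conv F H (x - t)"
      using M_shift[OF 1, of "- t"] by (simp add: conv_def)
    finally show "M (\<lambda>s. k (s, t)) = conv F H (x - t) * L t" by (simp add: mult.commute)
  qed
  finally show "conv (conv F H) L x = conv F (conv H L) x" by (simp add: conv_def)
qed

text \<open>The involution of the convolution algebra. Its fixed points are the kernels whose
  convolution operators are self-adjoint for the inner product given by \<open>M\<close>.\<close>

definition tilde :: "('a \<Rightarrow> complex) \<Rightarrow> 'a \<Rightarrow> complex" where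
  "tilde F x = cnj (F (- x))"

lemma uc_tilde: "F \<in> uc \<Longrightarrow> tilde F \<in> uc"
  unfolding tilde_def[abs_def] by (intro uc_cnj uc_reflect)

lemma tilde_tilde [simp]: "tilde (tilde F) = F"
  by (simp add: tilde_def[abs_def])

lemma tilde_conv:
  assumes F: "F \<in> uc" and H: "H \<in> uc"
  shows "tilde (conv F H) = conv (tilde F) (tilde H)"
proof
  fix x
  have "tilde (conv F H) x = M (\<lambda>t. cnj (F (- x - t) * H t))"
    unfolding tilde_def conv_def by (rule M_cnj[symmetric]) (rule uc_conv_integrand[OF F H])
  also have "\<dots> = M (\<lambda>t. cnj (F (- x - (0 - t)) * H (0 - t)))"
    by (rule M_reflect[symmetric]) (intro uc_cnj uc_conv_integrand F H)
  also have "\<dots> = conv (tilde F) (tilde H) x"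
    by (simp add: conv_def tilde_def)
  finally show "tilde (conv F H) x = conv (tilde F) (tilde H) x" .
qed

section \<open>The mean-square norm\<close>

definition n2 :: "('a \<Rightarrow> complex) \<Rightarrow> real" where
  "n2 F = M (\<lambda>t. (cmod (F t))\<^sup>2)"

lemma uc_norm: "F \<in> uc \<Longrightarrow> (\<lambda>x. norm (F x)) \<in> uc"
  by (rule uc_dominated[where B = 1]) (auto intro: norm_triangle_ineq3)

lemma uc_norm_squared: "F \<in> uc \<Longrightarrow> (\<lambda>t. (cmod (F t))\<^sup>2) \<in> uc"
  unfolding power2_eq_square by (intro uc_mult uc_norm)

lemma is_mean_n2: "F \<in> uc \<Longrightarrow> is_mean (\<lambda>t. (cmod (F t))\<^sup>2) (n2 F)"
  unfolding n2_def by (intro M_is_mean_real uc_norm_squared)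

lemma M_mult_cnj: "F \<in> uc \<Longrightarrow> M (\<lambda>t. F t * cnj (F t)) = of_real (n2 F)"
  unfolding complex_norm_square[symmetric]
  using is_mean_bounded_linear[OF bounded_linear_of_real is_mean_n2] by (intro M_eqI) auto

lemma n2_nonneg: "F \<in> uc \<Longrightarrow> n2 F \<ge> 0"
  by (rule is_mean_nonneg[OF is_mean_n2]) auto

lemma n2_le:
  assumes "F \<in> uc" "\<And>x. cmod (F x) \<le> B"
  shows "n2 F \<le> B\<^sup>2"
proof -
  have "norm (n2 F) \<le> B\<^sup>2"
    using assms(2) by (intro is_mean_norm_le[OF is_mean_n2[OF assms(1)]]) (simp add: power_mono)
  then show ?thesis by simp
qed

lemma n2_reflect_shift: "F \<in> uc \<Longrightarrow> n2 (\<lambda>t. F (x - t)) = n2 F"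
  using M_eqI[OF is_mean_reflect[OF is_mean_shift[OF is_mean_n2, of F x]]]
  by (simp add: n2_def add.commute[of "- _" x])

lemma conv_tilde_0: "F \<in> uc \<Longrightarrow> conv F (tilde F) 0 = of_real (n2 F)"
  using M_mult_cnj[OF uc_reflect, of F] n2_reflect_shift[of F 0]
  by (simp add: conv_def tilde_def)

text \<open>The mean is faithful. For every \<open>x\<close> some point of a finite net carries
  \<open>x\<close> close to \<open>x0\<close>, so the sum of the shifted copies of
  \<open>|F|\<^sup>2\<close> over the net is everywhere at least half of the value at
  \<open>x0\<close>.\<close>

lemma n2_pos:
  assumes F: "F \<in> uc" and "F x0 \<noteq> 0"
  shows "n2 F > 0"
proof -
  define a where "a = (cmod (F x0))\<^sup>2"
  have "a / 2 > 0" using assms by (simp add: a_def)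
  obtain d where d: "d > 0" "\<And>x y. \<rho> (x - y) < d \<Longrightarrow> norm ((cmod (F x))\<^sup>2 - (cmod (F y))\<^sup>2) \<le> a / 2"
    using ucD[OF uc_norm_squared[OF F] \<open>a / 2 > 0\<close>] by blast
  obtain ts where ts: "ts \<noteq> []" "\<And>x. \<exists>t\<in>set ts. \<rho> (x - t) < d"
    using \<rho>_net[OF d(1)] by blast
  have "is_mean (\<lambda>x. (\<Sum>t\<leftarrow>ts. (cmod (F (x + t)))\<^sup>2) - a / 2) ((\<Sum>t\<leftarrow>ts. n2 F) - a / 2)"
    by (intro is_mean_diff is_mean_sum_list is_mean_const is_mean_shift[OF is_mean_n2] F)
  then have "(\<Sum>t\<leftarrow>ts. n2 F) - a / 2 \<ge> 0"
  proof (rule is_mean_nonneg)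
    fix x
    obtain t where t: "t \<in> set ts" "\<rho> (x0 - x - t) < d" using ts(2) by blast
    have "a / 2 \<le> (cmod (F (x + t)))\<^sup>2"
      using d(2)[of x0 "x + t"] t(2) unfolding a_def diff_diff_eq real_norm_def by linarith
    also have "\<dots> \<le> (\<Sum>t\<leftarrow>ts. (cmod (F (x + t)))\<^sup>2)"
      using t(1) by (intro member_le_sum_list) auto
    finally show "0 \<le> (\<Sum>t\<leftarrow>ts. (cmod (F (x + t)))\<^sup>2) - a / 2" by simp
  qed
  then have "real (length ts) * n2 F > 0"
    using \<open>a / 2 > 0\<close> by (simp add: sum_list_triv)
  then show ?thesis by (simp add: zero_less_mult_iff)
qed

lemma M_Cauchy_Schwarz:
  assumes F: "F \<in> uc" and H: "H \<in> uc"
  shows "(cmod (M (\<lambda>t. F t * H t)))\<^sup>2 \<le> n2 F * n2 H"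
proof -
  define c where "c = M (\<lambda>t. F t * H t)"
  \<comment> \<open>The mean of \<open>|F - z * cnj H|\<^sup>2\<close> is nonnegative for every
    \<open>z\<close>; the best choice is \<open>z = c / n2 H\<close>.\<close>
  have key: "0 \<le> n2 F - 2 * Re (cnj z * c) + (cmod z)\<^sup>2 * n2 H" for z
  proof -
    have c: "is_mean (\<lambda>t. F t * H t) c" unfolding c_def by (intro M_is_mean uc_mult F H)
    have "is_mean (\<lambda>t. (cmod (F t))\<^sup>2 - 2 * Re (cnj z * (F t * H t)) + (cmod z)\<^sup>2 * (cmod (H t))\<^sup>2)
        (n2 F - 2 * Re (cnj z * c) + (cmod z)\<^sup>2 * n2 H)"
      by (intro is_mean_add is_mean_diff is_mean_n2 F H c is_mean_bounded_linear[OF bounded_linear_mult_right]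
          is_mean_bounded_linear[OF bounded_linear_Re])
    then show ?thesis
    proof (rule is_mean_nonneg)
      fix t
      have "(cmod (F t))\<^sup>2 - 2 * Re (cnj z * (F t * H t)) + (cmod z)\<^sup>2 * (cmod (H t))\<^sup>2
          = (cmod (F t - z * cnj (H t)))\<^sup>2"
        unfolding cmod_power2 by (simp add: power2_eq_square algebra_simps)
      then show "0 \<le> (cmod (F t))\<^sup>2 - 2 * Re (cnj z * (F t * H t)) + (cmod z)\<^sup>2 * (cmod (H t))\<^sup>2"
        by simp
    qed
  qed
  have cc: "Re (cnj c * c) = (cmod c)\<^sup>2" unfolding cmod_power2 by (simp add: power2_eq_square)
  show ?thesis
  proof (cases "n2 H = 0")
    case True
    have "c = 0"
    proof (rule ccontr)
      assume "c \<noteq> 0"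
      \<comment> \<open>This size turns \<open>key\<close>, which is linear in \<open>s\<close> when
        \<open>n2 H = 0\<close>, into \<open>0 \<le> - 1\<close>.\<close>
      define s where "s = (n2 F + 1) / (2 * (cmod c)\<^sup>2)"
      have "0 \<le> n2 F - 2 * s * (cmod c)\<^sup>2"
        using key[of "of_real s * c"] cc True by (simp add: mult.assoc)
      with \<open>c \<noteq> 0\<close> show False by (simp add: s_def)
    qed
    with True show ?thesis by (simp add: c_def)
  next
    case False
    then have pos: "n2 H > 0" using n2_nonneg[OF H] by simp
    have "cnj (c / of_real (n2 H)) * c = of_real (1 / n2 H) * (cnj c * c)" by simp
    then have "Re (cnj (c / of_real (n2 H)) * c) = (cmod c)\<^sup>2 / n2 H"
      unfolding cc[symmetric] by (simp del: complex_cnj_divide)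
    then have "0 \<le> n2 F - 2 * ((cmod c)\<^sup>2 / n2 H) + (cmod c)\<^sup>2 / (n2 H)\<^sup>2 * n2 H"
      using key[of "c / of_real (n2 H)"] pos by (simp add: norm_divide power_divide)
    also have "(cmod c)\<^sup>2 / (n2 H)\<^sup>2 * n2 H = (cmod c)\<^sup>2 / n2 H"
      using pos by (simp add: power2_eq_square)
    finally have "(cmod c)\<^sup>2 / n2 H \<le> n2 F" by simp
    with pos show ?thesis by (simp add: c_def pos_divide_le_eq)
  qed
qed

text \<open>This is how mean-square estimates become uniform: one convolution with a fixed function
  suffices.\<close>

lemma conv_bound:
  assumes "F \<in> uc" "H \<in> uc"
  shows "(cmod (conv F H x))\<^sup>2 \<le> n2 F * n2 H"
  using M_Cauchy_Schwarz[OF uc_reflect_shift[OF assms(1), of x] assms(2)]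
  by (simp add: conv_def n2_reflect_shift assms(1))

lemma n2_conv_le:
  assumes "F \<in> uc" "H \<in> uc"
  shows "n2 (conv F H) \<le> n2 F * n2 H"
proof -
  have "0 \<le> n2 F * n2 H" using assms by (intro mult_nonneg_nonneg n2_nonneg)
  moreover have "cmod (conv F H x) \<le> sqrt (n2 F * n2 H)" for x
    using conv_bound[OF assms, of x] by (rule real_le_rsqrt)
  ultimately show ?thesis using n2_le[OF uc_conv[OF assms]] by fastforce
qed

end

section \<open>Characters from idempotents\<close>

context tb_pseudonorm
begin

lemma conv_limit:
  assumes F: "F \<in> uc" and u: "\<And>n. u n \<in> uc" and lim: "uniform_limit UNIV u Q sequentially"
  shows "(\<lambda>n. conv F (u n) x) \<longlonglongrightarrow> conv F Q x"
proof (rule LIMSEQ_I)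
  fix e :: real assume "e > 0"
  have Q: "Q \<in> uc" by (rule uc_limit[OF u lim])
  obtain B where B: "B > 0" "\<And>x. norm (F x) \<le> B" using uc_bounded[OF F] by blast
  define d where "d = e / (2 * B)"
  have "d > 0" using B(1) \<open>e > 0\<close> by (simp add: d_def)
  then have "\<forall>\<^sub>F n in sequentially. \<forall>x\<in>UNIV. dist (u n x) (Q x) < d"
    using lim unfolding uniform_limit_iff by blast
  then obtain N where N: "\<And>n x. n \<ge> N \<Longrightarrow> dist (u n x) (Q x) < d"
    unfolding eventually_sequentially by auto
  have "norm (conv F (u n) x - conv F Q x) < e" if n: "n \<ge> N" for n
  proof -
    have uQ: "(\<lambda>x. u n x - Q x) \<in> uc" by (intro uc_diff u Q)
    have "norm (conv F (\<lambda>x. u n x - Q x) x) \<le> B * d"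
      unfolding conv_def
    proof (rule norm_M_le[OF uc_conv_integrand[OF F uQ]])
      fix t
      show "norm (F (x - t) * (u n t - Q t)) \<le> B * d"
        unfolding norm_mult using B N[OF n, of t]
        by (intro mult_mono) (auto simp: dist_norm intro: less_imp_le)
    qed
    also have "B * d < e" using B(1) \<open>e > 0\<close> by (simp add: d_def)
    finally show ?thesis by (simp add: conv_diff_right F u Q)
  qed
  then show "\<exists>N. \<forall>n\<ge>N. norm (conv F (u n) x - conv F Q x) < e" by blast
qed

text \<open>\<open>pw k n\<close> is the convolution power of exponent \<open>n + 1\<close>, since
  the algebra need not have a unit to start from. Hence the \<open>Suc\<close> in the law of
  exponents.\<close>

primrec pw :: "('a \<Rightarrow> complex) \<Rightarrow> nat \<Rightarrow> 'a \<Rightarrow> complex" where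
  "pw k 0 = k"
| "pw k (Suc n) = conv k (pw k n)"

lemma uc_pw: "k \<in> uc \<Longrightarrow> pw k n \<in> uc"
  by (induction n) (auto intro: uc_conv)

lemma conv_pw: "k \<in> uc \<Longrightarrow> conv (pw k m) (pw k n) = pw k (Suc (m + n))"
  by (induction m) (auto simp: conv_assoc uc_pw)

lemma tilde_pw: "k \<in> uc \<Longrightarrow> tilde k = k \<Longrightarrow> tilde (pw k n) = pw k n"
  by (induction n) (auto simp: tilde_conv uc_pw)

lemma hermitian_conv_0: "F \<in> uc \<Longrightarrow> tilde F = F \<Longrightarrow> conv F F 0 = of_real (n2 F)"
  using conv_tilde_0[of F] by simp

text \<open>On the completion these are the convolution kernels of orthogonal projections that
  commute with translations.\<close>

definition idem :: "('a \<Rightarrow> complex) \<Rightarrow> bool" where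
  "idem P \<longleftrightarrow> P \<in> uc \<and> tilde P = P \<and> conv P P = P"

text \<open>Power iteration: \<open>c n = \<parallel>k\<^bsup>n+1\<^esup>\<parallel>\<^sup>2\<close> is log-convex, so its ratios increase to the top eigenvalue
  \<open>\<mu>\<close> of \<open>k * k\<close>, and submultiplicativity of \<open>c\<close> gives \<open>\<mu>\<^bsup>n+1\<^esup> \<le> c n\<close>, which keeps the limit of the
  normalised powers away from \<open>0\<close>.\<close>

lemma hermitian_top_idempotent:
  assumes k: "k \<in> uc" and herm: "tilde k = k" and nz: "k x0 \<noteq> 0"
  obtains \<mu> Q where "\<mu> > 0" "idem Q" "Q 0 \<noteq> 0" "conv (conv k k) Q = (\<lambda>x. of_real \<mu> * Q x)"
proof -
  define c where "c = (\<lambda>n. n2 (pw k n))"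
  note pwu = uc_pw[OF k]
  \<comment> \<open>The index on the right stands for the power of exponent
    \<open>2 * n + 2\<close>; at 0 the square of a hermitian kernel is its squared norm.\<close>
  have c_eq: "of_real (c n) = pw k (Suc (n + n)) 0" for n
    using hermitian_conv_0[OF pwu tilde_pw[OF k herm], of n] conv_pw[OF k, of n n]
    by (simp add: c_def)
  have c_nonneg: "c n \<ge> 0" for n unfolding c_def by (rule n2_nonneg[OF pwu])
  have c_mult: "c (Suc (m + n)) \<le> c m * c n" for m n
    unfolding c_def conv_pw[OF k, symmetric] by (rule n2_conv_le[OF pwu pwu])
  have logconv: "(c (Suc n))\<^sup>2 \<le> c n * c (Suc (Suc n))" for n
  proof -
    have "cmod (of_real (c (Suc n))) = cmod (conv (pw k n) (pw k (Suc (Suc n))) 0)"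
      unfolding c_eq conv_pw[OF k] by simp
    then have "\<bar>c (Suc n)\<bar> = cmod (conv (pw k n) (pw k (Suc (Suc n))) 0)" by simp
    with conv_bound[OF pwu pwu, of n "Suc (Suc n)" 0] show ?thesis
      unfolding c_def by (metis power2_abs)
  qed
  \<comment> \<open>Positivity of the norm of \<open>k\<close> makes \<open>k * k\<close> nonzero at
    0; from two consecutive positive terms log-convexity yields the next.\<close>
  have c_pos: "c n > 0 \<and> c (Suc n) > 0" for n
  proof (induction n)
    case 0
    have "c 0 > 0" unfolding c_def using n2_pos[OF k nz] by simp
    moreover from this have "pw k (Suc 0) 0 \<noteq> 0" using c_eq[of 0] by auto
    then have "c (Suc 0) > 0" unfolding c_def by (rule n2_pos[OF pwu])
    ultimately show ?case by simp
  next
    case (Suc n)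
    then have "0 < c n * c (Suc (Suc n))" using logconv[of n] by (smt (verit) zero_less_power)
    with Suc show ?case by (auto simp: zero_less_mult_iff)
  qed
  then have pos: "c n > 0" for n by blast
  define r where "r = (\<lambda>n. c (Suc n) / c n)"
  have r_pos: "r n > 0" for n using pos by (simp add: r_def)
  have "incseq r"
  proof (rule incseq_SucI)
    fix n
    show "r n \<le> r (Suc n)"
      using logconv[of n] pos[of n] pos[of "Suc n"]
      by (simp add: r_def divide_le_eq pos_le_divide_eq power2_eq_square mult.commute)
  qed
  have r_le: "r n \<le> c 0" for n
    using c_mult[of 0 n] pos[of n] by (simp add: r_def divide_le_eq)
  have "\<exists>\<mu>. r \<longlonglongrightarrow> \<mu> \<and> (\<forall>i. r i \<le> \<mu>)"
    using incseq_convergent[OF \<open>incseq r\<close>, of "c 0"] r_le by metis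
  then obtain \<mu> where lim_r: "r \<longlonglongrightarrow> \<mu>" and r_mu: "\<And>n. r n \<le> \<mu>" by blast
  have "\<mu> > 0" using r_pos[of 0] r_mu[of 0] by linarith
  have ratio: "(\<lambda>n. c (n + m) / c n) \<longlonglongrightarrow> \<mu> ^ m" for m
  proof (induction m)
    case 0
    have "(\<lambda>n. c n / c n) = (\<lambda>_. 1)" using pos by (auto simp: less_imp_neq[symmetric])
    then show ?case by simp
  next
    case (Suc m)
    have "(\<lambda>n. r (n + m) * (c (n + m) / c n)) \<longlonglongrightarrow> \<mu> * \<mu> ^ m"
      by (intro tendsto_mult Suc LIMSEQ_ignore_initial_segment lim_r)
    moreover have "(\<lambda>n. r (n + m) * (c (n + m) / c n)) = (\<lambda>n. c (n + Suc m) / c n)"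
      using pos by (auto simp: r_def less_imp_neq[symmetric])
    ultimately show ?case by (simp only: power_Suc)
  qed
  have mu_c: "\<mu> ^ Suc m \<le> c m" for m
  proof (rule LIMSEQ_le_const2[OF ratio])
    have "c (n + Suc m) / c n \<le> c m" for n
      using c_mult[of n m] pos[of n] by (simp add: divide_le_eq mult.commute)
    then show "\<exists>N. \<forall>n\<ge>N. c (n + Suc m) / c n \<le> c m" by blast
  qed
  define b where "b = (\<lambda>n. c n / \<mu> ^ Suc n)"
  have b_ge: "b n \<ge> 1" for n
    using mu_c[of n] \<open>\<mu> > 0\<close> by (simp add: b_def)
  have "decseq b"
  proof (rule decseq_SucI)
    fix n
    have "c (Suc n) \<le> \<mu> * c n"
      using r_mu[of n] pos[of n] by (simp add: r_def divide_le_eq)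
    then show "b (Suc n) \<le> b n" using \<open>\<mu> > 0\<close> by (simp add: b_def divide_simps mult.commute)
  qed
  then obtain L where L: "b \<longlonglongrightarrow> L" "\<And>n. L \<le> b n"
    using decseq_convergent[of b 1] b_ge by metis
  have "L \<ge> 1" by (rule LIMSEQ_le_const[OF L(1)]) (use b_ge in blast)
  \<comment> \<open>\<open>u n\<close> is the power of exponent \<open>n + 1\<close> of
    \<open>k * k / \<mu>\<close>. Only even powers of \<open>k\<close> occur, so eigenvalues of
    equal modulus and opposite sign cause no oscillation.\<close>
  define u where "u = (\<lambda>n x. of_real (1 / \<mu> ^ Suc n) * pw k (Suc (n + n)) x)"
  have u_uc: "u n \<in> uc" for n unfolding u_def by (intro uc_scale pwu)
  have u_herm: "tilde (u n) = u n" for n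
  proof
    fix x
    show "tilde (u n) x = u n x"
      using fun_cong[OF tilde_pw[OF k herm, of "Suc (n + n)"], of x] by (simp add: u_def tilde_def)
  qed
  have u_0: "u n 0 = of_real (b n)" for n
    by (simp add: u_def b_def c_eq[symmetric] del: pw.simps)
  have u_conv: "conv (u m) (u n) = u (Suc (m + n))" for m n
  proof
    fix x
    have eq: "conv (pw k (Suc (m + m))) (pw k (Suc (n + n))) x = pw k (Suc (Suc (m + n) + Suc (m + n))) x"
      unfolding conv_pw[OF k] by (rule arg_cong[where f = "\<lambda>j. pw k j x"]) simp
    have "conv (u m) (u n) x = of_real (1 / \<mu> ^ Suc m) *
        (of_real (1 / \<mu> ^ Suc n) * conv (pw k (Suc (m + m))) (pw k (Suc (n + n))) x)"
      unfolding u_def by (simp only: conv_scale_left conv_scale_right uc_scale pwu)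
    then show "conv (u m) (u n) x = u (Suc (m + n)) x"
      unfolding eq u_def using \<open>\<mu> > 0\<close>
      by (simp add: power_add mult_ac del: pw.simps)
  qed
  \<comment> \<open>All terms of the expansion are values of \<open>b\<close>, so the right-hand
    side tends to \<open>L - 2 * L + L = 0\<close>.\<close>
  have n2_u: "n2 (\<lambda>x. u m x - u n x) = b (Suc (m + m)) - 2 * b (Suc (m + n)) + b (Suc (n + n))" for m n
  proof -
    let ?D = "\<lambda>x. u m x - u n x"
    have D: "?D \<in> uc" by (intro uc_diff u_uc)
    have "tilde ?D = ?D"
      using u_herm[of m] u_herm[of n] by (simp add: tilde_def fun_eq_iff)
    then have "of_real (n2 ?D) = conv ?D ?D 0" using hermitian_conv_0[OF D] by simp
    also have "\<dots> = conv (u m) (u m) 0 - conv (u m) (u n) 0 - (conv (u n) (u m) 0 - conv (u n) (u n) 0)"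
      using D by (simp add: conv_diff_left conv_diff_right u_uc)
    also have "\<dots> = of_real (b (Suc (m + m)) - 2 * b (Suc (m + n)) + b (Suc (n + n)))"
      by (simp add: u_conv u_0 add.commute)
    finally show ?thesis by (simp only: of_real_eq_iff)
  qed
  \<comment> \<open>The shifted sequence has one factor \<open>u 0\<close> to spare:
    \<open>v m - v n\<close> is \<open>u 0\<close> convolved with \<open>u m - u n\<close>, and
    \<open>conv_bound\<close> turns the mean-square estimate into a uniform one.\<close>
  define v where "v = (\<lambda>n. u (Suc n))"
  have "uniformly_Cauchy_on UNIV v"
  proof (rule uniformly_Cauchy_onI)
    fix e :: real assume "e > 0"
    \<comment> \<open>Twice this number bounds \<open>n2\<close> of the difference; the summand 1
      keeps the denominator positive and the final inequality strict.\<close>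
    define \<eta> where "\<eta> = e\<^sup>2 / (2 * (n2 (u 0) + 1))"
    have n2u0: "n2 (u 0) \<ge> 0" by (rule n2_nonneg[OF u_uc])
    then have "\<eta> > 0" using \<open>e > 0\<close> by (simp add: \<eta>_def)
    then have "\<forall>\<^sub>F n in sequentially. b n < L + \<eta>"
      using order_tendstoD(2)[OF L(1), of "L + \<eta>"] by simp
    then obtain N where N: "\<And>n. n \<ge> N \<Longrightarrow> b n < L + \<eta>" unfolding eventually_sequentially by blast
    have "dist (v m x) (v n x) < e" if "m \<ge> N" "n \<ge> N" for m n x
    proof -
      have "v m x - v n x = conv (u 0) (\<lambda>x. u m x - u n x) x"
        by (simp add: conv_diff_right u_uc u_conv v_def)
      then have "(cmod (v m x - v n x))\<^sup>2 \<le> n2 (u 0) * n2 (\<lambda>x. u m x - u n x)"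
        using conv_bound[OF u_uc uc_diff[OF u_uc u_uc]] by metis
      also have "\<dots> \<le> n2 (u 0) * (2 * \<eta>)"
        using N[of "Suc (m + m)"] N[of "Suc (n + n)"] L(2)[of "Suc (m + n)"] that n2u0
        unfolding n2_u by (intro mult_left_mono) auto
      also have "\<dots> = (n2 (u 0) / (n2 (u 0) + 1)) * e\<^sup>2"
        using n2u0 by (simp add: \<eta>_def field_simps)
      also have "\<dots> < 1 * e\<^sup>2" using n2u0 \<open>e > 0\<close> by (intro mult_strict_right_mono) auto
      finally show ?thesis
        using \<open>e > 0\<close> power2_less_imp_less[of "cmod (v m x - v n x)" e] by (simp add: dist_norm)
    qed
    then show "\<exists>N. \<forall>x\<in>UNIV. \<forall>m\<ge>N. \<forall>n\<ge>N. dist (v m x) (v n x) < e" by blast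
  qed
  then have "uniformly_convergent_on UNIV v" by (rule Cauchy_uniformly_convergent)
  then obtain Q where lim: "uniform_limit UNIV v Q sequentially"
    unfolding uniformly_convergent_on_def by blast
  have v_uc: "v n \<in> uc" for n by (simp add: v_def u_uc)
  have Q: "Q \<in> uc" by (rule uc_limit[OF v_uc lim])
  have vQ: "(\<lambda>n. v n x) \<longlonglongrightarrow> Q x" for x
    using tendsto_uniform_limitI[OF lim] by simp
  have uQ: "conv (u m) Q = Q" for m
  proof
    fix x
    have "(\<lambda>n. conv (u m) (v n) x) \<longlonglongrightarrow> conv (u m) Q x"
      by (rule conv_limit[OF u_uc v_uc lim])
    moreover have "(\<lambda>n. conv (u m) (v n) x) = (\<lambda>n. v (n + Suc m) x)"
      by (simp add: u_conv v_def add.commute)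
    moreover have "(\<lambda>n. v (n + Suc m) x) \<longlonglongrightarrow> Q x"
      by (rule LIMSEQ_ignore_initial_segment[OF vQ])
    ultimately show "conv (u m) Q x = Q x" using LIMSEQ_unique by metis
  qed
  have "conv Q Q = Q"
  proof
    fix x
    have "(\<lambda>n. conv Q (v n) x) \<longlonglongrightarrow> conv Q Q x"
      by (rule conv_limit[OF Q v_uc lim])
    moreover have "conv Q (v n) = Q" for n
      using conv_commute[OF Q v_uc] uQ by (simp add: v_def)
    ultimately have "(\<lambda>n. Q x) \<longlonglongrightarrow> conv Q Q x" by simp
    then show "conv Q Q x = Q x" using LIMSEQ_unique tendsto_const by blast
  qed
  moreover have "tilde Q = Q"
  proof
    fix x
    have "(\<lambda>n. cnj (v n (- x))) \<longlonglongrightarrow> cnj (Q (- x))" by (intro tendsto_cnj vQ)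
    moreover have "(\<lambda>n. cnj (v n (- x))) = (\<lambda>n. v n x)"
      using u_herm by (auto simp: v_def tilde_def fun_eq_iff)
    ultimately show "tilde Q x = Q x" using LIMSEQ_unique vQ[of x] by (simp add: tilde_def)
  qed
  ultimately have "idem Q" using Q by (simp add: idem_def)
  moreover have "Q 0 \<noteq> 0"
  proof -
    have "(\<lambda>n. of_real (b (Suc n))) \<longlonglongrightarrow> (of_real L :: complex)"
      by (intro tendsto_of_real LIMSEQ_Suc L(1))
    then have "Q 0 = of_real L" using LIMSEQ_unique vQ[of 0] by (simp add: v_def u_0)
    with \<open>L \<ge> 1\<close> show ?thesis by simp
  qed
  moreover have "conv (conv k k) Q = (\<lambda>x. of_real \<mu> * Q x)"
  proof
    fix x
    have "conv k k = (\<lambda>x. of_real \<mu> * u 0 x)" using \<open>\<mu> > 0\<close> by (simp add: u_def)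
    then show "conv (conv k k) Q x = of_real \<mu> * Q x"
      by (simp add: conv_scale_left u_uc Q uQ)
  qed
  ultimately show ?thesis using that \<open>\<mu> > 0\<close> by blast
qed

section \<open>Idempotents and characters\<close>

lemma idemD:
  assumes "idem P"
  shows "P \<in> uc" "tilde P = P" "conv P P = P"
  using assms by (auto simp: idem_def)

lemma idem_0: "idem P \<Longrightarrow> P 0 = of_real (n2 P)"
  using hermitian_conv_0[of P] idemD[of P] by simp

text \<open>\<open>P = P * P\<close> gives \<open>n2 P \<le> (n2 P)\<^sup>2\<close>. This gap above
  0 bounds how often an idempotent can be split.\<close>

lemma idem_n2_ge_1:
  assumes P: "idem P" and "P x0 \<noteq> 0"
  shows "n2 P \<ge> 1"
proof -
  note P' = idemD[OF P]
  have "n2 P > 0" by (rule n2_pos[OF P'(1)]) fact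
  moreover have "n2 P \<le> n2 P * n2 P" using n2_conv_le[OF P'(1) P'(1)] P'(3) by simp
  ultimately show ?thesis by simp
qed

text \<open>Continuity is demanded with respect to \<rho>; in the application \<open>uc\<close>
  functions turn out to be continuous in the group topology as well.\<close>

definition chars :: "('a \<Rightarrow> complex) set" where
  "chars = {\<gamma> \<in> uc. (\<forall>x. cmod (\<gamma> x) = 1) \<and> (\<forall>x y. \<gamma> (x + y) = \<gamma> x * \<gamma> y)}"

lemma charsD:
  assumes "\<gamma> \<in> chars"
  shows "\<gamma> \<in> uc" "cmod (\<gamma> x) = 1" "\<gamma> (x + y) = \<gamma> x * \<gamma> y" "\<gamma> 0 = 1" "\<gamma> (- x) = cnj (\<gamma> x)"
    "\<gamma> x * cnj (\<gamma> x) = 1" "\<gamma> (x - y) = \<gamma> x * cnj (\<gamma> y)"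
proof -
  show 1: "\<gamma> \<in> uc" "cmod (\<gamma> x) = 1" "\<gamma> (x + y) = \<gamma> x * \<gamma> y" for x y
    using assms by (auto simp: chars_def)
  have nz: "\<gamma> x \<noteq> 0" for x using 1(2)[of x] by auto
  show z: "\<gamma> 0 = 1" using 1(3)[of 0 0] nz[of 0] by simp
  show c: "\<gamma> x * cnj (\<gamma> x) = 1" for x using 1(2)[of x] by (simp add: complex_norm_square[symmetric])
  have "\<gamma> x * \<gamma> (- x) = \<gamma> x * cnj (\<gamma> x)" for x using 1(3)[of x "- x"] z c[of x] by simp
  then show m: "\<gamma> (- x) = cnj (\<gamma> x)" for x
    unfolding mult_left_cancel[OF nz] .
  show "\<gamma> (x - y) = \<gamma> x * cnj (\<gamma> y)" using 1(3)[of x "- y"] m by simp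
qed

text \<open>If every hermitian element of \<open>P * uc\<close> is a multiple of \<open>P\<close>, then so is every translate of
  \<open>P\<close>.\<close>

lemma minimal_idem_character:
  assumes P: "idem P" and nz: "P 0 \<noteq> 0"
    and min: "\<And>h. h \<in> uc \<Longrightarrow> tilde h = h \<Longrightarrow> conv P h = h \<Longrightarrow> \<exists>c. h = (\<lambda>x. c * P x)"
  shows "\<exists>\<gamma>\<in>chars. conv P \<gamma> = \<gamma>"
proof -
  note P' = idemD[OF P]
  have mult: "\<exists>c. h = (\<lambda>x. c * P x)" if h: "h \<in> uc" "conv P h = h" for h
  proof -
    have h': "tilde h \<in> uc" "conv P (tilde h) = tilde h"
      using h tilde_conv[OF P'(1) h(1)] P'(2) by (auto intro: uc_tilde)
    \<comment> \<open>Both functions are hermitian and \<open>h = (a - \<i> * b) / 2\<close>, so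
      \<open>min\<close> applies to each part.\<close>
    define a where "a = (\<lambda>x. h x + tilde h x)"
    define b where "b = (\<lambda>x. \<i> * (h x - tilde h x))"
    have "\<exists>c. a = (\<lambda>x. c * P x)"
    proof (rule min)
      show "a \<in> uc" unfolding a_def by (intro uc_add h h')
      show "tilde a = a" by (auto simp: a_def tilde_def)
      show "conv P a = a" by (rule ext) (simp add: a_def conv_add_right P' h h')
    qed
    moreover have "\<exists>c. b = (\<lambda>x. c * P x)"
    proof (rule min)
      show "b \<in> uc" unfolding b_def by (intro uc_scale uc_diff h h')
      show "tilde b = b" by (auto simp: b_def tilde_def algebra_simps)
      show "conv P b = b" by (rule ext) (simp add: b_def conv_scale_right uc_diff conv_diff_right P' h h')
    qed
    ultimately obtain c d where "a = (\<lambda>x. c * P x)" "b = (\<lambda>x. d * P x)" by blast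
    moreover have "h x = (a x - \<i> * b x) / 2" for x by (simp add: a_def b_def)
    ultimately have "h = (\<lambda>x. (c - \<i> * d) / 2 * P x)" by (auto simp: algebra_simps diff_divide_distrib)
    then show ?thesis by blast
  qed
  have "\<exists>c. \<forall>x. P (x + y) = c * P x" for y
  proof -
    have "conv P (\<lambda>x. P (x + y)) = (\<lambda>x. P (x + y))"
      by (rule ext) (simp add: conv_shift_right P')
    from mult[OF uc_shift[OF P'(1)] this] show ?thesis by (auto simp: fun_eq_iff)
  qed
  then obtain c where c: "\<And>x y. P (x + y) = c y * P x" by metis
  \<comment> \<open>After division by the value at 0 the factor \<open>c y\<close> by which a
    translation acts is the function itself, which makes it multiplicative. Hermitian symmetry of
    \<open>P\<close> then forces modulus 1.\<close>
  define \<gamma> where "\<gamma> = (\<lambda>x. (1 / P 0) * P x)"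
  have \<gamma>_c: "\<gamma> = c"
  proof
    fix y
    have "P y = c y * P 0" using c[of 0 y] by (simp only: add_0)
    then show "\<gamma> y = c y" using nz by (simp add: \<gamma>_def)
  qed
  have \<gamma>_mult: "\<gamma> (x + y) = \<gamma> x * \<gamma> y" for x y
    using c[of x y] unfolding \<gamma>_c[symmetric] by (simp add: \<gamma>_def)
  have 1: "\<gamma> 0 = 1" using nz by (simp add: \<gamma>_def)
  have "cnj (P (- (- x))) = P (- x)" for x
    using fun_cong[OF P'(2), of "- x"] unfolding tilde_def .
  moreover have "cnj (P 0) = P 0"
    using fun_cong[OF P'(2), of 0] by (simp add: tilde_def)
  ultimately have "\<gamma> (- x) = cnj (\<gamma> x)" for x by (simp add: \<gamma>_def)
  with \<gamma>_mult[of _ "- _"] 1 have "\<gamma> x * cnj (\<gamma> x) = 1" for x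
    by (metis add.right_inverse)
  then have "of_real ((cmod (\<gamma> x))\<^sup>2) = (1 :: complex)" for x unfolding complex_norm_square .
  then have "cmod (\<gamma> x) = 1" for x
    unfolding of_real_eq_1_iff abs_square_eq_1 by simp
  moreover have "\<gamma> \<in> uc" unfolding \<gamma>_def by (intro uc_scale P')
  ultimately have "\<gamma> \<in> chars" using \<gamma>_mult by (auto simp: chars_def)
  moreover have "conv P \<gamma> = \<gamma>"
    unfolding \<gamma>_def by (rule ext) (simp only: conv_scale_right P')
  ultimately show ?thesis by blast
qed

text \<open>Induction on an integer above \<open>n2 P\<close>. A proper sub-idempotent
  \<open>Q\<close> lowers \<open>n2\<close> by at least 1, as the complement \<open>P - Q\<close> is
  itself a nonzero idempotent. Without such a \<open>Q\<close>, every nonzero hermitian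
  \<open>k\<close> in \<open>P * uc\<close> has \<open>k * k\<close> proportional to the unit
  \<open>P\<close>, and factoring \<open>h * h - \<mu> * P\<close> shows that \<open>h\<close> is a
  multiple of \<open>P\<close>.\<close>

lemma idem_character:
  assumes "idem P" "P x0 \<noteq> 0"
  shows "\<exists>\<gamma>\<in>chars. conv P \<gamma> = \<gamma>"
proof -
  obtain n where "n2 P < real n" using reals_Archimedean2 by blast
  with assms show ?thesis
  proof (induction n arbitrary: P x0)
    case 0
    with n2_nonneg[OF idemD(1)] show ?case by fastforce
  next
    case (Suc n)
    note P = idemD[OF \<open>idem P\<close>]
    have P0: "P 0 \<noteq> 0" using idem_0[OF Suc.prems(1)] idem_n2_ge_1[OF Suc.prems(1,2)] by simp
    show ?case
    proof (cases "\<exists>Q. idem Q \<and> Q 0 \<noteq> 0 \<and> conv P Q = Q \<and> Q \<noteq> P")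
      case True
      then obtain Q where "idem Q" and Q0: "Q 0 \<noteq> 0" and PQ: "conv P Q = Q" and "Q \<noteq> P" by blast
      note Q = idemD[OF \<open>idem Q\<close>]
      have QP: "conv Q P = Q" using conv_commute[OF Q(1) P(1)] PQ by simp
      let ?R = "\<lambda>x. P x - Q x"
      obtain x where "?R x \<noteq> 0" using \<open>Q \<noteq> P\<close> by (metis ext eq_iff_diff_eq_0)
      have "?R \<in> uc" by (intro uc_diff P Q)
      moreover have "tilde ?R = ?R"
        using P(2) Q(2) by (simp add: tilde_def fun_eq_iff)
      moreover have "conv ?R ?R = ?R"
        by (rule ext) (simp add: conv_diff_left conv_diff_right uc_diff P Q PQ QP)
      ultimately have R: "idem ?R" by (simp add: idem_def)
      have "of_real (n2 ?R) = (of_real (n2 P - n2 Q) :: complex)"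
        using idem_0[OF R] idem_0[OF \<open>idem P\<close>] idem_0[OF \<open>idem Q\<close>] by simp
      then have "n2 ?R = n2 P - n2 Q" unfolding of_real_eq_iff .
      with idem_n2_ge_1[OF R \<open>?R x \<noteq> 0\<close>] Suc.prems(3) have "n2 Q < real n" by simp
      from Suc.IH[OF \<open>idem Q\<close> Q0 this] obtain \<gamma> where "\<gamma> \<in> chars" "conv Q \<gamma> = \<gamma>" by blast
      moreover from this have "conv P \<gamma> = \<gamma>"
        using conv_assoc[OF P(1) Q(1) charsD(1)] PQ by metis
      ultimately show ?thesis by blast
    next
      case False
      \<comment> \<open>The top idempotent of \<open>k\<close> lies below \<open>P\<close>, hence
        equals \<open>P\<close>; its eigenvalue equation then reads
        \<open>k * k = \<mu> * P\<close>.\<close>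
      have sq: "\<exists>\<mu>>0. conv k k = (\<lambda>x. of_real \<mu> * P x)"
        if k: "k \<in> uc" "tilde k = k" "conv P k = k" and nz: "k x1 \<noteq> 0" for k x1
      proof -
        obtain \<mu> Q where \<mu>: "\<mu> > 0" and "idem Q" "Q 0 \<noteq> 0"
          and kQ: "conv (conv k k) Q = (\<lambda>x. of_real \<mu> * Q x)"
          using hermitian_top_idempotent[OF k(1,2) nz] by blast
        note Q = idemD[OF \<open>idem Q\<close>]
        have kk: "conv k k \<in> uc" by (intro uc_conv k)
        have Pkk: "conv P (conv k k) = conv k k"
          using conv_assoc[OF P(1) k(1) k(1)] k(3) by simp
        have "conv P (\<lambda>x. of_real \<mu> * Q x) = (\<lambda>x. of_real \<mu> * Q x)"
          unfolding kQ[symmetric] using conv_assoc[OF P(1) kk Q(1)] Pkk by simp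
        then have "conv P Q = Q" using \<mu> by (simp add: conv_scale_right P Q fun_eq_iff)
        with False \<open>idem Q\<close> \<open>Q 0 \<noteq> 0\<close> have "Q = P" by blast
        with kQ have "conv k k = (\<lambda>x. of_real \<mu> * P x)"
          using conv_commute[OF P(1) kk] Pkk by simp
        with \<mu> show ?thesis by blast
      qed
      have "\<exists>c. h = (\<lambda>x. c * P x)" if h: "h \<in> uc" "tilde h = h" "conv P h = h" for h
      proof (cases "\<exists>x. h x \<noteq> 0")
        case False
        then show ?thesis by (intro exI[of _ 0]) auto
      next
        case True
        then obtain \<mu> where \<mu>: "\<mu> > 0" "conv h h = (\<lambda>x. of_real \<mu> * P x)"
          using sq[OF h] by blast
        define s where "s = (of_real (sqrt \<mu>) :: complex)"
        have ss: "s * s = of_real \<mu>" using \<mu>(1) by (simp add: s_def flip: of_real_mult)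
        define k where "k = (\<lambda>x. h x - s * P x)"
        define l where "l = (\<lambda>x. h x + s * P x)"
        have sP: "(\<lambda>x. s * P x) \<in> uc" by (intro uc_scale P)
        have k: "k \<in> uc" "tilde k = k" "conv P k = k"
        proof -
          show "k \<in> uc" unfolding k_def by (intro uc_diff sP h)
          show "tilde k = k"
            using h(2) P(2) by (simp add: tilde_def fun_eq_iff k_def s_def)
          show "conv P k = k"
            by (rule ext) (simp add: k_def conv_diff_right conv_scale_right h P sP)
        qed
        have l: "l \<in> uc" "conv P l = l"
        proof -
          show "l \<in> uc" unfolding l_def by (intro uc_add sP h)
          show "conv P l = l"
            by (rule ext) (simp add: l_def conv_add_right conv_scale_right h P sP)
        qed
        have hP: "conv h P = h" using conv_commute[OF h(1) P(1)] h(3) by simp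
        have kl: "conv k l x = 0" for x
        proof -
          have "conv k l x = conv k h x + s * conv k P x"
            unfolding l_def by (simp add: conv_add_right conv_scale_right h P sP k)
          also have "conv k h x = of_real \<mu> * P x - s * h x"
            unfolding k_def by (simp add: conv_diff_left conv_scale_left h P sP \<mu>(2))
          also have "conv k P x = h x - s * P x"
            unfolding k_def by (simp add: conv_diff_left conv_scale_left h P sP hP)
          finally show ?thesis by (simp add: algebra_simps ss[symmetric])
        qed
        show ?thesis
        proof (cases "\<exists>x. k x \<noteq> 0")
          case False
          then have "h = (\<lambda>x. s * P x)" by (auto simp: k_def)
          then show ?thesis by blast
        next
          case True
          then obtain \<nu> where \<nu>: "\<nu> > 0" "conv k k = (\<lambda>x. of_real \<nu> * P x)"
            using sq[OF k] by blast
          \<comment> \<open>Convolution with \<open>k * k\<close> multiplies \<open>l\<close> by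
            \<open>\<nu>\<close>, so \<open>k * l = 0\<close> leaves no room for a nonzero
            \<open>l\<close>.\<close>
          have "l x = 0" for x
          proof -
            have "of_real \<nu> * l x = conv (conv k k) l x"
              by (simp add: \<nu>(2) conv_scale_left P l)
            also have "\<dots> = conv k (conv k l) x" by (simp add: conv_assoc k l)
            also have "conv k l = (\<lambda>_. 0)" using kl by (rule ext)
            also have "conv k (\<lambda>_. 0) x = 0" by (simp add: conv_def M_const)
            finally show ?thesis using \<nu>(1) by simp
          qed
          then have "h = (\<lambda>x. - s * P x)" by (auto simp: l_def add_eq_0_iff2)
          then show ?thesis by blast
        qed
      qed
      then show ?thesis using minimal_idem_character[OF \<open>idem P\<close> P0] by blast
    qed
  qed
qed

end

section \<open>Approximation by characters\<close>

text \<open>Rotating \<open>c\<close> onto the positive real axis by \<open>cnj (sgn c)\<close>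
  reduces this to positivity of the mean.\<close>

lemma is_mean_norm_le_mean:
  fixes F :: "'a::ab_group_add \<Rightarrow> complex"
  assumes F: "is_mean F c" and r: "is_mean r d" and le: "\<And>x. cmod (F x) \<le> r x"
  shows "cmod c \<le> d"
proof -
  have "is_mean (\<lambda>x. r x - Re (cnj (sgn c) * F x)) (d - Re (cnj (sgn c) * c))"
    by (intro is_mean_diff r is_mean_bounded_linear[OF bounded_linear_Re]
        is_mean_bounded_linear[OF bounded_linear_mult_right] F)
  then have "d - Re (cnj (sgn c) * c) \<ge> 0"
  proof (rule is_mean_nonneg)
    fix x
    have "Re (cnj (sgn c) * F x) \<le> cmod (cnj (sgn c) * F x)" by (rule complex_Re_le_cmod)
    also have "\<dots> \<le> 1 * r x"
      unfolding norm_mult using le[of x] by (intro mult_mono) (auto simp: norm_sgn)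
    finally show "0 \<le> r x - Re (cnj (sgn c) * F x)" by simp
  qed
  moreover have "cnj (sgn c) * c = of_real (cmod c)"
  proof (cases "c = 0")
    case False
    have "cnj (sgn c) * c = (cnj c * c) / of_real (cmod c)"
      by (simp add: sgn_div_norm scaleR_conv_of_real divide_inverse mult_ac)
    also have "cnj c * c = of_real (cmod c) * of_real (cmod c)"
      using complex_norm_square[of c] by (simp add: power2_eq_square mult.commute)
    finally show ?thesis using False by simp
  qed simp
  ultimately show ?thesis by simp
qed

context tb_pseudonorm
begin

text \<open>A shift by a point where the characters differ multiplies the mean by a number other
  than 1, while invariance leaves it unchanged.\<close>

lemma M_chars_orthogonal:
  assumes \<gamma>: "\<gamma> \<in> chars" and \<psi>: "\<psi> \<in> chars" and "\<gamma> \<noteq> \<psi>"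
  shows "M (\<lambda>t. \<gamma> t * cnj (\<psi> t)) = 0"
proof -
  obtain a where a: "\<gamma> a \<noteq> \<psi> a" using \<open>\<gamma> \<noteq> \<psi>\<close> by blast
  have uc: "(\<lambda>t. \<gamma> t * cnj (\<psi> t)) \<in> uc" by (intro uc_mult uc_cnj charsD[OF \<gamma>] charsD[OF \<psi>])
  have "M (\<lambda>t. \<gamma> t * cnj (\<psi> t)) = M (\<lambda>t. \<gamma> (t + a) * cnj (\<psi> (t + a)))"
    by (rule M_shift[OF uc, symmetric])
  also have "\<dots> = M (\<lambda>t. (\<gamma> a * cnj (\<psi> a)) * (\<gamma> t * cnj (\<psi> t)))"
    by (simp add: charsD(3)[OF \<gamma>] charsD(3)[OF \<psi>] mult_ac)
  also have "\<dots> = (\<gamma> a * cnj (\<psi> a)) * M (\<lambda>t. \<gamma> t * cnj (\<psi> t))" by (rule M_cmult[OF uc])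
  finally have "\<gamma> a * cnj (\<psi> a) = 1 \<or> M (\<lambda>t. \<gamma> t * cnj (\<psi> t)) = 0" by auto
  moreover have "\<gamma> a * cnj (\<psi> a) \<noteq> 1"
  proof
    assume "\<gamma> a * cnj (\<psi> a) = 1"
    then have "\<gamma> a * (cnj (\<psi> a) * \<psi> a) = \<psi> a" by (metis mult.assoc mult_1)
    with charsD(6)[OF \<psi>, of a] a show False by (simp add: mult.commute)
  qed
  ultimately show ?thesis by blast
qed

section \<open>Fourier coefficients and remainders of Fourier sums\<close>

definition hat :: "('a \<Rightarrow> complex) \<Rightarrow> ('a \<Rightarrow> complex) \<Rightarrow> complex" where
  "hat F \<gamma> = M (\<lambda>t. F t * cnj (\<gamma> t))"

lemma conv_char:
  assumes "F \<in> uc" "\<gamma> \<in> chars"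
  shows "conv F \<gamma> x = hat F \<gamma> * \<gamma> x"
proof -
  note \<gamma> = charsD[OF assms(2)]
  have "conv F \<gamma> x = M (\<lambda>t. \<gamma> x * (F t * cnj (\<gamma> t)))"
    unfolding conv_commute[OF assms(1) \<gamma>(1)] by (simp add: conv_def \<gamma>(7) mult_ac)
  also have "\<dots> = \<gamma> x * hat F \<gamma>"
    unfolding hat_def by (intro M_cmult uc_mult uc_cnj assms \<gamma>(1))
  finally show ?thesis by simp
qed

lemma hat_diff: "F \<in> uc \<Longrightarrow> H \<in> uc \<Longrightarrow> \<gamma> \<in> chars \<Longrightarrow> hat (\<lambda>x. F x - H x) \<gamma> = hat F \<gamma> - hat H \<gamma>"
  unfolding hat_def left_diff_distrib by (intro M_diff uc_mult uc_cnj; (assumption | rule charsD(1), assumption))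

lemma hat_scale: "F \<in> uc \<Longrightarrow> \<gamma> \<in> chars \<Longrightarrow> hat (\<lambda>x. c * F x) \<gamma> = c * hat F \<gamma>"
  unfolding hat_def mult.assoc by (intro M_cmult uc_mult uc_cnj; (assumption | rule charsD(1), assumption))

lemma hat_chars: "\<gamma> \<in> chars \<Longrightarrow> \<psi> \<in> chars \<Longrightarrow> hat \<gamma> \<psi> = (if \<gamma> = \<psi> then 1 else 0)"
  using M_chars_orthogonal[of \<gamma> \<psi>] by (auto simp: hat_def charsD(6) M_const)

definition res :: "('a \<Rightarrow> complex) set \<Rightarrow> ('a \<Rightarrow> complex) \<Rightarrow> 'a \<Rightarrow> complex" where
  "res X F x = F x - (\<Sum>\<gamma>\<in>X. hat F \<gamma> * \<gamma> x)"

lemma res_empty: "res {} F = F"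
  by (simp add: res_def[abs_def])

lemma res_insert:
  "finite X \<Longrightarrow> \<psi> \<notin> X \<Longrightarrow> res (insert \<psi> X) F = (\<lambda>x. res X F x - hat F \<psi> * \<psi> x)"
  by (auto simp: res_def)

lemma uc_res:
  assumes "finite X" "X \<subseteq> chars" "F \<in> uc"
  shows "res X F \<in> uc"
  using assms(1,2)
proof (induction X)
  case (insert \<psi> X)
  then have "res X F \<in> uc" "\<psi> \<in> uc" using charsD(1) by auto
  with insert.hyps show ?case unfolding res_insert[OF insert.hyps] by (intro uc_diff uc_scale)
qed (simp add: res_empty assms)

lemma hat_res:
  assumes "finite X" "X \<subseteq> chars" "F \<in> uc" and \<psi>: "\<psi> \<in> chars"
  shows "hat (res X F) \<psi> = (if \<psi> \<in> X then 0 else hat F \<psi>)"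
  using assms(1,2)
proof (induction X)
  case (insert \<gamma> X)
  then have \<gamma>: "\<gamma> \<in> chars" by simp
  have "hat (res (insert \<gamma> X) F) \<psi> = hat (res X F) \<psi> - hat F \<gamma> * hat \<gamma> \<psi>"
    using insert charsD(1)[OF \<gamma>] by (simp add: res_insert hat_diff hat_scale uc_res uc_scale assms(3) \<psi>)
  with insert show ?case by (auto simp: hat_chars[OF \<gamma> \<psi>])
qed (simp add: res_empty)

text \<open>Pythagoras, one character at a time: a character outside \<open>X\<close> has the same
  coefficient in \<open>res X F\<close> as in \<open>F\<close>.\<close>

lemma n2_res:
  assumes "finite X" "X \<subseteq> chars" and F: "F \<in> uc"
  shows "n2 (res X F) = n2 F - (\<Sum>\<gamma>\<in>X. (cmod (hat F \<gamma>))\<^sup>2)"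
  using assms(1,2)
proof (induction X)
  case (insert \<psi> X)
  then have \<psi>: "\<psi> \<in> chars" by simp
  define G where "G = res X F"
  define a where "a = hat F \<psi>"
  have G: "G \<in> uc" unfolding G_def using insert F by (intro uc_res) auto
  have hatG: "hat G \<psi> = a"
    using insert F by (auto simp: G_def a_def hat_res)
  have "is_mean (\<lambda>t. G t * cnj (\<psi> t)) a"
    unfolding hatG[symmetric] hat_def by (intro M_is_mean uc_mult uc_cnj G charsD(1)[OF \<psi>])
  then have "is_mean (\<lambda>t. (cmod (G t))\<^sup>2 - 2 * Re (cnj a * (G t * cnj (\<psi> t))) + (cmod a)\<^sup>2)
      (n2 G - 2 * Re (cnj a * a) + (cmod a)\<^sup>2)"
    by (intro is_mean_add is_mean_diff is_mean_n2 G is_mean_const is_mean_bounded_linear[OF bounded_linear_mult_right]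
          is_mean_bounded_linear[OF bounded_linear_Re])
  moreover have "(cmod (G t))\<^sup>2 - 2 * Re (cnj a * (G t * cnj (\<psi> t))) + (cmod a)\<^sup>2
      = (cmod (G t - a * \<psi> t))\<^sup>2" for t
  proof -
    have "(cmod a)\<^sup>2 = (cmod a)\<^sup>2 * (cmod (\<psi> t))\<^sup>2" using charsD(2)[OF \<psi>, of t] by simp
    then show ?thesis
      unfolding cmod_power2 by (simp add: power2_eq_square algebra_simps)
  qed
  ultimately have "n2 (\<lambda>t. G t - a * \<psi> t) = n2 G - 2 * Re (cnj a * a) + (cmod a)\<^sup>2"
    unfolding n2_def by (intro M_eqI) simp
  moreover have "Re (cnj a * a) = (cmod a)\<^sup>2" unfolding cmod_power2 by (simp add: power2_eq_square)
  ultimately show ?case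
    using insert by (simp add: res_insert G_def a_def)
qed (simp add: res_empty)

lemma hat_tilde:
  assumes "F \<in> uc" "\<gamma> \<in> chars"
  shows "hat (tilde F) \<gamma> = cnj (hat F \<gamma>)"
proof -
  have uc: "(\<lambda>t. F t * cnj (\<gamma> t)) \<in> uc" by (intro uc_mult uc_cnj assms charsD(1)[OF assms(2)])
  have "hat (tilde F) \<gamma> = M (\<lambda>t. cnj (F (0 - t) * cnj (\<gamma> (0 - t))))"
    by (simp add: hat_def tilde_def charsD(5)[OF assms(2)])
  also have "\<dots> = M (\<lambda>t. cnj (F t * cnj (\<gamma> t)))" by (rule M_reflect) (rule uc_cnj[OF uc])
  also have "\<dots> = cnj (hat F \<gamma>)" unfolding hat_def by (rule M_cnj[OF uc])
  finally show ?thesis .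
qed

text \<open>Evaluate \<open>F * tilde F * \<gamma>\<close> at 0 in two ways. The coefficients are
  nonnegative and their sums are the energies of \<open>F\<close>, which is what allows uniform
  convergence in \<open>Parseval\<close>.\<close>

lemma hat_conv_tilde:
  assumes F: "F \<in> uc" and \<gamma>: "\<gamma> \<in> chars"
  shows "hat (conv F (tilde F)) \<gamma> = of_real ((cmod (hat F \<gamma>))\<^sup>2)"
proof -
  note \<gamma>uc = charsD(1)[OF \<gamma>]
  have "conv (conv F (tilde F)) \<gamma> 0 = conv F (conv (tilde F) \<gamma>) 0"
    by (simp add: conv_assoc F uc_tilde \<gamma>uc)
  also have "conv (tilde F) \<gamma> = (\<lambda>x. hat (tilde F) \<gamma> * \<gamma> x)"
    by (rule ext) (rule conv_char[OF uc_tilde[OF F] \<gamma>])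
  also have "conv F \<dots> 0 = hat F \<gamma> * cnj (hat F \<gamma>)"
    by (simp add: conv_scale_right F \<gamma>uc conv_char \<gamma> charsD(4) hat_tilde)
  finally show ?thesis
    by (simp add: conv_char uc_conv F uc_tilde \<gamma> charsD(4) complex_norm_square del: of_real_power)
qed

text \<open>For a character fixed by the top idempotent \<open>Q\<close>, the value of
  \<open>\<Psi> * \<Psi> * Q * \<gamma>\<close> at 0 is \<open>\<mu>\<close> on the one hand and
  \<open>(hat \<Psi> \<gamma>)\<^sup>2\<close> on the other.\<close>

lemma hermitian_char:
  assumes \<Psi>: "\<Psi> \<in> uc" "tilde \<Psi> = \<Psi>" "\<Psi> x0 \<noteq> 0"
  shows "\<exists>\<gamma>\<in>chars. hat \<Psi> \<gamma> \<noteq> 0"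
proof -
  obtain \<mu> Q where "\<mu> > 0" "idem Q" "Q 0 \<noteq> 0" and Q: "conv (conv \<Psi> \<Psi>) Q = (\<lambda>x. of_real \<mu> * Q x)"
    using hermitian_top_idempotent[OF \<Psi>] by blast
  obtain \<gamma> where \<gamma>: "\<gamma> \<in> chars" "conv Q \<gamma> = \<gamma>"
    using idem_character[OF \<open>idem Q\<close> \<open>Q 0 \<noteq> 0\<close>] by blast
  note uc = charsD(1)[OF \<gamma>(1)] idemD(1)[OF \<open>idem Q\<close>] \<Psi>(1)
  have "of_real \<mu> = conv (conv (conv \<Psi> \<Psi>) Q) \<gamma> 0"
    by (simp add: Q conv_scale_left uc \<gamma> charsD(4))
  also have "\<dots> = conv \<Psi> (conv \<Psi> \<gamma>) 0"
    by (simp add: conv_assoc uc_conv uc \<gamma>)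
  also have "conv \<Psi> \<gamma> = (\<lambda>x. hat \<Psi> \<gamma> * \<gamma> x)"
    by (rule ext) (rule conv_char[OF uc(3) \<gamma>(1)])
  finally have "of_real \<mu> = hat \<Psi> \<gamma> * conv \<Psi> \<gamma> 0" by (simp add: conv_scale_right uc)
  with \<open>\<mu> > 0\<close> \<gamma>(1) show ?thesis by (intro bexI[of _ \<gamma>]) auto
qed

text \<open>If the energies \<open>E X\<close> stay below \<open>n2 g\<close>, then the positive definite function \<open>\<Psi>\<close>, obtained from
  \<open>g * tilde g\<close> by removing all its Fourier terms, has \<open>\<Psi> 0 \<noteq> 0\<close>, so a further character occurs in
  it.\<close>

lemma Parseval:
  assumes g: "g \<in> uc" and "e > 0"
  shows "\<exists>X. finite X \<and> X \<subseteq> chars \<and> n2 (res X g) < e"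
proof -
  define a where "a = (\<lambda>\<gamma>. (cmod (hat g \<gamma>))\<^sup>2)"
  have a_nonneg: "a \<gamma> \<ge> 0" for \<gamma> by (simp add: a_def)
  define E where "E = (\<lambda>X. \<Sum>\<gamma>\<in>X. a \<gamma>)"
  define S where "S = {X. finite X \<and> X \<subseteq> chars}"
  have E_eq: "E X = n2 g - n2 (res X g)" if "X \<in> S" for X
    using that n2_res[OF _ _ g, of X] by (simp add: E_def a_def S_def)
  have E_le: "E X \<le> n2 g" if "X \<in> S" for X
    using E_eq[OF that] n2_nonneg[OF uc_res[OF _ _ g]] that by (simp add: S_def)
  have bdd: "bdd_above (E ` S)" using E_le by (intro bdd_aboveI) auto
  have "{} \<in> S" by (simp add: S_def)
  define Emax where "Emax = Sup (E ` S)"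
  have E_Emax: "E X \<le> Emax" if "X \<in> S" for X
    unfolding Emax_def using that by (intro cSup_upper bdd) auto
  have "Emax = n2 g"
  proof (rule ccontr)
    assume ne: "Emax \<noteq> n2 g"
    have "\<exists>X\<in>S. Emax - 1 / real (Suc n) < E X" for n
      using less_cSupD[of "E ` S" "Emax - 1 / real (Suc n)"] \<open>{} \<in> S\<close> by (auto simp: Emax_def)
    then obtain X where X: "\<And>n. X n \<in> S" "\<And>n. Emax - 1 / real (Suc n) < E (X n)" by metis
    then have X': "finite (X n)" "X n \<subseteq> chars" for n by (auto simp: S_def)
    \<comment> \<open>The coefficients of \<open>\<phi>\<close> are the energies
      \<open>a \<gamma>\<close>, whose sums are bounded, so its Fourier sums can be controlled
      uniformly; those of \<open>g\<close> are controlled only in mean square.\<close>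
    define \<phi> where "\<phi> = conv g (tilde g)"
    have \<phi>: "\<phi> \<in> uc" unfolding \<phi>_def by (intro uc_conv uc_tilde g)
    have hat\<phi>: "hat \<phi> \<gamma> = of_real (a \<gamma>)" if "\<gamma> \<in> chars" for \<gamma>
      unfolding \<phi>_def a_def by (rule hat_conv_tilde[OF g that])
    define f where "f = (\<lambda>n. res (X n) \<phi>)"
    have f_uc: "f n \<in> uc" for n unfolding f_def by (intro uc_res X' \<phi>)
    have f_eq: "f n x = \<phi> x - (\<Sum>\<gamma>\<in>X n. of_real (a \<gamma>) * \<gamma> x)" for n x
      unfolding f_def res_def using X'(2)[of n] by (auto intro!: sum.cong simp: hat\<phi>)
    \<comment> \<open>A finite set of characters outside \<open>X n\<close> carries little energy,
      since adding it to \<open>X n\<close> cannot exceed the supremum \<open>Emax\<close>.\<close>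
    have half: "(\<Sum>\<gamma>\<in>Y - X n. a \<gamma>) \<le> 1 / real (Suc n)" if "Y \<in> S" for Y n
    proof -
      have "E (X n \<union> Y) = E (X n) + (\<Sum>\<gamma>\<in>Y - X n. a \<gamma>)"
        unfolding E_def using that X'[of n]
        by (subst sum.union_disjoint[symmetric]) (auto simp: S_def)
      moreover have "E (X n \<union> Y) \<le> Emax" using that X(1)[of n] by (intro E_Emax) (auto simp: S_def)
      ultimately show ?thesis using X(2)[of n] by linarith
    qed
    have diff: "cmod (f m x - f n x) \<le> 1 / real (Suc m) + 1 / real (Suc n)" for m n x
    proof -
      have bound: "cmod (\<Sum>\<gamma>\<in>X n - X m. of_real (a \<gamma>) * \<gamma> x) \<le> 1 / real (Suc m)" for m n
      proof -
        have "cmod (\<Sum>\<gamma>\<in>X n - X m. of_real (a \<gamma>) * \<gamma> x) \<le> (\<Sum>\<gamma>\<in>X n - X m. a \<gamma>)"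
          using X'(2)[of n] by (intro sum_norm_le) (auto simp: norm_mult a_nonneg charsD(2) subset_iff)
        also have "\<dots> \<le> 1 / real (Suc m)" by (rule half[OF X(1)])
        finally show ?thesis .
      qed
      let ?s = "\<lambda>Y. \<Sum>\<gamma>\<in>Y. of_real (a \<gamma>) * \<gamma> x"
      \<comment> \<open>The sets \<open>X n\<close> need not be nested; the terms they share
        cancel.\<close>
      have split: "?s (X n) = ?s (X n \<inter> X m) + ?s (X n - X m)" for m n
        using X'(1)[of n] by (rule sum.Int_Diff)
      have "f m x - f n x = ?s (X n) - ?s (X m)" by (simp add: f_eq)
      also have "\<dots> = ?s (X n - X m) - ?s (X m - X n)"
        using split[of n m] split[of m n] by (simp add: Int_commute)
      also have "cmod \<dots> \<le> cmod (?s (X n - X m)) + cmod (?s (X m - X n))"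
        by (rule norm_triangle_ineq4)
      also have "\<dots> \<le> 1 / real (Suc m) + 1 / real (Suc n)" by (intro add_mono bound)
      finally show ?thesis .
    qed
    have "uniformly_Cauchy_on UNIV f"
    proof (rule uniformly_Cauchy_onI)
      fix e :: real assume "e > 0"
      then obtain N where N: "inverse (real (Suc N)) < e / 2" using reals_Archimedean[of "e / 2"] by auto
      have small: "1 / real (Suc n) < e / 2" if "n \<ge> N" for n
      proof -
        have "1 / real (Suc n) \<le> 1 / real (Suc N)" using that by (intro divide_left_mono) auto
        with N show ?thesis by (simp add: inverse_eq_divide)
      qed
      then have "dist (f m x) (f n x) < e" if "m \<ge> N" "n \<ge> N" for m n x
        using diff[of m x n] small[OF that(1)] small[OF that(2)] by (simp add: dist_norm)
      then show "\<exists>N. \<forall>x\<in>UNIV. \<forall>m\<ge>N. \<forall>n\<ge>N. dist (f m x) (f n x) < e" by blast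
    qed
    then have "uniformly_convergent_on UNIV f" by (rule Cauchy_uniformly_convergent)
    then obtain \<Psi> where lim: "uniform_limit UNIV f \<Psi> sequentially"
      unfolding uniformly_convergent_on_def by blast
    have \<Psi>: "\<Psi> \<in> uc" by (rule uc_limit[OF f_uc lim])
    have f\<Psi>: "(\<lambda>n. f n x) \<longlonglongrightarrow> \<Psi> x" for x
      using tendsto_uniform_limitI[OF lim] by simp
    have "tilde \<phi> = \<phi>"
      unfolding \<phi>_def using tilde_conv[OF g uc_tilde[OF g]] conv_commute[OF g uc_tilde[OF g]] by simp
    then have "cnj (\<phi> (- x)) = \<phi> x" for x unfolding tilde_def by (rule fun_cong)
    then have f_herm: "cnj (f n (- x)) = f n x" for n x
      unfolding f_eq using X'(2)[of n] by (auto intro!: sum.cong simp: charsD(5) subset_iff)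
    have "tilde \<Psi> = \<Psi>"
    proof
      fix x
      have "(\<lambda>n. cnj (f n (- x))) \<longlonglongrightarrow> cnj (\<Psi> (- x))" by (intro tendsto_cnj f\<Psi>)
      with f\<Psi>[of x] show "tilde \<Psi> x = \<Psi> x" unfolding f_herm tilde_def by (rule LIMSEQ_unique[rotated])
    qed
    moreover have "\<Psi> 0 \<noteq> 0"
    proof -
      \<comment> \<open>Characters are 1 at 0, so this value is what the energies of
        \<open>X n\<close> leave over from \<open>n2 g\<close>.\<close>
      have "f n 0 = of_real (n2 g - E (X n))" for n
      proof -
        have "(\<Sum>\<gamma>\<in>X n. of_real (a \<gamma>) * \<gamma> 0) = (of_real (E (X n)) :: complex)"
          unfolding E_def of_real_sum using X'(2)[of n]
          by (intro sum.cong) (auto simp: charsD(4) subset_iff)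
        then show ?thesis by (simp add: f_eq \<phi>_def conv_tilde_0 g)
      qed
      moreover have "Emax \<le> n2 g" unfolding Emax_def using \<open>{} \<in> S\<close> E_le by (intro cSup_least) auto
      ultimately have "cmod (f n 0) \<ge> \<bar>n2 g - Emax\<bar>" for n
        using E_Emax[OF X(1)[of n]] by (simp add: norm_of_real del: of_real_diff)
      then have "\<bar>n2 g - Emax\<bar> \<le> cmod (\<Psi> 0)"
        by (intro LIMSEQ_le_const[OF tendsto_norm[OF f\<Psi>]]) auto
      with ne show ?thesis by auto
    qed
    ultimately obtain \<gamma> where \<gamma>: "\<gamma> \<in> chars" "hat \<Psi> \<gamma> \<noteq> 0"
      using hermitian_char[OF \<Psi>] by blast
    have hatf: "hat (f n) \<gamma> = (if \<gamma> \<in> X n then 0 else of_real (a \<gamma>))" for n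
      unfolding f_def hat_res[OF X' \<phi> \<gamma>(1)] hat\<phi>[OF \<gamma>(1)] ..
    \<comment> \<open>Coefficients pass to the uniform limit. As the limit is nonzero,
      \<open>\<gamma>\<close> stays outside \<open>X n\<close> for all large \<open>n\<close> while
      \<open>a \<gamma> > 0\<close>, which contradicts \<open>half\<close>.\<close>
    have "(\<lambda>n. conv \<gamma> (f n) 0) \<longlonglongrightarrow> conv \<gamma> \<Psi> 0"
      by (rule conv_limit[OF charsD(1)[OF \<gamma>(1)] f_uc lim])
    moreover have "conv \<gamma> F 0 = hat F \<gamma>" if "F \<in> uc" for F
      using conv_commute[OF charsD(1)[OF \<gamma>(1)] that] conv_char[OF that \<gamma>(1), of 0] charsD(4)[OF \<gamma>(1)]
      by simp
    ultimately have "(\<lambda>n. hat (f n) \<gamma>) \<longlonglongrightarrow> hat \<Psi> \<gamma>" using f_uc \<Psi> by simp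
    then have "\<forall>\<^sub>F n in sequentially. hat (f n) \<gamma> \<noteq> 0"
      using \<gamma>(2) by (rule tendsto_imp_eventually_ne)
    then obtain N where N: "\<And>n. n \<ge> N \<Longrightarrow> hat (f n) \<gamma> \<noteq> 0" unfolding eventually_sequentially by blast
    have notin: "\<gamma> \<notin> X n" "a \<gamma> \<noteq> 0" if "n \<ge> N" for n
      using N[OF that] hatf[of n] by (auto split: if_splits)
    have "a \<gamma> > 0" using notin(2)[of N] by (simp add: a_def)
    then obtain m where m: "inverse (real (Suc m)) < a \<gamma>" using reals_Archimedean by blast
    define n where "n = max m N"
    have "{\<gamma>} - X n = {\<gamma>}" using notin(1)[of n] by (auto simp: n_def)
    then have "a \<gamma> \<le> 1 / real (Suc n)"
      using half[of "{\<gamma>}" n] \<gamma>(1) by (simp add: S_def)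
    also have "\<dots> \<le> 1 / real (Suc m)" by (intro divide_left_mono) (auto simp: n_def)
    finally show False using m by (simp add: inverse_eq_divide)
  qed
  moreover obtain X where "X \<in> S" "Emax - e < E X"
    using less_cSupD[of "E ` S" "Emax - e"] \<open>{} \<in> S\<close> \<open>e > 0\<close> by (auto simp: Emax_def)
  ultimately show ?thesis
    using E_eq[of X] by (intro exI[of _ X]) (auto simp: S_def)
qed

lemma conv_res:
  assumes "finite X" "X \<subseteq> chars" and F: "F \<in> uc" and k: "k \<in> uc"
  shows "conv (res X F) k x = conv F k x - (\<Sum>\<gamma>\<in>X. hat F \<gamma> * hat k \<gamma> * \<gamma> x)"
  using assms(1,2)
proof (induction X)
  case (insert \<psi> X)
  then have \<psi>: "\<psi> \<in> chars" by simp
  have "conv \<psi> k x = hat k \<psi> * \<psi> x"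
    using conv_commute[OF charsD(1)[OF \<psi>] k] conv_char[OF k \<psi>, of x] by simp
  with insert show ?case
    by (simp add: res_insert conv_diff_left conv_scale_left uc_res uc_scale F k charsD(1)[OF \<psi>])
qed (simp add: res_empty)

text \<open>By the reverse triangle inequality. This is the source of the bump function that serves
  as approximate identity.\<close>

lemma uc_\<rho>: "\<rho> \<in> uc"
proof (rule ucI)
  fix e :: real assume "e > 0"
  have "norm (\<rho> x - \<rho> y) \<le> \<rho> (x - y)" for x y
    using \<rho>_triangle[of "x - y" y] \<rho>_triangle[of "y - x" x] \<rho>_minus[of "x - y"] by simp
  with \<open>e > 0\<close> show "\<exists>d>0. \<forall>x y. \<rho> (x - y) < d \<longrightarrow> norm (\<rho> x - \<rho> y) \<le> e"
    by (meson less_imp_le order_trans)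
qed

text \<open>An approximate identity \<open>k\<close> turns mean-square approximation of \<open>g\<close> into uniform approximation of
  \<open>g * k\<close>.\<close>

theorem Bohr_approximation:
  assumes g: "g \<in> uc" and "e > 0"
  shows "\<exists>X c. finite X \<and> X \<subseteq> chars \<and> (\<forall>x. cmod (g x - (\<Sum>\<gamma>\<in>X. c \<gamma> * \<gamma> x)) \<le> e)"
proof -
  have "e / 2 > 0" using \<open>e > 0\<close> by simp
  obtain d where d: "d > 0" "\<And>x y. \<rho> (x - y) < d \<Longrightarrow> norm (g x - g y) \<le> e / 2"
    using ucD[OF g \<open>e / 2 > 0\<close>] by blast
  \<comment> \<open>A tent of height 1 that vanishes outside the ball of radius \<open>d\<close>. It
    is not normalised; its mean \<open>m\<close> is carried along and divided out at the
    end.\<close>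
  define r where "r = (\<lambda>x. max 0 (1 - \<rho> x / d))"
  have r01: "0 \<le> r x" "r x \<le> 1" for x using \<rho>_nonneg[of x] d(1) by (auto simp: r_def)
  have r_uc: "r \<in> uc"
  proof (rule uc_dominated[OF uc_\<rho>])
    fix x y
    have "norm (r x - r y) \<le> \<bar>(1 - \<rho> x / d) - (1 - \<rho> y / d)\<bar>" unfolding r_def by auto
    also have "\<dots> = \<bar>\<rho> x - \<rho> y\<bar> / d" using d(1)
      by (simp add: diff_divide_distrib[symmetric] abs_divide abs_minus_commute)
    finally show "norm (r x - r y) \<le> norm (\<rho> x - \<rho> y) * (1 / d)" by simp
  qed (use d(1) in simp)
  define k where "k = (\<lambda>x. complex_of_real (r x))"
  have k: "k \<in> uc" unfolding k_def by (rule uc_bounded_linear[OF bounded_linear_of_real r_uc])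
  define m where "m = M r"
  have mean_r: "is_mean r m" unfolding m_def by (rule M_is_mean_real[OF r_uc])
  \<comment> \<open>From \<open>0 \<le> r \<le> 1\<close> follows \<open>r\<^sup>2 \<le> r\<close>,
    so the mean of \<open>r\<close> dominates the positive number \<open>n2 k\<close>.\<close>
  have "m > 0"
  proof -
    have "k 0 \<noteq> 0" using d(1) by (simp add: k_def r_def \<rho>_0)
    then have "n2 k > 0" by (rule n2_pos[OF k])
    moreover have "is_mean (\<lambda>x. r x - (cmod (k x))\<^sup>2) (m - n2 k)"
      by (intro is_mean_diff mean_r is_mean_n2 k)
    then have "m - n2 k \<ge> 0"
    proof (rule is_mean_nonneg)
      fix x
      show "0 \<le> r x - (cmod (k x))\<^sup>2"
        using mult_left_le[OF r01(2) r01(1), of x x] r01(1)[of x] by (simp add: k_def power2_eq_square)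
    qed
    ultimately show ?thesis by simp
  qed
  have mean_k: "M k = of_real m"
    unfolding k_def by (rule M_eqI) (rule is_mean_bounded_linear[OF bounded_linear_of_real mean_r])
  \<comment> \<open>Where the tent is nonzero, \<open>g (x - t)\<close> differs from
    \<open>g x\<close> by at most \<open>e / 2\<close>; the weight \<open>r\<close> has mean
    \<open>m\<close>.\<close>
  have approx1: "cmod (conv g k x - of_real m * g x) \<le> e / 2 * m" for x
  proof -
    have uc: "(\<lambda>t. g (x - t) * k t - g x * k t) \<in> uc" by (intro uc_diff uc_conv_integrand uc_scale g k)
    have "conv g k x - of_real m * g x = M (\<lambda>t. g (x - t) * k t - g x * k t)"
      using M_diff[OF uc_conv_integrand[OF g k, of x] uc_scale[OF k, of "g x"]]
      by (simp add: conv_def M_cmult k mean_k)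
    also have "cmod \<dots> \<le> e / 2 * m"
    proof (rule is_mean_norm_le_mean[OF M_is_mean[OF uc]])
      show "is_mean (\<lambda>t. e / 2 * r t) (e / 2 * m)"
        by (rule is_mean_bounded_linear[OF bounded_linear_mult_right mean_r])
      fix t
      have eq: "cmod (g (x - t) * k t - g x * k t) = cmod (g (x - t) - g x) * r t"
        using r01(1)[of t] by (simp add: left_diff_distrib[symmetric] norm_mult k_def)
      show "cmod (g (x - t) * k t - g x * k t) \<le> e / 2 * r t"
      proof (cases "\<rho> t < d")
        case True
        then show ?thesis
          unfolding eq using d(2)[of "x - t" x] \<rho>_minus[of t] r01(1)[of t] by (intro mult_right_mono) auto
      next
        case False
        then have "r t = 0" using d(1) by (simp add: r_def)
        then show ?thesis unfolding eq by simp
      qed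
    qed
    finally show ?thesis .
  qed
  have n2k: "n2 k \<ge> 0" by (rule n2_nonneg[OF k])
  \<comment> \<open>Chosen so that Cauchy-Schwarz bounds the convolution of \<open>k\<close> with
    the remainder of \<open>g\<close> by \<open>e / 2 * m\<close>.\<close>
  define \<eta> where "\<eta> = (e / 2 * m)\<^sup>2 / (n2 k + 1)"
  have "\<eta> > 0" using \<open>e > 0\<close> \<open>m > 0\<close> n2k by (simp add: \<eta>_def)
  obtain X where X: "finite X" "X \<subseteq> chars" "n2 (res X g) < \<eta>" using Parseval[OF g \<open>\<eta> > 0\<close>] by blast
  have approx2: "cmod (conv (res X g) k x) \<le> e / 2 * m" for x
  proof -
    have "(cmod (conv (res X g) k x))\<^sup>2 \<le> n2 (res X g) * n2 k"
      by (intro conv_bound uc_res X g k)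
    also have "\<dots> \<le> \<eta> * (n2 k + 1)" using X(3) n2k \<open>\<eta> > 0\<close> by (intro mult_mono) auto
    also have "\<dots> = (e / 2 * m)\<^sup>2" using n2k by (simp add: \<eta>_def)
    finally show ?thesis
      by (rule power2_le_imp_le) (use \<open>e > 0\<close> \<open>m > 0\<close> in simp)
  qed
  \<comment> \<open>Coefficients of \<open>g * k / m\<close>, since convolution multiplies Fourier
    coefficients.\<close>
  define c where "c = (\<lambda>\<gamma>. hat g \<gamma> * hat k \<gamma> / of_real m)"
  have "cmod (g x - (\<Sum>\<gamma>\<in>X. c \<gamma> * \<gamma> x)) \<le> e" for x
  proof -
    have "of_real m * (\<Sum>\<gamma>\<in>X. c \<gamma> * \<gamma> x) = (\<Sum>\<gamma>\<in>X. hat g \<gamma> * hat k \<gamma> * \<gamma> x)"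
      unfolding sum_distrib_left using \<open>m > 0\<close> by (intro sum.cong) (auto simp: c_def)
    then have eq: "of_real m * (g x - (\<Sum>\<gamma>\<in>X. c \<gamma> * \<gamma> x)) =
        conv (res X g) k x - (conv g k x - of_real m * g x)"
      by (simp add: conv_res X g k right_diff_distrib)
    have "m * cmod (g x - (\<Sum>\<gamma>\<in>X. c \<gamma> * \<gamma> x)) = cmod (of_real m * (g x - (\<Sum>\<gamma>\<in>X. c \<gamma> * \<gamma> x)))"
      using \<open>m > 0\<close> by (simp add: norm_mult)
    also have "\<dots> \<le> cmod (conv (res X g) k x) + cmod (conv g k x - of_real m * g x)"
      unfolding eq by (rule norm_triangle_ineq4)
    also have "\<dots> \<le> e / 2 * m + e / 2 * m" by (intro add_mono approx1 approx2)
    also have "\<dots> = m * e" by simp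
    finally show ?thesis using \<open>m > 0\<close> by simp
  qed
  with X(1,2) show ?thesis by blast
qed

end

section \<open>Translation and invariant measures\<close>

lemma ennreal_tendsto_0I:
  fixes X :: "'b \<Rightarrow> ennreal"
  assumes "\<And>e. e > 0 \<Longrightarrow> \<forall>\<^sub>F n in F. X n \<le> ennreal e"
  shows "(X \<longlongrightarrow> 0) F"
proof (rule order_tendstoI)
  fix a :: ennreal assume "0 < a"
  then obtain b where b: "0 < b" "b < a" using dense by blast
  have "b < top" using b(2) top_greatest by (rule less_le_trans)
  then obtain e where e: "b = ennreal e" "e \<ge> 0" by (cases b) auto
  with b(1) have "e > 0" by simp
  from assms[OF this] show "\<forall>\<^sub>F n in F. X n < a"
    using b e by (auto elim!: eventually_mono)
qed simp

lemma ennreal_tendsto_0D: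
  fixes X :: "'b \<Rightarrow> ennreal"
  assumes "(X \<longlongrightarrow> 0) F" "e > 0"
  shows "\<forall>\<^sub>F n in F. X n \<le> ennreal e"
  using order_tendstoD(2)[OF assms(1), of "ennreal e"] assms(2)
  by (auto elim!: eventually_mono)

lemma open_translation:
  fixes W :: "'a::topological_ab_group_add set"
  assumes "open W"
  shows "open {x. x - t \<in> W}"
proof -
  have "open ((\<lambda>x. x - t) -` W)"
    by (rule open_vimage[OF assms]) (intro continuous_intros)
  then show ?thesis by (simp add: vimage_def)
qed

lemma plus_image_eq: "(+) t ` A = {x :: 'a::ab_group_add. x - t \<in> A}"
proof (intro set_eqI iffI)
  fix x assume "x \<in> {x. x - t \<in> A}"
  then show "x \<in> (+) t ` A" by (intro image_eqI[of _ _ "x - t"]) auto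
qed auto

lemma compact_Minkowski_sum:
  fixes C D :: "'a::topological_ab_group_add set"
  assumes "compact C" "compact D"
  shows "compact {c + d | c d. c \<in> C \<and> d \<in> D}"
proof -
  have "compact ((\<lambda>z. fst z + snd z) ` (C \<times> D))"
    by (intro compact_continuous_image continuous_intros compact_Times assms)
  moreover have "(\<lambda>z. fst z + snd z) ` (C \<times> D) = {c + d | c d. c \<in> C \<and> d \<in> D}"
    by force
  ultimately show ?thesis by simp
qed

lemma norm_add_powr_le:
  fixes a b :: "'b::real_normed_vector"
  assumes "p \<ge> 0"
  shows "norm (a + b) powr p \<le> 2 powr p * (norm a powr p + norm b powr p)"
proof -
  have "norm (a + b) \<le> 2 * max (norm a) (norm b)" using norm_triangle_ineq[of a b] by auto
  then have "norm (a + b) powr p \<le> (2 * max (norm a) (norm b)) powr p"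
    using assms by (intro powr_mono2) auto
  also have "\<dots> = 2 powr p * max (norm a) (norm b) powr p" by (rule powr_mult)
  also have "\<dots> \<le> 2 powr p * (norm a powr p + norm b powr p)"
    by (intro mult_left_mono) (auto simp: max_def)
  finally show ?thesis .
qed

section \<open>Haar measure of Borel sets and of their translates\<close>

locale lca_haar =
  fixes \<theta> :: "'a::{topological_ab_group_add, second_countable_topology, t2_space} measure"
  assumes locally_compact: "locally_compact_space (euclidean :: 'a topology)"
    and haar: "haar_measure \<theta>"
begin

lemma sets_haar [measurable_cong, simp]: "sets \<theta> = sets borel"
  using haar by (simp add: haar_measure_def)

lemma space_haar [simp]: "space \<theta> = UNIV"
  using sets_eq_imp_space_eq[OF sets_haar] by simp

lemma emeasure_compact: "compact C \<Longrightarrow> emeasure \<theta> C < \<infinity>"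
  using haar by (simp add: haar_measure_def)

lemma measurable_translation [measurable]: "(\<lambda>x::'a. x - t) \<in> borel_measurable borel"
  by (intro borel_measurable_continuous_onI continuous_intros)

lemma sets_translation: "A \<in> sets borel \<Longrightarrow> {x::'a. x - t \<in> A} \<in> sets borel"
  using measurable_sets[OF measurable_translation, of A] by (simp add: vimage_def)

lemma emeasure_translation: "A \<in> sets borel \<Longrightarrow> emeasure \<theta> {x. x - t \<in> A} = emeasure \<theta> A"
  using haar by (simp add: haar_measure_def plus_image_eq)

lemma distr_translation: "distr \<theta> borel (\<lambda>x. x - t) = \<theta>"
proof (rule measure_eqI)
  fix A assume "A \<in> sets (distr \<theta> borel (\<lambda>x. x - t))"
  then have A: "A \<in> sets borel" by simp
  have "emeasure (distr \<theta> borel (\<lambda>x. x - t)) A = emeasure \<theta> {x. x - t \<in> A}"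
    using A by (subst emeasure_distr) (auto simp: vimage_def)
  then show "emeasure (distr \<theta> borel (\<lambda>x. x - t)) A = emeasure \<theta> A"
    using emeasure_translation[OF A] by simp
qed simp

lemma nn_integral_translation:
  assumes "h \<in> borel_measurable borel"
  shows "(\<integral>\<^sup>+x. h (x - t) \<partial>\<theta>) = (\<integral>\<^sup>+x. h x \<partial>\<theta>)"
proof -
  have "(\<integral>\<^sup>+x. h x \<partial>\<theta>) = (\<integral>\<^sup>+x. h x \<partial>distr \<theta> borel (\<lambda>x. x - t))" by (simp add: distr_translation)
  also have "\<dots> = (\<integral>\<^sup>+x. h (x - t) \<partial>\<theta>)"
    by (rule nn_integral_distr) (use assms in simp_all)
  finally show ?thesis by simp
qed

lemma compact_neighbourhood:
  obtains U C where "open U" "compact C" "(x::'a) \<in> U" "U \<subseteq> C"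
  using locally_compact unfolding locally_compact_space_def by simp blast

text \<open>These open sets have finite measure and, by second countability, still generate the
  Borel sets; the induction over Borel sets starts from them.\<close>

definition rel_compact_open :: "'a set set" where
  "rel_compact_open = {V. open V \<and> (\<exists>C. compact C \<and> V \<subseteq> C)}"

lemma open_countable_Union_rel_compact:
  assumes "open (W::'a set)"
  obtains \<B> where "countable \<B>" "\<B> \<subseteq> rel_compact_open" "\<Union>\<B> = W"
proof -
  obtain B :: "'a set set" where B: "countable B" "topological_basis B"
    using ex_countable_basis by blast
  define \<B> where "\<B> = {b \<in> B. b \<subseteq> W \<and> b \<in> rel_compact_open}"
  have "W \<subseteq> \<Union>\<B>"
  proof
    fix x assume "x \<in> W"
    obtain U C where U: "open U" "compact C" "x \<in> U" "U \<subseteq> C" by (rule compact_neighbourhood)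
    then obtain b where "b \<in> B" "x \<in> b" "b \<subseteq> U \<inter> W"
      using topological_basisE[OF B(2), of "U \<inter> W" x] \<open>x \<in> W\<close> assms by auto
    moreover have "open b" using \<open>b \<in> B\<close> B(2) topological_basis_open by blast
    ultimately have "b \<in> \<B>" using U by (auto simp: \<B>_def rel_compact_open_def)
    with \<open>x \<in> b\<close> show "x \<in> \<Union>\<B>" by blast
  qed
  then have "\<Union>\<B> = W" by (auto simp: \<B>_def)
  moreover have "countable \<B>" using B(1) by (auto simp: \<B>_def)
  ultimately show ?thesis using that by (auto simp: \<B>_def)
qed

lemma emeasure_rel_compact_open: "V \<in> rel_compact_open \<Longrightarrow> emeasure \<theta> V < \<infinity>"
proof -
  assume "V \<in> rel_compact_open"
  then obtain C where C: "compact C" "V \<subseteq> C" by (auto simp: rel_compact_open_def)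
  have "emeasure \<theta> V \<le> emeasure \<theta> C"
    using C by (intro emeasure_mono) (auto intro: borel_compact)
  also have "\<dots> < \<infinity>" by (rule emeasure_compact[OF C(1)])
  finally show ?thesis .
qed

lemma sigma_finite_haar: "sigma_finite_measure \<theta>"
proof
  obtain \<B> where \<B>: "countable \<B>" "\<B> \<subseteq> rel_compact_open" "\<Union>\<B> = UNIV"
    using open_countable_Union_rel_compact[OF open_UNIV] .
  have "\<B> \<subseteq> sets \<theta>" using \<B>(2) by (auto simp: rel_compact_open_def)
  moreover have "emeasure \<theta> a \<noteq> \<infinity>" if "a \<in> \<B>" for a
    using emeasure_rel_compact_open[of a] \<B>(2) that by auto
  ultimately show "\<exists>A. countable A \<and> A \<subseteq> sets \<theta> \<and> \<Union>A = space \<theta> \<and> (\<forall>a\<in>A. emeasure \<theta> a \<noteq> \<infinity>)"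
    using \<B>(1,3) by (intro exI[of _ \<B>]) auto
qed

text \<open>By Lindelof countably many translates of \<open>W\<close> cover the group, so a null set
  \<open>W\<close> would make the whole group null.\<close>

lemma emeasure_open_pos:
  assumes "open W" "W \<noteq> {}"
  shows "emeasure \<theta> W > 0"
proof (rule ccontr)
  assume "\<not> ?thesis"
  then have W0: "emeasure \<theta> W = 0" by simp
  obtain w where "w \<in> W" using assms(2) by blast
  define \<F> where "\<F> = range (\<lambda>t. {x. x - t \<in> W})"
  have "S \<in> \<F> \<Longrightarrow> open S" for S using open_translation[OF assms(1)] by (auto simp: \<F>_def)
  then obtain \<F>' where F': "\<F>' \<subseteq> \<F>" "countable \<F>'" "\<Union>\<F>' = \<Union>\<F>" by (rule Lindelof) blast
  have "x \<in> \<Union>\<F>" for x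
    unfolding \<F>_def by (rule UnionI[of "{y. y - (x - w) \<in> W}"]) (use \<open>w \<in> W\<close> in auto)
  then have U: "\<Union>\<F>' = UNIV" unfolding F'(3) by blast
  have "S \<in> null_sets \<theta>" if "S \<in> \<F>'" for S
  proof -
    obtain t where "S = {x. x - t \<in> W}" using F'(1) \<open>S \<in> \<F>'\<close> by (auto simp: \<F>_def)
    then show ?thesis using assms(1) W0 by (auto simp: null_sets_def emeasure_translation sets_translation)
  qed
  then have "(\<Union>S\<in>\<F>'. S) \<in> null_sets \<theta>" by (intro null_sets_UN' F'(2))
  with U have "emeasure \<theta> UNIV = 0" by auto
  with haar show False by (simp add: haar_measure_def)
qed

lemma sets_borel_eq_rel_compact: "sets (borel :: 'a measure) = sigma_sets UNIV rel_compact_open"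
proof
  have "sigma_sets UNIV (Collect open) \<subseteq> sigma_sets UNIV (rel_compact_open)"
  proof (rule sigma_sets_mono, rule subsetI)
    fix W :: "'a set" assume "W \<in> Collect open"
    then obtain \<B> where \<B>: "countable \<B>" "\<B> \<subseteq> rel_compact_open" "\<Union>\<B> = W"
      using open_countable_Union_rel_compact[of W] by auto
    interpret sigma_algebra UNIV "sigma_sets UNIV rel_compact_open"
      by (rule sigma_algebra_sigma_sets) simp
    have "\<Union>\<B> \<in> sigma_sets UNIV rel_compact_open"
      using \<B>(1,2) by (intro countable_Union) auto
    with \<B>(3) show "W \<in> sigma_sets UNIV rel_compact_open" by simp
  qed
  then show "sets (borel :: 'a measure) \<subseteq> sigma_sets UNIV rel_compact_open"
    by (simp add: borel_def)
  have "rel_compact_open \<subseteq> sets borel" by (auto simp: rel_compact_open_def)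
  then show "sigma_sets UNIV rel_compact_open \<subseteq> sets (borel :: 'a measure)"
    using sets.sigma_sets_subset[of rel_compact_open borel] by simp
qed

text \<open>A compact neighbourhood of 0 contains the late terms of \<open>- s n\<close>, so adding
  it to \<open>C\<close> absorbs the late translations.\<close>

lemma compact_translates:
  fixes s :: "nat \<Rightarrow> 'a"
  assumes "s \<longlonglongrightarrow> 0" "compact C"
  obtains C' n0 where "compact C'" "C \<subseteq> C'" "\<And>n x. n \<ge> n0 \<Longrightarrow> x \<in> C \<Longrightarrow> x - s n \<in> C'"
proof -
  obtain U D where U: "open U" "compact D" "(0::'a) \<in> U" "U \<subseteq> D" by (rule compact_neighbourhood)
  have "(\<lambda>n. - s n) \<longlonglongrightarrow> - 0" by (intro tendsto_minus assms)
  then have "\<forall>\<^sub>F n in sequentially. - s n \<in> U" using U by (intro topological_tendstoD) auto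
  then obtain n0 where n0: "\<And>n. n \<ge> n0 \<Longrightarrow> - s n \<in> U" unfolding eventually_sequentially by blast
  define C' where "C' = {c + d | c d. c \<in> C \<and> d \<in> D}"
  have "compact C'" unfolding C'_def by (intro compact_Minkowski_sum assms U)
  moreover have "C \<subseteq> C'"
    using U by (force simp: C'_def)
  moreover have "x - s n \<in> C'" if "n \<ge> n0" "x \<in> C" for n x
    using n0[OF that(1)] that(2) U(4) by (force simp: C'_def)
  ultimately show ?thesis using that by blast
qed

lemma sets_translation_difference:
  assumes "A \<in> sets borel" "compact C"
  shows "{x \<in> C. (x - t \<in> A) \<noteq> (x \<in> A)} \<in> sets (borel :: 'a measure)"
proof -
  have "{x \<in> C. (x - t \<in> A) \<noteq> (x \<in> A)} = C \<inter> (({x. x - t \<in> A} - A) \<union> (A - {x. x - t \<in> A}))"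
    by auto
  also have "\<dots> \<in> sets borel"
    by (intro sets.Int sets.Un sets.Diff sets_translation assms borel_compact)
  finally show ?thesis .
qed

text \<open>For an open \<open>V\<close> of finite measure, \<open>V\<close> minus its translate tends to a null set pointwise, and by
  invariance the translate minus \<open>V\<close> has the same measure.\<close>

lemma emeasure_translation_difference:
  assumes s: "s \<longlonglongrightarrow> (0::'a)" and A: "A \<in> sets borel" and C: "compact C"
  shows "(\<lambda>n. emeasure \<theta> {x \<in> C. (x - s n \<in> A) \<noteq> (x \<in> A)}) \<longlonglongrightarrow> 0"
proof -
  define D where "D = (\<lambda>A C n. {x \<in> C. (x - s n \<in> A) \<noteq> (x \<in> A)})"
  have D_sets: "D A C n \<in> sets borel" if "A \<in> sets borel" "compact C" for A C n
    unfolding D_def by (rule sets_translation_difference[OF that])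
  have "A \<in> sigma_sets UNIV rel_compact_open" using A by (simp add: sets_borel_eq_rel_compact)
  then have "A \<in> sets borel \<and> (\<forall>C. compact C \<longrightarrow> (\<lambda>n. emeasure \<theta> (D A C n)) \<longlonglongrightarrow> 0)"
  proof (induction rule: sigma_sets.induct)
    case (Basic V)
    then have "open V" and fin: "emeasure \<theta> V < \<infinity>"
      using emeasure_rel_compact_open by (auto simp: rel_compact_open_def)
    then have V: "V \<in> sets borel" by simp
    define W where "W = (\<lambda>n. {x. x - s n \<in> V})"
    have W: "W n \<in> sets borel" for n unfolding W_def by (rule sets_translation[OF V])
    have "(\<lambda>n. \<integral>\<^sup>+x. indicator (V - W n) x \<partial>\<theta>) \<longlonglongrightarrow> (\<integral>\<^sup>+x. 0 \<partial>\<theta>)"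
    proof (rule nn_integral_dominated_convergence[where w = "indicator V"])
      show "AE x in \<theta>. (\<lambda>n. indicator (V - W n) x) \<longlonglongrightarrow> (0::ennreal)"
      proof (rule AE_I2)
        fix x
        show "(\<lambda>n. indicator (V - W n) x) \<longlonglongrightarrow> (0::ennreal)"
        proof (cases "x \<in> V")
          case True
          have "(\<lambda>n. x - s n) \<longlonglongrightarrow> x - 0" by (intro tendsto_intros s)
          then have "\<forall>\<^sub>F n in sequentially. x - s n \<in> V"
            using \<open>open V\<close> True by (intro topological_tendstoD) auto
          then show ?thesis
            by (intro tendsto_eventually) (auto elim!: eventually_mono simp: W_def)
        qed simp
      qed
    qed (use V W fin in \<open>auto intro!: AE_I2 split: split_indicator\<close>)
    then have lim: "(\<lambda>n. emeasure \<theta> (V - W n)) \<longlonglongrightarrow> 0" using V W by simp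
    have eq: "emeasure \<theta> (W n - V) = emeasure \<theta> (V - W n)" for n
    proof -
      have WV: "emeasure \<theta> (W n) = emeasure \<theta> V" unfolding W_def by (rule emeasure_translation[OF V])
      have "emeasure \<theta> (V \<inter> W n) \<le> emeasure \<theta> V" using V by (intro emeasure_mono) auto
      then have fin': "emeasure \<theta> (V \<inter> W n) \<noteq> \<infinity>" using fin by (metis infinity_ennreal_def leD)
      have "emeasure \<theta> (W n - (V \<inter> W n)) = emeasure \<theta> (W n) - emeasure \<theta> (V \<inter> W n)"
        using V W fin' by (intro emeasure_Diff) auto
      moreover have "emeasure \<theta> (V - (V \<inter> W n)) = emeasure \<theta> V - emeasure \<theta> (V \<inter> W n)"
        using V W fin' by (intro emeasure_Diff) auto
      moreover have "W n - (V \<inter> W n) = W n - V" "V - (V \<inter> W n) = V - W n" by auto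
      ultimately show ?thesis by (simp add: WV)
    qed
    have "(\<lambda>n. emeasure \<theta> (D V C n)) \<longlonglongrightarrow> 0" for C
    proof (rule tendsto_sandwich[OF _ _ tendsto_const])
      have "emeasure \<theta> (D V C n) \<le> emeasure \<theta> (V - W n) + emeasure \<theta> (V - W n)" for n
      proof -
        have "emeasure \<theta> (D V C n) \<le> emeasure \<theta> ((V - W n) \<union> (W n - V))"
          using V W by (intro emeasure_mono) (auto simp: D_def W_def)
        also have "\<dots> \<le> emeasure \<theta> (V - W n) + emeasure \<theta> (W n - V)"
          using V W by (intro emeasure_subadditive) auto
        finally show ?thesis by (simp add: eq)
      qed
      then show "\<forall>\<^sub>F n in sequentially. emeasure \<theta> (D V C n) \<le> emeasure \<theta> (V - W n) + emeasure \<theta> (V - W n)"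
        by simp
      show "(\<lambda>n. emeasure \<theta> (V - W n) + emeasure \<theta> (V - W n)) \<longlonglongrightarrow> 0"
        using tendsto_add[OF lim lim] by simp
    qed simp
    with V show ?case by blast
  next
    case Empty
    show ?case by (simp add: D_def)
  next
    case (Compl A)
    have "D (UNIV - A) = D A" by (auto simp: D_def fun_eq_iff)
    with Compl show ?case by auto
  next
    case (Union A)
    then have A: "A i \<in> sets borel" for i by blast
    have "(\<lambda>n. emeasure \<theta> (D (\<Union>i. A i) C n)) \<longlonglongrightarrow> 0" if C: "compact C" for C
    proof (rule ennreal_tendsto_0I)
      fix e :: real assume "e > 0"
      obtain C' n0 where C': "compact C'" "C \<subseteq> C'" "\<And>n x. n \<ge> n0 \<Longrightarrow> x \<in> C \<Longrightarrow> x - s n \<in> C'"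
        using compact_translates[OF s C] by blast
      \<comment> \<open>The tail of the union, cut down to a compact set so that its measure is
        finite and tends to 0. Membership in the union can change under translation only through one
        of the first \<open>N\<close> sets, through the tail, or through the translated tail, which
        has the same measure.\<close>
      define B where "B = (\<lambda>N. C' \<inter> ((\<Union>i. A i) - (\<Union>i<N. A i)))"
      have B: "B N \<in> sets borel" for N
        unfolding B_def using A borel_compact[OF C'(1)] by auto
      have "emeasure \<theta> (B N) \<noteq> \<infinity>" for N
      proof -
        have "emeasure \<theta> (B N) \<le> emeasure \<theta> C'"
          using C'(1) by (intro emeasure_mono) (auto simp: B_def intro: borel_compact)
        also have "\<dots> < \<infinity>" by (rule emeasure_compact[OF C'(1)])
        finally show ?thesis by simp
      qed
      moreover have "decseq B"
        by (fastforce simp: B_def decseq_def)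
      ultimately have "(\<lambda>N. emeasure \<theta> (B N)) \<longlonglongrightarrow> emeasure \<theta> (\<Inter>N. B N)"
        using B by (intro Lim_emeasure_decseq) auto
      moreover have "(\<Inter>N. B N) = {}"
        by (fastforce simp: B_def)
      ultimately have "(\<lambda>N. emeasure \<theta> (B N)) \<longlonglongrightarrow> 0" by simp
      then have "\<forall>\<^sub>F N in sequentially. emeasure \<theta> (B N) \<le> ennreal (e / 3)"
        by (rule ennreal_tendsto_0D) (use \<open>e > 0\<close> in simp)
      then obtain N where N: "emeasure \<theta> (B N) \<le> ennreal (e / 3)" unfolding eventually_sequentially by blast
      have "(\<lambda>n. \<Sum>i<N. emeasure \<theta> (D (A i) C n)) \<longlonglongrightarrow> (\<Sum>i<N. 0)"
        using Union C by (intro tendsto_sum) blast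
      then have "(\<lambda>n. \<Sum>i<N. emeasure \<theta> (D (A i) C n)) \<longlonglongrightarrow> 0" by simp
      then have ev: "\<forall>\<^sub>F n in sequentially. (\<Sum>i<N. emeasure \<theta> (D (A i) C n)) \<le> ennreal (e / 3)"
        by (rule ennreal_tendsto_0D) (use \<open>e > 0\<close> in simp)
      have bound: "emeasure \<theta> (D (\<Union>i. A i) C n) \<le> (\<Sum>i<N. emeasure \<theta> (D (A i) C n)) + ennreal (e / 3) + ennreal (e / 3)"
        if n: "n \<ge> n0" for n
      proof -
        let ?T = "{x. x - s n \<in> B N}"
        have T: "?T \<in> sets borel" by (rule sets_translation[OF B])
        have sub: "D (\<Union>i. A i) C n \<subseteq> (\<Union>i<N. D (A i) C n) \<union> B N \<union> ?T"
          using C'(2) C'(3)[OF n] by (auto simp: D_def B_def)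
        have DU: "(\<Union>i<N. D (A i) C n) \<in> sets \<theta>" using D_sets[OF A C] by auto
        have "emeasure \<theta> (D (\<Union>i. A i) C n) \<le> emeasure \<theta> ((\<Union>i<N. D (A i) C n) \<union> B N \<union> ?T)"
          using DU B T by (intro emeasure_mono sub) auto
        also have "\<dots> \<le> emeasure \<theta> ((\<Union>i<N. D (A i) C n) \<union> B N) + emeasure \<theta> ?T"
          using DU B T by (intro emeasure_subadditive) auto
        also have "\<dots> \<le> emeasure \<theta> (\<Union>i<N. D (A i) C n) + emeasure \<theta> (B N) + emeasure \<theta> ?T"
          using DU B by (intro add_right_mono emeasure_subadditive) auto
        also have "\<dots> \<le> (\<Sum>i<N. emeasure \<theta> (D (A i) C n)) + ennreal (e / 3) + ennreal (e / 3)"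
          using D_sets[OF A C] N emeasure_translation[OF B]
          by (intro add_mono emeasure_subadditive_finite) auto
        finally show ?thesis .
      qed
      from ev eventually_ge_at_top[of n0] show "\<forall>\<^sub>F n in sequentially. emeasure \<theta> (D (\<Union>i. A i) C n) \<le> ennreal e"
      proof eventually_elim
        case (elim n)
        have "emeasure \<theta> (D (\<Union>i. A i) C n) \<le> ennreal (e / 3) + ennreal (e / 3) + ennreal (e / 3)"
          using bound[OF elim(2)] elim(1) by (meson add_right_mono order_trans)
        also have "\<dots> = ennreal e" using \<open>e > 0\<close> by (simp flip: ennreal_plus)
        finally show ?case .
      qed
    qed
    with A show ?case by auto
  qed
  with C show ?thesis by (simp add: D_def)
qed

end

section \<open>Local \<open>p\<close>-th power integrals and continuity of translation\<close>

locale stepanov = lca_haar \<theta>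
  for \<theta> :: "'a::{topological_ab_group_add, second_countable_topology, t2_space} measure" +
  fixes p :: real and K :: "'a set"
  assumes p: "1 \<le> p" and K_sets: "K \<in> sets \<theta>"
    and K_compact: "compact (closure K)" and K_interior: "interior K \<noteq> {}"
begin

definition L :: "'a set \<Rightarrow> ('a \<Rightarrow> complex) \<Rightarrow> ennreal" where
  "L A F = (\<integral>\<^sup>+x\<in>A. ennreal (cmod (F x) powr p) \<partial>\<theta>)"

lemma L_mono: "A \<subseteq> B \<Longrightarrow> L A F \<le> L B F"
  unfolding L_def by (intro nn_integral_mono) (auto split: split_indicator)

abbreviation c2 :: ennreal where "c2 \<equiv> ennreal (2 powr p)"

lemma L_add:
  assumes [measurable]: "F \<in> borel_measurable borel" "H \<in> borel_measurable borel" "A \<in> sets borel"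
  shows "L A (\<lambda>x. F x + H x) \<le> c2 * (L A F + L A H)"
proof -
  let ?f = "\<lambda>F x. ennreal (cmod (F x) powr p) * indicator A x"
  have "L A (\<lambda>x. F x + H x) \<le> (\<integral>\<^sup>+x. c2 * (?f F x + ?f H x) \<partial>\<theta>)"
    unfolding L_def
  proof (rule nn_integral_mono)
    fix x
    have "ennreal (cmod (F x + H x) powr p) \<le> ennreal (2 powr p * (cmod (F x) powr p + cmod (H x) powr p))"
      using p by (intro ennreal_leI norm_add_powr_le) simp
    also have "\<dots> = c2 * (ennreal (cmod (F x) powr p) + ennreal (cmod (H x) powr p))"
      by (simp add: ennreal_mult)
    finally show "ennreal (cmod (F x + H x) powr p) * indicator A x \<le> c2 * (?f F x + ?f H x)"
      by (auto split: split_indicator)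
  qed
  also have "\<dots> = c2 * (L A F + L A H)"
    unfolding L_def by (subst nn_integral_cmult) (simp_all add: nn_integral_add)
  finally show ?thesis .
qed

text \<open>\<open>\<eta>'\<close> is the share of each of two summands when \<open>L_add\<close> or
  \<open>N_add\<close> has to deliver the bound \<open>\<eta>\<close>.\<close>

lemma c2_half:
  assumes "\<eta> > 0"
  obtains \<eta>' where "\<eta>' > 0" "c2 * (ennreal \<eta>' + ennreal \<eta>') = ennreal \<eta>"
proof
  show "\<eta> / (2 powr p * 2) > 0" using assms by simp
  show "c2 * (ennreal (\<eta> / (2 powr p * 2)) + ennreal (\<eta> / (2 powr p * 2))) = ennreal \<eta>"
    using assms by (simp flip: ennreal_plus ennreal_mult)
qed

lemma L_minus: "L A (\<lambda>x. - F x) = L A F"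
  by (simp add: L_def)

lemma L_diff:
  assumes "F \<in> borel_measurable borel" "H \<in> borel_measurable borel" "A \<in> sets borel"
  shows "L A (\<lambda>x. F x - H x) \<le> c2 * (L A F + L A H)"
  using L_add[OF assms(1) borel_measurable_uminus[OF assms(2)] assms(3)] by (simp add: L_minus)

lemma L_translation:
  assumes [measurable]: "F \<in> borel_measurable borel" "A \<in> sets borel"
  shows "L {x. x - t \<in> A} (\<lambda>x. F (x - t)) = L A F"
proof -
  have "L {x. x - t \<in> A} (\<lambda>x. F (x - t)) =
      (\<integral>\<^sup>+x. (\<lambda>x. ennreal (cmod (F x) powr p) * indicator A x) (x - t) \<partial>\<theta>)"
    unfolding L_def by (intro nn_integral_cong) (auto split: split_indicator)
  also have "\<dots> = L A F"
    unfolding L_def by (rule nn_integral_translation) measurable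
  finally show ?thesis .
qed

lemma Lp_loc_iff:
  "f \<in> Lp_loc \<theta> p \<longleftrightarrow> f \<in> borel_measurable borel \<and> (\<forall>C. compact C \<longrightarrow> L C f < \<infinity>)"
  by (simp add: Lp_loc_def L_def measurable_cong_sets[OF sets_haar refl])

lemma borel_measurable_translate:
  "F \<in> borel_measurable borel \<Longrightarrow> (\<lambda>x::'a. F (x - t)) \<in> borel_measurable borel"
  for F :: "'a \<Rightarrow> complex"
  using measurable_compose[OF measurable_translation] .

text \<open>Where translation changes the value of \<open>\<sigma>\<close>, the point lies in the
  difference set of the level set of \<open>\<sigma> x\<close>, and the change is at most
  \<open>2 * b\<close>; there are finitely many level sets.\<close>

lemma L_simple_translation_tendsto:
  assumes s: "s \<longlonglongrightarrow> (0::'a)" and \<sigma>: "simple_function \<theta> \<sigma>" and C: "compact C"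
  shows "(\<lambda>n. L C (\<lambda>x. \<sigma> (x - s n) - \<sigma> x)) \<longlonglongrightarrow> 0"
proof -
  define R where "R = range \<sigma>"
  have "finite R" using simple_functionD(1)[OF \<sigma>] by (simp add: R_def)
  have A: "\<sigma> -` {y} \<in> sets borel" for y using simple_functionD(2)[OF \<sigma>, of "{y}"] by simp
  define D where "D = (\<lambda>y n. {x \<in> C. (x - s n \<in> \<sigma> -` {y}) \<noteq> (x \<in> \<sigma> -` {y})})"
  have D: "D y n \<in> sets \<theta>" for y n
    unfolding D_def sets_haar by (rule sets_translation_difference[OF A C])
  define b where "b = Max (norm ` R)"
  have b: "norm (\<sigma> x) \<le> b" for x unfolding b_def using \<open>finite R\<close> by (intro Max_ge) (auto simp: R_def)
  then have "b \<ge> 0" using norm_ge_zero order_trans by blast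
  have "L C (\<lambda>x. \<sigma> (x - s n) - \<sigma> x) \<le> ennreal ((2 * b) powr p) * (\<Sum>y\<in>R. emeasure \<theta> (D y n))" for n
  proof -
    have "L C (\<lambda>x. \<sigma> (x - s n) - \<sigma> x) \<le> (\<integral>\<^sup>+x. ennreal ((2 * b) powr p) * (\<Sum>y\<in>R. indicator (D y n) x) \<partial>\<theta>)"
      unfolding L_def
    proof (rule nn_integral_mono)
      fix x
      let ?d = "\<sigma> (x - s n) - \<sigma> x"
      show "ennreal (cmod ?d powr p) * indicator C x \<le> ennreal ((2 * b) powr p) * (\<Sum>y\<in>R. indicator (D y n) x)"
      proof (cases "x \<in> C \<and> \<sigma> (x - s n) \<noteq> \<sigma> x")
        case True
        then have "x \<in> D (\<sigma> x) n" by (simp add: D_def)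
        then have "(1::ennreal) = indicator (D (\<sigma> x) n) x" by simp
        also have "\<dots> \<le> (\<Sum>y\<in>R. indicator (D y n) x)"
          using \<open>finite R\<close> by (intro member_le_sum) (auto simp: R_def)
        finally have "ennreal ((2 * b) powr p) * 1 \<le> ennreal ((2 * b) powr p) * (\<Sum>y\<in>R. indicator (D y n) x)"
          by (intro mult_left_mono) auto
        moreover have "cmod ?d \<le> 2 * b"
          using norm_triangle_ineq4[of "\<sigma> (x - s n)" "\<sigma> x"] b[of x] b[of "x - s n"] by simp
        then have "ennreal (cmod ?d powr p) \<le> ennreal ((2 * b) powr p)"
          using p by (intro ennreal_leI powr_mono2) auto
        ultimately have "ennreal (cmod ?d powr p) \<le> ennreal ((2 * b) powr p) * (\<Sum>y\<in>R. indicator (D y n) x)"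
          by (metis mult.right_neutral order_trans)
        then show ?thesis using True by simp
      qed auto
    qed
    also have "\<dots> = ennreal ((2 * b) powr p) * (\<Sum>y\<in>R. emeasure \<theta> (D y n))"
      using D by (simp add: nn_integral_cmult nn_integral_sum)
    finally show ?thesis .
  qed
  moreover have "(\<lambda>n. ennreal ((2 * b) powr p) * (\<Sum>y\<in>R. emeasure \<theta> (D y n))) \<longlonglongrightarrow> ennreal ((2 * b) powr p) * (\<Sum>y\<in>R. 0)"
    unfolding D_def
    by (intro ennreal_tendsto_cmult tendsto_sum emeasure_translation_difference s A C) simp
  then have lim: "(\<lambda>n. ennreal ((2 * b) powr p) * (\<Sum>y\<in>R. emeasure \<theta> (D y n))) \<longlonglongrightarrow> 0" by simp
  ultimately show ?thesis by (intro tendsto_sandwich[OF _ _ tendsto_const lim]) auto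
qed

text \<open>Density of simple functions: the error \<open>f - \<sigma> i\<close> is small over the
  larger compact set \<open>C'\<close>, which controls it over \<open>C\<close> both before and
  after translation.\<close>

lemma L_translation_tendsto:
  assumes s: "s \<longlonglongrightarrow> (0::'a)" and f: "f \<in> Lp_loc \<theta> p" and C: "compact C"
  shows "(\<lambda>n. L C (\<lambda>x. f (x - s n) - f x)) \<longlonglongrightarrow> 0"
proof (rule ennreal_tendsto_0I)
  fix e :: real assume "e > 0"
  have [measurable]: "f \<in> borel_measurable borel" using f by (simp add: Lp_loc_iff)
  obtain C' n0 where C': "compact C'" "C \<subseteq> C'" "\<And>n x. n \<ge> n0 \<Longrightarrow> x \<in> C \<Longrightarrow> x - s n \<in> C'"
    using compact_translates[OF s C] by blast
  have [measurable]: "C \<in> sets borel" "C' \<in> sets borel" using C C'(1) by (auto intro: borel_compact)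
  have "f \<in> borel_measurable \<theta>" by (simp add: measurable_cong_sets[OF sets_haar refl])
  from borel_measurable_implies_sequence_metric[OF this, of 0]
  obtain \<sigma> where \<sigma>: "\<And>i. simple_function \<theta> (\<sigma> i)" "\<And>x. (\<lambda>i. \<sigma> i x) \<longlonglongrightarrow> f x"
    "\<And>i x. cmod (\<sigma> i x) \<le> 2 * cmod (f x)" by auto
  have [measurable]: "\<sigma> i \<in> borel_measurable borel" for i
    using borel_measurable_simple_function[OF \<sigma>(1)] by (simp add: measurable_cong_sets[OF sets_haar refl])
  have "(\<lambda>i. L C' (\<lambda>x. f x - \<sigma> i x)) \<longlonglongrightarrow> (\<integral>\<^sup>+x. 0 \<partial>\<theta>)"
    unfolding L_def
  proof (rule nn_integral_dominated_convergence[where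
        w = "\<lambda>x. ennreal (3 powr p) * (ennreal (cmod (f x) powr p) * indicator C' x)"])
    show "AE x in \<theta>. ennreal (cmod (f x - \<sigma> i x) powr p) * indicator C' x
        \<le> ennreal (3 powr p) * (ennreal (cmod (f x) powr p) * indicator C' x)" for i
    proof (rule AE_I2)
      fix x
      \<comment> \<open>The factor is \<open>1 + 2\<close>, from the bound
        \<open>2 * cmod (f x)\<close> on the approximants.\<close>
      have "cmod (f x - \<sigma> i x) \<le> 3 * cmod (f x)"
        using norm_triangle_ineq4[of "f x" "\<sigma> i x"] \<sigma>(3)[of i x] by simp
      then have "cmod (f x - \<sigma> i x) powr p \<le> (3 * cmod (f x)) powr p" using p by (intro powr_mono2) auto
      then have "ennreal (cmod (f x - \<sigma> i x) powr p) \<le> ennreal (3 powr p) * ennreal (cmod (f x) powr p)"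
        by (simp add: powr_mult flip: ennreal_mult)
      then show "ennreal (cmod (f x - \<sigma> i x) powr p) * indicator C' x
        \<le> ennreal (3 powr p) * (ennreal (cmod (f x) powr p) * indicator C' x)"
        by (simp add: mult.assoc[symmetric] mult_right_mono)
    qed
    have "(\<integral>\<^sup>+x. ennreal (3 powr p) * (ennreal (cmod (f x) powr p) * indicator C' x) \<partial>\<theta>) = ennreal (3 powr p) * L C' f"
      unfolding L_def by (rule nn_integral_cmult) measurable
    also have "\<dots> < \<infinity>" using f C'(1) by (simp add: Lp_loc_iff ennreal_mult_less_top)
    finally show "(\<integral>\<^sup>+x. ennreal (3 powr p) * (ennreal (cmod (f x) powr p) * indicator C' x) \<partial>\<theta>) < \<infinity>" .
    show "AE x in \<theta>. (\<lambda>i. ennreal (cmod (f x - \<sigma> i x) powr p) * indicator C' x) \<longlonglongrightarrow> 0"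
    proof (rule AE_I2)
      fix x
      have "(\<lambda>i. cmod (f x - \<sigma> i x) powr p) \<longlonglongrightarrow> cmod (f x - f x) powr p"
        using p by (intro tendsto_powr' tendsto_norm tendsto_diff tendsto_const \<sigma>(2)) auto
      then have "(\<lambda>i. ennreal (cmod (f x - \<sigma> i x) powr p)) \<longlonglongrightarrow> ennreal 0"
        by (intro tendsto_ennrealI) simp
      then show "(\<lambda>i. ennreal (cmod (f x - \<sigma> i x) powr p) * indicator C' x) \<longlonglongrightarrow> 0"
        by (cases "x \<in> C'") auto
    qed
  qed measurable
  then have lim0: "(\<lambda>i. L C' (\<lambda>x. f x - \<sigma> i x)) \<longlonglongrightarrow> 0" by simp
  \<comment> \<open>Two levels of halving: the outer one separates the simple function from the
    error \<open>g\<close>, the inner one the two terms of \<open>g (x - s n) - g x\<close>.\<close>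
  obtain \<eta>' where \<eta>': "\<eta>' > 0" "c2 * (ennreal \<eta>' + ennreal \<eta>') = ennreal e"
    using c2_half[OF \<open>e > 0\<close>] by blast
  obtain \<eta> where \<eta>: "\<eta> > 0" "c2 * (ennreal \<eta> + ennreal \<eta>) = ennreal \<eta>'"
    using c2_half[OF \<eta>'(1)] by blast
  obtain i where i: "L C' (\<lambda>x. f x - \<sigma> i x) \<le> ennreal \<eta>"
    using ennreal_tendsto_0D[OF lim0 \<eta>(1)] unfolding eventually_sequentially by blast
  have "\<forall>\<^sub>F n in sequentially. L C (\<lambda>x. \<sigma> i (x - s n) - \<sigma> i x) \<le> ennreal \<eta>'"
    by (rule ennreal_tendsto_0D[OF L_simple_translation_tendsto[OF s \<sigma>(1) C] \<eta>'(1)])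
  then show "\<forall>\<^sub>F n in sequentially. L C (\<lambda>x. f (x - s n) - f x) \<le> ennreal e"
    using eventually_ge_at_top[of n0]
  proof eventually_elim
    case (elim n)
    define g where "g = (\<lambda>x. f x - \<sigma> i x)"
    have [measurable]: "g \<in> borel_measurable borel" unfolding g_def by measurable
    have 1: "L C (\<lambda>x. g (x - s n)) \<le> ennreal \<eta>"
    proof -
      have "L C (\<lambda>x. g (x - s n)) \<le> L {x. x - s n \<in> C'} (\<lambda>x. g (x - s n))"
        using C'(3)[OF elim(2)] by (intro L_mono) auto
      also have "\<dots> = L C' g" by (rule L_translation) measurable
      finally show ?thesis using i by (simp add: g_def)
    qed
    have 2: "L C g \<le> ennreal \<eta>" using L_mono[OF C'(2), of g] i by (simp add: g_def)
    have "L C (\<lambda>x. f (x - s n) - f x) = L C (\<lambda>x. (g (x - s n) - g x) + (\<sigma> i (x - s n) - \<sigma> i x))"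
      by (simp add: g_def)
    also have "\<dots> \<le> c2 * (L C (\<lambda>x. g (x - s n) - g x) + L C (\<lambda>x. \<sigma> i (x - s n) - \<sigma> i x))"
      by (rule L_add) (auto intro!: borel_measurable_diff borel_measurable_translate)
    also have "\<dots> \<le> c2 * (ennreal \<eta>' + ennreal \<eta>')"
    proof (intro mult_left_mono add_mono elim(1))
      have "L C (\<lambda>x. g (x - s n) - g x) \<le> c2 * (L C (\<lambda>x. g (x - s n)) + L C g)"
        by (rule L_diff) (auto intro!: borel_measurable_translate)
      also have "\<dots> \<le> c2 * (ennreal \<eta> + ennreal \<eta>)" by (intro mult_left_mono add_mono 1 2) auto
      finally show "L C (\<lambda>x. g (x - s n) - g x) \<le> ennreal \<eta>'" by (simp only: \<eta>(2))
    qed auto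
    finally show ?case by (simp only: \<eta>'(2))
  qed
qed

end

section \<open>Finite nets of translations\<close>

text \<open>Sort the points \<open>t\<close> by the grid cell of the tuple of values
  \<open>\<gamma> t\<close>. Finitely many cells occur, and one representative of each suffices
  because \<open>P x - P (x - (t - s))\<close> is controlled by the differences
  \<open>\<gamma> t - \<gamma> s\<close>.\<close>

lemma trig_polynomial_totally_bounded:
  fixes P :: "'a::{topological_space, ab_group_add} \<Rightarrow> complex"
  assumes "trig_polynomial P" "d > 0"
  shows "\<exists>T. finite T \<and> (\<forall>t. \<exists>s\<in>T. \<forall>x. cmod (P x - P (x - (t - s))) \<le> d)"
proof -
  obtain X c where "finite X" and X: "\<And>\<gamma>. \<gamma> \<in> X \<Longrightarrow> continuous_character \<gamma>"
    and P: "P = (\<lambda>x. \<Sum>\<gamma>\<in>X. c \<gamma> * \<gamma> x)"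
    using assms(1) by (auto simp: trig_polynomial_def)
  define B where "B = (\<Sum>\<gamma>\<in>X. cmod (c \<gamma>)) + 1"
  have "B > 0" unfolding B_def by (intro add_nonneg_pos sum_nonneg) auto
  \<comment> \<open>With cells of side \<open>1 / m\<close> a character varies by at most
    \<open>2 / m\<close> within a cell, and \<open>B * (2 / m) = d\<close>.\<close>
  define m where "m = 2 * B / d"
  have "m > 0" using \<open>B > 0\<close> assms(2) by (simp add: m_def)
  define G where "G = (\<lambda>t. \<lambda>\<gamma>\<in>X. (\<lfloor>m * Re (\<gamma> t)\<rfloor>, \<lfloor>m * Im (\<gamma> t)\<rfloor>))"
  have fl: "\<lfloor>m * r\<rfloor> \<in> {- \<lceil>m\<rceil>..\<lceil>m\<rceil>}" if "\<bar>r\<bar> \<le> 1" for r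
  proof -
    have "\<bar>m * r\<bar> \<le> m" using that \<open>m > 0\<close> by (simp add: abs_mult mult_left_le)
    then have "- m \<le> m * r" "m * r \<le> m" by linarith+
    then have "\<lfloor>- m\<rfloor> \<le> \<lfloor>m * r\<rfloor>" "\<lfloor>m * r\<rfloor> \<le> \<lfloor>m\<rfloor>" by (auto intro: floor_mono)
    then show ?thesis by (simp add: ceiling_def) linarith
  qed
  have "G t \<in> (\<Pi>\<^sub>E \<gamma>\<in>X. {- \<lceil>m\<rceil>..\<lceil>m\<rceil>} \<times> {- \<lceil>m\<rceil>..\<lceil>m\<rceil>})" for t
  proof (rule PiE_I)
    fix \<gamma> assume "\<gamma> \<in> X"
    then have "cmod (\<gamma> t) = 1" using X by (auto simp: continuous_character_def)
    then have "\<bar>Re (\<gamma> t)\<bar> \<le> 1" "\<bar>Im (\<gamma> t)\<bar> \<le> 1" using abs_Re_le_cmod abs_Im_le_cmod by metis+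
    then have "\<lfloor>m * Re (\<gamma> t)\<rfloor> \<in> {- \<lceil>m\<rceil>..\<lceil>m\<rceil>}" "\<lfloor>m * Im (\<gamma> t)\<rfloor> \<in> {- \<lceil>m\<rceil>..\<lceil>m\<rceil>}" by (auto intro!: fl simp del: atLeastAtMost_iff)
    with \<open>\<gamma> \<in> X\<close> show "G t \<gamma> \<in> {- \<lceil>m\<rceil>..\<lceil>m\<rceil>} \<times> {- \<lceil>m\<rceil>..\<lceil>m\<rceil>}" by (simp add: G_def)
  qed (simp add: G_def)
  then have "range G \<subseteq> (\<Pi>\<^sub>E \<gamma>\<in>X. {- \<lceil>m\<rceil>..\<lceil>m\<rceil>} \<times> {- \<lceil>m\<rceil>..\<lceil>m\<rceil>})" by blast
  then have fin: "finite (range G)" by (rule finite_subset) (intro finite_PiE \<open>finite X\<close> finite_cartesian_product finite_atLeastAtMost_int)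
  have close: "cmod (P x - P (x - (t - s))) \<le> d" if G: "G t = G s" for t s x
  proof -
    have \<gamma>: "cmod (\<gamma> x - \<gamma> (x - (t - s))) \<le> 2 / m" if "\<gamma> \<in> X" for \<gamma>
    proof -
      have 1: "cmod (\<gamma> z) = 1" "\<gamma> (z + w) = \<gamma> z * \<gamma> w" for z w
        using X[OF that] by (auto simp: continuous_character_def)
      have "\<gamma> x = \<gamma> (x - (t - s)) * \<gamma> (t - s)" "\<gamma> t = \<gamma> s * \<gamma> (t - s)"
        using 1(2)[of "x - (t - s)" "t - s"] 1(2)[of s "t - s"] by simp_all
      then have "\<gamma> x - \<gamma> (x - (t - s)) = \<gamma> (x - (t - s)) * (\<gamma> (t - s) - 1)" "\<gamma> t - \<gamma> s = \<gamma> s * (\<gamma> (t - s) - 1)"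
        by (simp_all add: algebra_simps)
      \<comment> \<open>Independent of \<open>x\<close>: both differences are a unimodular factor
        times \<open>\<gamma> (t - s) - 1\<close>.\<close>
      then have eq: "cmod (\<gamma> x - \<gamma> (x - (t - s))) = cmod (\<gamma> t - \<gamma> s)" by (simp add: norm_mult 1)
      have fleq: "\<bar>a - b\<bar> \<le> 1 / m" if "\<lfloor>m * a\<rfloor> = \<lfloor>m * b\<rfloor>" for a b
      proof -
        have "\<bar>m * a - m * b\<bar> \<le> 1" using that by linarith
        then have "m * \<bar>a - b\<bar> \<le> 1" using \<open>m > 0\<close> by (simp add: right_diff_distrib[symmetric] abs_mult)
        then show ?thesis using \<open>m > 0\<close> by (simp add: pos_le_divide_eq mult.commute)
      qed
      have "G t \<gamma> = G s \<gamma>" by (simp add: G)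
      then have "\<lfloor>m * Re (\<gamma> t)\<rfloor> = \<lfloor>m * Re (\<gamma> s)\<rfloor>" "\<lfloor>m * Im (\<gamma> t)\<rfloor> = \<lfloor>m * Im (\<gamma> s)\<rfloor>"
        using that by (simp_all add: G_def)
      then have "\<bar>Re (\<gamma> t - \<gamma> s)\<bar> + \<bar>Im (\<gamma> t - \<gamma> s)\<bar> \<le> 1 / m + 1 / m"
        unfolding minus_complex.sel by (intro add_mono fleq)
      with cmod_le[of "\<gamma> t - \<gamma> s"] show ?thesis unfolding eq by simp
    qed
    have "P x - P (x - (t - s)) = (\<Sum>\<gamma>\<in>X. c \<gamma> * (\<gamma> x - \<gamma> (x - (t - s))))"
      by (simp add: P sum_subtractf right_diff_distrib)
    also have "cmod \<dots> \<le> (\<Sum>\<gamma>\<in>X. cmod (c \<gamma>) * (2 / m))"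
      by (intro sum_norm_le) (simp only: norm_mult, intro mult_left_mono \<gamma> norm_ge_zero)
    also have "\<dots> = (B - 1) * (2 / m)" by (simp only: B_def add_diff_cancel_right' sum_distrib_right)
    also have "\<dots> \<le> B * (2 / m)" using \<open>m > 0\<close> by (intro mult_right_mono) auto
    also have "\<dots> = d" using \<open>B > 0\<close> assms(2) by (simp add: m_def)
    finally show ?thesis .
  qed
  have "\<exists>s\<in>inv G ` range G. \<forall>x. cmod (P x - P (x - (t - s))) \<le> d" for t
    by (rule bexI[of _ "inv G (G t)"]) (auto intro!: close simp: f_inv_into_f)
  with fin show ?thesis by (intro exI[of _ "inv G ` range G"]) auto
qed

lemma ennreal_powr_le_iff:
  assumes "p > 0" "e \<ge> 0"
  shows "ennreal_powr x (1 / p) \<le> ennreal e \<longleftrightarrow> x \<le> ennreal (e powr p)"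
proof (cases x)
  case (real r)
  have "r powr (1 / p) \<le> e \<longleftrightarrow> r \<le> e powr p"
  proof
    assume "r powr (1 / p) \<le> e"
    then have "(r powr (1 / p)) powr p \<le> e powr p" using assms by (intro powr_mono2) auto
    then show "r \<le> e powr p" using assms real by (simp add: powr_powr)
  next
    assume "r \<le> e powr p"
    then have "r powr (1 / p) \<le> (e powr p) powr (1 / p)" using assms real by (intro powr_mono2) auto
    then show "r powr (1 / p) \<le> e" using assms by (simp add: powr_powr)
  qed
  with real assms show ?thesis by (simp add: ennreal_powr_def ennreal_le_iff)
qed (simp add: ennreal_powr_def top_unique)

context stepanov
begin

section \<open>Suprema over sliding windows and the oscillation under translation\<close>

definition N :: "('a \<Rightarrow> complex) \<Rightarrow> ennreal" where
  "N F = (SUP y. L {x. x - y \<in> K} F)"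

lemma K_borel: "K \<in> sets borel"
  using K_sets by simp

lemma translate_K_borel: "{x. x - y \<in> K} \<in> sets borel"
  by (rule sets_translation[OF K_borel])

lemma L_le_N: "L {x. x - y \<in> K} F \<le> N F"
  unfolding N_def by (rule SUP_upper) simp

lemma N_leI: "(\<And>y. L {x. x - y \<in> K} F \<le> b) \<Longrightarrow> N F \<le> b"
  unfolding N_def by (rule SUP_least)

definition \<kappa> :: real where "\<kappa> = measure \<theta> K"

lemma emeasure_K: "emeasure \<theta> K = ennreal \<kappa>"
proof -
  have "emeasure \<theta> K \<le> emeasure \<theta> (closure K)"
    by (intro emeasure_mono closure_subset) simp
  also have "\<dots> < \<infinity>" by (rule emeasure_compact[OF K_compact])
  finally show ?thesis unfolding \<kappa>_def by (intro emeasure_eq_ennreal_measure) simp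
qed

lemma \<kappa>_pos: "\<kappa> > 0"
proof -
  have "0 < emeasure \<theta> (interior K)" by (rule emeasure_open_pos) (use K_interior in auto)
  also have "\<dots> \<le> emeasure \<theta> K" using K_borel by (intro emeasure_mono interior_subset) simp
  finally show ?thesis unfolding emeasure_K by simp
qed

text \<open>Non-strict bounds pass through the supremum, strict ones do not; the strict balls of the
  definitions are reached by working with radius \<open>e / 2\<close>.\<close>

lemma stepanov_norm_le_iff:
  assumes "e \<ge> 0"
  shows "stepanov_norm \<theta> p K F \<le> ennreal e \<longleftrightarrow> N F \<le> ennreal (\<kappa> * e powr p)"
proof -
  have eq: "ennreal_powr (1 / emeasure \<theta> K * L A F) (1 / p) \<le> ennreal e \<longleftrightarrow> L A F \<le> ennreal (\<kappa> * e powr p)" for A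
  proof -
    have inv: "1 / emeasure \<theta> K = ennreal (1 / \<kappa>)"
      unfolding emeasure_K using \<kappa>_pos by (metis divide_ennreal ennreal_1 zero_le_one)
    have "ennreal_powr (ennreal (1 / \<kappa>) * L A F) (1 / p) \<le> ennreal e \<longleftrightarrow>
        ennreal (1 / \<kappa>) * L A F \<le> ennreal (e powr p)"
      using p assms by (intro ennreal_powr_le_iff) auto
    also have "ennreal (1 / \<kappa>) * L A F \<le> ennreal (e powr p) \<longleftrightarrow> L A F \<le> ennreal (\<kappa> * e powr p)"
    proof (cases "L A F")
      case (real r)
      then show ?thesis using \<kappa>_pos
        by (simp add: ennreal_mult[symmetric] ennreal_le_iff divide_le_eq mult.commute)
    next
      case top
      then show ?thesis using \<kappa>_pos by (simp add: ennreal_mult_top top_unique)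
    qed
    finally show ?thesis unfolding inv .
  qed
  have "stepanov_norm \<theta> p K F = (SUP y. ennreal_powr (1 / emeasure \<theta> K * L {x. x - y \<in> K} F) (1 / p))"
    by (simp add: stepanov_norm_def L_def plus_image_eq)
  then show ?thesis by (simp add: SUP_le_iff eq N_def)
qed

lemma N_add:
  assumes "F \<in> borel_measurable borel" "H \<in> borel_measurable borel"
  shows "N (\<lambda>x. F x + H x) \<le> c2 * (N F + N H)"
proof (rule N_leI)
  fix y
  have "L {x. x - y \<in> K} (\<lambda>x. F x + H x) \<le> c2 * (L {x. x - y \<in> K} F + L {x. x - y \<in> K} H)"
    by (rule L_add[OF assms translate_K_borel])
  also have "\<dots> \<le> c2 * (N F + N H)" by (intro mult_left_mono add_mono L_le_N) simp
  finally show "L {x. x - y \<in> K} (\<lambda>x. F x + H x) \<le> c2 * (N F + N H)" .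
qed

lemma N_minus: "N (\<lambda>x. - F x) = N F"
  by (simp add: N_def L_minus)

lemma N_minus_commute: "N (\<lambda>x. F x - H x) = N (\<lambda>x. H x - F x)"
  using N_minus[of "\<lambda>x. F x - H x"] by simp

lemma N_diff:
  assumes "F \<in> borel_measurable borel" "H \<in> borel_measurable borel"
  shows "N (\<lambda>x. F x - H x) \<le> c2 * (N F + N H)"
  using N_add[OF assms(1) borel_measurable_uminus[OF assms(2)]] by (simp add: N_minus)

lemma L_translate_K:
  assumes "F \<in> borel_measurable borel"
  shows "L {x. x - y \<in> K} (\<lambda>x. F (x - t)) = L {x. x - (y - t) \<in> K} F"
  using L_translation[OF assms translate_K_borel, of t "y - t"] by simp

lemma N_translate:
  assumes F: "F \<in> borel_measurable borel"
  shows "N (\<lambda>x. F (x - t)) = N F"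
proof (rule antisym)
  show "N (\<lambda>x. F (x - t)) \<le> N F"
    by (rule N_leI) (simp only: L_translate_K[OF F] L_le_N)
  show "N F \<le> N (\<lambda>x. F (x - t))"
  proof (rule N_leI)
    fix y
    show "L {x. x - y \<in> K} F \<le> N (\<lambda>x. F (x - t))"
      using L_le_N[of "y + t" "\<lambda>x. F (x - t)"] by (simp add: L_translate_K[OF F])
  qed
qed

lemma N_bounded:
  assumes "\<And>x. cmod (F x) \<le> d" "d \<ge> 0"
  shows "N F \<le> ennreal (\<kappa> * d powr p)"
proof (rule N_leI)
  fix y
  have "L {x. x - y \<in> K} F \<le> (\<integral>\<^sup>+x\<in>{x. x - y \<in> K}. ennreal (d powr p) \<partial>\<theta>)"
    unfolding L_def using p assms
    by (intro nn_integral_mono mult_right_mono ennreal_leI powr_mono2) auto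
  also have "\<dots> = ennreal (d powr p) * emeasure \<theta> {x. x - y \<in> K}"
    using translate_K_borel by (intro nn_integral_cmult_indicator) simp
  also have "\<dots> = ennreal (\<kappa> * d powr p)"
    using emeasure_translation[OF K_borel, of y] \<kappa>_pos
    by (simp add: emeasure_K ennreal_mult mult.commute)
  finally show "L {x. x - y \<in> K} F \<le> ennreal (\<kappa> * d powr p)" .
qed

text \<open>For measurable \<open>F\<close> a pseudonorm on the group up to the factor
  \<open>c2\<close>, possibly with infinite values.\<close>

definition osc :: "('a \<Rightarrow> complex) \<Rightarrow> 'a \<Rightarrow> ennreal" where
  "osc F t = N (\<lambda>x. F x - F (x - t))"

lemma borel_measurable_difference:
  "F \<in> borel_measurable borel \<Longrightarrow> (\<lambda>x::'a. F x - F (x - t)) \<in> borel_measurable borel"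
  for F :: "'a \<Rightarrow> complex"
  by (intro borel_measurable_diff borel_measurable_translate)

lemma osc_minus:
  assumes "F \<in> borel_measurable borel"
  shows "osc F (- t) = osc F t"
  using N_translate[OF borel_measurable_difference[OF assms, of "- t"], of t]
    N_minus_commute[of F "\<lambda>x. F (x - t)"]
  by (simp add: osc_def)

lemma osc_add:
  assumes F: "F \<in> borel_measurable borel"
  shows "osc F (s + t) \<le> c2 * (osc F s + osc F t)"
proof -
  have "osc F (s + t) = N (\<lambda>x. (F x - F (x - s)) + (\<lambda>x. F x - F (x - t)) (x - s))"
    by (simp add: osc_def diff_diff_eq)
  also have "\<dots> \<le> c2 * (N (\<lambda>x. F x - F (x - s)) + N (\<lambda>x. (\<lambda>x. F x - F (x - t)) (x - s)))"
    by (intro N_add borel_measurable_difference borel_measurable_translate[of "\<lambda>x. F x - F (x - t)"] F)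
  also have "N (\<lambda>x. (\<lambda>x. F x - F (x - t)) (x - s)) = osc F t"
    unfolding osc_def by (rule N_translate) (rule borel_measurable_difference[OF F])
  finally show ?thesis by (simp add: osc_def)
qed

text \<open>Distances between orbit points depend on \<open>t - s\<close> alone, which turns
  precompactness of the orbit into a statement about \<open>osc\<close>.\<close>

lemma N_translate_diff:
  assumes F: "F \<in> borel_measurable borel"
  shows "N (\<lambda>x. F (x - t) - F (x - s)) = osc F (t - s)"
proof -
  have "N (\<lambda>x. F (x - t) - F (x - s)) = N (\<lambda>x. (\<lambda>x. F x - F (x - (s - t))) (x - t))"
    by simp
  also have "\<dots> = osc F (- (t - s))"
    unfolding osc_def minus_diff_eq by (rule N_translate) (rule borel_measurable_difference[OF F])
  finally show ?thesis by (simp only: osc_minus[OF F])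
qed

text \<open>Relative density of the sets where \<open>osc F\<close> is small, written so that it
  differs from \<open>finitely_ap\<close> only in compact versus finite.\<close>

definition compactly_ap :: "('a \<Rightarrow> complex) \<Rightarrow> bool" where
  "compactly_ap F \<longleftrightarrow> (\<forall>\<eta>>0. \<exists>C. compact C \<and> (\<forall>t. \<exists>c\<in>C. osc F (t - c) \<le> ennreal \<eta>))"

definition finitely_ap :: "('a \<Rightarrow> complex) \<Rightarrow> bool" where
  "finitely_ap F \<longleftrightarrow> (\<forall>\<eta>>0. \<exists>T. finite T \<and> (\<forall>t. \<exists>s\<in>T. osc F (t - s) \<le> ennreal \<eta>))"

lemma finitely_ap_imp_compactly_ap: "finitely_ap F \<Longrightarrow> compactly_ap F"
  unfolding finitely_ap_def compactly_ap_def by (meson finite_imp_compact)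

lemma radius:
  assumes "\<eta> > 0"
  obtains e where "e > 0" "\<kappa> * e powr p = \<eta>"
proof
  show "(\<eta> / \<kappa>) powr (1 / p) > 0" using assms \<kappa>_pos by simp
  show "\<kappa> * ((\<eta> / \<kappa>) powr (1 / p)) powr p = \<eta>" using assms \<kappa>_pos p by (simp add: powr_powr)
qed

lemma stepanov_ap_iff: "stepanov_almost_periodic \<theta> p K F \<longleftrightarrow> compactly_ap F"
proof
  assume ap: "stepanov_almost_periodic \<theta> p K F"
  show "compactly_ap F"
    unfolding compactly_ap_def
  proof (intro allI impI)
    fix \<eta> :: real assume "\<eta> > 0"
    then obtain e where e: "e > 0" "\<kappa> * e powr p = \<eta>" by (rule radius)
    let ?R = "{t. stepanov_norm \<theta> p K (\<lambda>x. F x - translate t F x) < ennreal e}"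
    obtain C where C: "compact C" "{r + c | r c. r \<in> ?R \<and> c \<in> C} = UNIV"
      using ap[unfolded stepanov_almost_periodic_def relatively_dense_def, rule_format, OF e(1)] by blast
    have "\<exists>c\<in>C. osc F (t - c) \<le> ennreal \<eta>" for t
    proof -
      have "t \<in> {r + c | r c. r \<in> ?R \<and> c \<in> C}" unfolding C(2) by simp
      then obtain r c where rc: "t = r + c" "r \<in> ?R" "c \<in> C" by blast
      then have "stepanov_norm \<theta> p K (\<lambda>x. F x - F (x - r)) \<le> ennreal e"
        by (simp add: translate_def)
      then have "osc F r \<le> ennreal \<eta>"
        using e by (simp add: stepanov_norm_le_iff osc_def)
      with rc show ?thesis by (intro bexI[of _ c]) auto
    qed
    with C(1) show "\<exists>C. compact C \<and> (\<forall>t. \<exists>c\<in>C. osc F (t - c) \<le> ennreal \<eta>)" by blast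
  qed
next
  assume ap: "compactly_ap F"
  show "stepanov_almost_periodic \<theta> p K F"
    unfolding stepanov_almost_periodic_def relatively_dense_def
  proof (intro allI impI)
    fix e :: real assume "e > 0"
    let ?R = "{t. stepanov_norm \<theta> p K (\<lambda>x. F x - translate t F x) < ennreal e}"
    have "\<kappa> * (e / 2) powr p > 0" using \<kappa>_pos \<open>e > 0\<close> by simp
    then obtain C where C: "compact C" "\<And>t. \<exists>c\<in>C. osc F (t - c) \<le> ennreal (\<kappa> * (e / 2) powr p)"
      using ap unfolding compactly_ap_def by blast
    have "t \<in> {r + c | r c. r \<in> ?R \<and> c \<in> C}" for t
    proof -
      obtain c where c: "c \<in> C" "osc F (t - c) \<le> ennreal (\<kappa> * (e / 2) powr p)" using C(2) by blast
      then have "stepanov_norm \<theta> p K (\<lambda>x. F x - F (x - (t - c))) \<le> ennreal (e / 2)"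
        using \<open>e > 0\<close> by (simp add: stepanov_norm_le_iff osc_def)
      also have "\<dots> < ennreal e" using \<open>e > 0\<close> by (simp add: ennreal_less_iff)
      finally have "t - c \<in> ?R" by (simp add: translate_def)
      moreover have "t = (t - c) + c" by simp
      ultimately show ?thesis using c(1) by blast
    qed
    with C(1) show "\<exists>C. compact C \<and> {r + c | r c. r \<in> ?R \<and> c \<in> C} = UNIV" by blast
  qed
qed

lemma compact_sum_K:
  assumes "compact C"
  obtains C1 where "compact C1" "\<And>c. c \<in> C \<Longrightarrow> {x. x - c \<in> K} \<subseteq> C1"
proof
  show "compact {c + d | c d. c \<in> C \<and> d \<in> closure K}"
    by (intro compact_Minkowski_sum assms K_compact)
  fix c assume "c \<in> C"
  show "{x. x - c \<in> K} \<subseteq> {c + d | c d. c \<in> C \<and> d \<in> closure K}"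
  proof
    fix x assume "x \<in> {x. x - c \<in> K}"
    then have "x - c \<in> closure K" using closure_subset by auto
    moreover have "x = c + (x - c)" by simp
    ultimately show "x \<in> {c + d | c d. c \<in> C \<and> d \<in> closure K}" using \<open>c \<in> C\<close> by blast
  qed
qed

text \<open>An almost period moves any window \<open>y + K\<close> to some \<open>c + K\<close> with
  \<open>c \<in> C\<close>, and all of these lie in a single compact set.\<close>

lemma N_finite:
  assumes "f \<in> Lp_loc \<theta> p" "compactly_ap f"
  shows "N f < \<infinity>"
proof -
  have f: "f \<in> borel_measurable borel" using assms(1) by (simp add: Lp_loc_iff)
  obtain C where C: "compact C" "\<And>t. \<exists>c\<in>C. osc f (t - c) \<le> ennreal 1"
    using assms(2) zero_less_one unfolding compactly_ap_def by blast
  obtain C1 where C1: "compact C1" "\<And>c. c \<in> C \<Longrightarrow> {x. x - c \<in> K} \<subseteq> C1"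
    using compact_sum_K[OF C(1)] by blast
  have "N f \<le> c2 * (ennreal 1 + L C1 f)"
  proof (rule N_leI)
    fix y
    obtain c where c: "c \<in> C" "osc f (y - c) \<le> ennreal 1" using C(2) by blast
    let ?A = "{x. x - y \<in> K}" and ?r = "y - c"
    have "L ?A f = L ?A (\<lambda>x. (f x - f (x - ?r)) + f (x - ?r))" by simp
    also have "\<dots> \<le> c2 * (L ?A (\<lambda>x. f x - f (x - ?r)) + L ?A (\<lambda>x. f (x - ?r)))"
      by (intro L_add borel_measurable_difference borel_measurable_translate f translate_K_borel)
    also have "\<dots> \<le> c2 * (ennreal 1 + L C1 f)"
    proof (intro mult_left_mono add_mono)
      show "L ?A (\<lambda>x. f x - f (x - ?r)) \<le> ennreal 1"
        using L_le_N[of y "\<lambda>x. f x - f (x - ?r)"] c(2) by (simp add: osc_def)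
      have "L ?A (\<lambda>x. f (x - ?r)) = L {x. x - c \<in> K} f" by (simp add: L_translate_K[OF f])
      also have "\<dots> \<le> L C1 f" by (rule L_mono[OF C1(2)[OF c(1)]])
      finally show "L ?A (\<lambda>x. f (x - ?r)) \<le> L C1 f" .
    qed simp
    finally show "L ?A f \<le> c2 * (ennreal 1 + L C1 f)" .
  qed
  also have "\<dots> < \<infinity>"
    using assms(1) C1(1) by (simp add: ennreal_mult_less_top Lp_loc_iff)
  finally show ?thesis .
qed

lemma osc_tendsto:
  assumes "f \<in> Lp_loc \<theta> p" "compactly_ap f"
  shows "(osc f \<longlongrightarrow> 0) (nhds 0)"
proof (rule ennreal_tendsto_0I)
  fix e :: real assume "e > 0"
  have f: "f \<in> borel_measurable borel" using assms(1) by (simp add: Lp_loc_iff)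
  obtain \<eta>' where \<eta>': "\<eta>' > 0" "c2 * (ennreal \<eta>' + ennreal \<eta>') = ennreal e"
    using c2_half[OF \<open>e > 0\<close>] by blast
  obtain \<eta> where \<eta>: "\<eta> > 0" "c2 * (ennreal \<eta> + ennreal \<eta>) = ennreal \<eta>'"
    using c2_half[OF \<eta>'(1)] by blast
  obtain C where C: "compact C" "\<And>t. \<exists>c\<in>C. osc f (t - c) \<le> ennreal \<eta>"
    using assms(2) \<eta>(1) unfolding compactly_ap_def by blast
  obtain C1 where C1: "compact C1" "\<And>c. c \<in> C \<Longrightarrow> {x. x - c \<in> K} \<subseteq> C1"
    using compact_sum_K[OF C(1)] by blast
  have bound: "osc f s \<le> c2 * (ennreal \<eta>' + L C1 (\<lambda>x. f (x - s) - f x))" for s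
    unfolding osc_def
  proof (rule N_leI)
    fix y
    obtain c where c: "c \<in> C" "osc f (y - c) \<le> ennreal \<eta>" using C(2) by blast
    let ?A = "{x. x - y \<in> K}" and ?r = "y - c"
    let ?g = "\<lambda>x. f x - f (x - ?r)" and ?h = "\<lambda>x. f x - f (x - s)"
    have g: "?g \<in> borel_measurable borel" and h: "?h \<in> borel_measurable borel"
      by (rule borel_measurable_difference[OF f])+
    \<comment> \<open>Split \<open>f\<close> into \<open>?g\<close> and its translate by
      \<open>?r\<close>. The increment of \<open>?g\<close> is small for every \<open>s\<close>
      because \<open>?g\<close> itself is small; the rest is the increment of \<open>f\<close> seen
      through the window at \<open>c\<close>.\<close>
    have "L ?A ?h = L ?A (\<lambda>x. (?g x - ?g (x - s)) + ?h (x - ?r))"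
      by (simp add: algebra_simps)
    also have "\<dots> \<le> c2 * (L ?A (\<lambda>x. ?g x - ?g (x - s)) + L ?A (\<lambda>x. ?h (x - ?r)))"
      by (intro L_add borel_measurable_difference[OF g] borel_measurable_translate[OF h] translate_K_borel)
    also have "\<dots> \<le> c2 * (ennreal \<eta>' + L C1 (\<lambda>x. f (x - s) - f x))"
    proof (intro mult_left_mono add_mono)
      have "L ?A (\<lambda>x. ?g x - ?g (x - s)) \<le> N (\<lambda>x. ?g x - ?g (x - s))" by (rule L_le_N)
      also have "\<dots> \<le> c2 * (N ?g + N (\<lambda>x. ?g (x - s)))"
        by (intro N_diff g borel_measurable_translate[OF g])
      also have "N (\<lambda>x. ?g (x - s)) = N ?g" by (rule N_translate[OF g])
      also have "c2 * (N ?g + N ?g) \<le> c2 * (ennreal \<eta> + ennreal \<eta>)"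
        using c(2) unfolding osc_def by (intro mult_left_mono add_mono) simp_all
      finally show "L ?A (\<lambda>x. ?g x - ?g (x - s)) \<le> ennreal \<eta>'" by (simp only: \<eta>(2))
      have "L ?A (\<lambda>x. ?h (x - ?r)) = L {x. x - c \<in> K} ?h" using L_translate_K[OF h, of y ?r] by simp
      also have "\<dots> \<le> L C1 ?h" by (rule L_mono[OF C1(2)[OF c(1)]])
      also have "\<dots> = L C1 (\<lambda>x. f (x - s) - f x)" using L_minus[of C1 ?h] by simp
      finally show "L ?A (\<lambda>x. ?h (x - ?r)) \<le> L C1 (\<lambda>x. f (x - s) - f x)" .
    qed simp
    finally show "L ?A ?h \<le> c2 * (ennreal \<eta>' + L C1 (\<lambda>x. f (x - s) - f x))" .
  qed
  show "\<forall>\<^sub>F s in nhds 0. osc f s \<le> ennreal e"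
    \<comment> \<open>Sequences suffice by first countability; continuity of translation was
      obtained for sequences, as it rests on dominated convergence.\<close>
    unfolding eventually_nhds_iff_sequentially
  proof (intro allI impI)
    fix s :: "nat \<Rightarrow> 'a" assume "s \<longlonglongrightarrow> 0"
    then have "\<forall>\<^sub>F n in sequentially. L C1 (\<lambda>x. f (x - s n) - f x) \<le> ennreal \<eta>'"
      by (intro ennreal_tendsto_0D[OF L_translation_tendsto[OF _ assms(1) C1(1)] \<eta>'(1)])
    then show "\<forall>\<^sub>F n in sequentially. osc f (s n) \<le> ennreal e"
    proof eventually_elim
      case (elim n)
      have "osc f (s n) \<le> c2 * (ennreal \<eta>' + ennreal \<eta>')"
        using bound[of "s n"] elim by (meson add_left_mono mult_left_mono order_trans zero_le)
      then show ?case by (simp only: \<eta>'(2))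
    qed
  qed
qed

lemma compactly_ap_imp_finitely_ap:
  assumes "f \<in> Lp_loc \<theta> p" "compactly_ap f"
  shows "finitely_ap f"
  unfolding finitely_ap_def
proof (intro allI impI)
  fix \<eta> :: real assume "\<eta> > 0"
  have f: "f \<in> borel_measurable borel" using assms(1) by (simp add: Lp_loc_iff)
  obtain \<eta>' where \<eta>': "\<eta>' > 0" "c2 * (ennreal \<eta>' + ennreal \<eta>') = ennreal \<eta>"
    using c2_half[OF \<open>\<eta> > 0\<close>] by blast
  obtain C where C: "compact C" "\<And>t. \<exists>c\<in>C. osc f (t - c) \<le> ennreal \<eta>'"
    using assms(2) \<eta>'(1) unfolding compactly_ap_def by blast
  obtain V where V: "open V" "0 \<in> V" "\<And>v. v \<in> V \<Longrightarrow> osc f v \<le> ennreal \<eta>'"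
    using ennreal_tendsto_0D[OF osc_tendsto[OF assms] \<eta>'(1)] unfolding eventually_nhds by blast
  have "open {x. x - c \<in> V}" for c by (rule open_translation[OF V(1)])
  moreover have "C \<subseteq> (\<Union>c\<in>C. {x. x - c \<in> V})" using V(2) by auto
  ultimately obtain T where T: "T \<subseteq> C" "finite T" "C \<subseteq> (\<Union>c\<in>T. {x. x - c \<in> V})"
    using compactE_image[OF C(1), of C "\<lambda>c. {x. x - c \<in> V}"] by metis
  have "\<exists>s\<in>T. osc f (t - s) \<le> ennreal \<eta>" for t
  proof -
    obtain c where c: "c \<in> C" "osc f (t - c) \<le> ennreal \<eta>'" using C(2) by blast
    then obtain s where s: "s \<in> T" "c - s \<in> V" using T(3) by blast
    have "osc f (t - s) \<le> c2 * (osc f (t - c) + osc f (c - s))"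
      using osc_add[OF f, of "t - c" "c - s"] by simp
    also have "\<dots> \<le> c2 * (ennreal \<eta>' + ennreal \<eta>')"
      using c(2) V(3)[OF s(2)] by (intro mult_left_mono add_mono) auto
    finally show ?thesis using s(1) \<eta>'(2) by auto
  qed
  with T(2) show "\<exists>T. finite T \<and> (\<forall>t. \<exists>s\<in>T. osc f (t - s) \<le> ennreal \<eta>)" by blast
qed

section \<open>Precompact orbits and limits of trigonometric polynomials\<close>

lemma translate_Lp_loc:
  assumes "f \<in> Lp_loc \<theta> p"
  shows "translate t f \<in> Lp_loc \<theta> p"
proof -
  have f: "f \<in> borel_measurable borel" using assms by (simp add: Lp_loc_iff)
  have "L C (\<lambda>x. f (x - t)) < \<infinity>" if C: "compact C" for C
  proof -
    have "compact ((\<lambda>x. x - t) ` C)" by (intro compact_continuous_image continuous_intros C)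
    moreover have "C \<subseteq> {x. x - t \<in> (\<lambda>x. x - t) ` C}" by blast
    ultimately show ?thesis
      using L_mono[of C "{x. x - t \<in> (\<lambda>x. x - t) ` C}" "\<lambda>x. f (x - t)"] assms
        L_translation[OF f borel_compact, of "(\<lambda>x. x - t) ` C" t]
      by (metis Lp_loc_iff order_le_less_trans)
  qed
  then show ?thesis
    using borel_measurable_translate[OF f] by (simp add: Lp_loc_iff translate_def)
qed

lemma precompact_iff:
  assumes "f \<in> Lp_loc \<theta> p"
  shows "stepanov_precompact \<theta> p K (range (\<lambda>t. translate t f)) \<longleftrightarrow> finitely_ap f"
proof
  have f: "f \<in> borel_measurable borel" using assms by (simp add: Lp_loc_iff)
  {
    assume pre: "stepanov_precompact \<theta> p K (range (\<lambda>t. translate t f))"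
    show "finitely_ap f"
      unfolding finitely_ap_def
    proof (intro allI impI)
      fix \<eta> :: real assume "\<eta> > 0"
      obtain \<eta>' where \<eta>': "\<eta>' > 0" "c2 * (ennreal \<eta>' + ennreal \<eta>') = ennreal \<eta>"
        using c2_half[OF \<open>\<eta> > 0\<close>] by blast
      obtain e where e: "e > 0" "\<kappa> * e powr p = \<eta>'" using radius[OF \<eta>'(1)] by blast
      obtain H where H: "finite H" "H \<subseteq> Lp_loc \<theta> p" "range (\<lambda>t. translate t f) \<subseteq>
          (\<Union>h\<in>H. {g \<in> Lp_loc \<theta> p. stepanov_norm \<theta> p K (\<lambda>x. g x - h x) < ennreal e})"
        using pre[unfolded stepanov_precompact_def, rule_format, OF e(1)] by blast
      define near where "near = (\<lambda>h t. N (\<lambda>x. translate t f x - h x) \<le> ennreal \<eta>')"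
      have "\<exists>h\<in>H. near h t" for t
      proof -
        obtain h where "h \<in> H" "stepanov_norm \<theta> p K (\<lambda>x. translate t f x - h x) < ennreal e"
          using H(3) by blast
        then show ?thesis
          using e stepanov_norm_le_iff[of e "\<lambda>x. translate t f x - h x"] by (auto simp: near_def)
      qed
      \<comment> \<open>The centres \<open>h\<close> are arbitrary functions, so each is replaced by
        one orbit point near it. Where no orbit point is near, the choice is arbitrary; only those
        \<open>h\<close> with a near point enter below.\<close>
      define T where "T = (\<lambda>h. SOME t. near h t) ` H"
      have "\<exists>s\<in>T. osc f (t - s) \<le> ennreal \<eta>" for t
      proof -
        obtain h where h: "h \<in> H" "near h t" using \<open>\<exists>h\<in>H. near h t\<close> by blast
        define s where "s = (SOME s. near h s)"
        have "near h s" unfolding s_def using h(2) by (rule someI)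
        have hm: "h \<in> borel_measurable borel" using H(2) h(1) by (auto simp: Lp_loc_iff)
        have tm: "translate r f \<in> borel_measurable borel" for r
          using translate_Lp_loc[OF assms] by (simp add: Lp_loc_iff)
        have "osc f (t - s) = N (\<lambda>x. (translate t f x - h x) - (translate s f x - h x))"
          using N_translate_diff[OF f, of t s] by (simp add: translate_def)
        also have "\<dots> \<le> c2 * (N (\<lambda>x. translate t f x - h x) + N (\<lambda>x. translate s f x - h x))"
          by (intro N_diff borel_measurable_diff tm hm)
        also have "\<dots> \<le> c2 * (ennreal \<eta>' + ennreal \<eta>')"
          using h(2) \<open>near h s\<close> unfolding near_def by (intro mult_left_mono add_mono) auto
        finally have "osc f (t - s) \<le> ennreal \<eta>" by (simp only: \<eta>'(2))
        moreover have "s \<in> T" using h(1) by (simp add: T_def s_def)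
        ultimately show ?thesis by blast
      qed
      moreover have "finite T" using H(1) by (simp add: T_def)
      ultimately show "\<exists>T. finite T \<and> (\<forall>t. \<exists>s\<in>T. osc f (t - s) \<le> ennreal \<eta>)" by blast
    qed
  }
  assume ap: "finitely_ap f"
  show "stepanov_precompact \<theta> p K (range (\<lambda>t. translate t f))"
    unfolding stepanov_precompact_def
  proof (intro allI impI)
    fix e :: real assume "e > 0"
    then have "\<kappa> * (e / 2) powr p > 0" using \<kappa>_pos by simp
    then obtain T where T: "finite T" "\<And>t. \<exists>s\<in>T. osc f (t - s) \<le> ennreal (\<kappa> * (e / 2) powr p)"
      using ap unfolding finitely_ap_def by blast
    let ?H = "(\<lambda>s. translate s f) ` T"
    have "\<exists>h\<in>?H. stepanov_norm \<theta> p K (\<lambda>x. translate t f x - h x) < ennreal e" for t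
    proof -
      obtain s where s: "s \<in> T" "osc f (t - s) \<le> ennreal (\<kappa> * (e / 2) powr p)" using T(2) by blast
      then have "stepanov_norm \<theta> p K (\<lambda>x. translate t f x - translate s f x) \<le> ennreal (e / 2)"
        using \<open>e > 0\<close> by (simp add: stepanov_norm_le_iff translate_def N_translate_diff[OF f])
      also have "\<dots> < ennreal e" using \<open>e > 0\<close> by (simp add: ennreal_less_iff)
      finally show ?thesis using s(1) by blast
    qed
    then have "range (\<lambda>t. translate t f) \<subseteq>
        (\<Union>h\<in>?H. {g \<in> Lp_loc \<theta> p. stepanov_norm \<theta> p K (\<lambda>x. g x - h x) < ennreal e})"
      using translate_Lp_loc[OF assms] by blast
    moreover have "finite ?H" "?H \<subseteq> Lp_loc \<theta> p" using T(1) translate_Lp_loc[OF assms] by auto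
    ultimately show "\<exists>H. finite H \<and> H \<subseteq> Lp_loc \<theta> p \<and> range (\<lambda>t. translate t f) \<subseteq>
        (\<Union>h\<in>H. {g \<in> Lp_loc \<theta> p. stepanov_norm \<theta> p K (\<lambda>x. g x - h x) < ennreal e})"
      by blast
  qed
qed

lemma trig_polynomial_measurable:
  assumes "trig_polynomial P"
  shows "P \<in> borel_measurable (borel :: 'a measure)"
proof -
  obtain X c where "\<forall>\<gamma>\<in>X. continuous_character \<gamma>" "P = (\<lambda>x. \<Sum>\<gamma>\<in>X. c \<gamma> * \<gamma> x)"
    using assms by (auto simp: trig_polynomial_def)
  then show ?thesis
    by (auto simp: continuous_character_def intro!: borel_measurable_continuous_onI continuous_intros)
qed

text \<open>A near-period of one good approximant \<open>Q\<close> is a near-period of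
  \<open>f\<close>: the error \<open>g = f - Q\<close> contributes twice, by the same amount for
  every translation.\<close>

lemma trig_limit_imp_finitely_ap:
  assumes f: "f \<in> borel_measurable borel" and P: "\<And>n::nat. trig_polynomial (P n)"
    and lim: "(\<lambda>n. stepanov_norm \<theta> p K (\<lambda>x. f x - P n x)) \<longlonglongrightarrow> 0"
  shows "finitely_ap f"
  unfolding finitely_ap_def
proof (intro allI impI)
  fix \<eta> :: real assume "\<eta> > 0"
  obtain \<eta>' where \<eta>': "\<eta>' > 0" "c2 * (ennreal \<eta>' + ennreal \<eta>') = ennreal \<eta>"
    using c2_half[OF \<open>\<eta> > 0\<close>] by blast
  obtain \<eta>'' where \<eta>'': "\<eta>'' > 0" "c2 * (ennreal \<eta>'' + ennreal \<eta>'') = ennreal \<eta>'"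
    using c2_half[OF \<eta>'(1)] by blast
  \<comment> \<open>\<open>e\<close> measures the Stepanov distance from \<open>f\<close> to
    \<open>Q\<close>, \<open>d\<close> the uniform change of \<open>Q\<close> under translation;
    \<open>radius\<close> converts both into bounds on \<open>N\<close>.\<close>
  obtain e where e: "e > 0" "\<kappa> * e powr p = \<eta>''" using radius[OF \<eta>''(1)] by blast
  obtain d where d: "d > 0" "\<kappa> * d powr p = \<eta>'" using radius[OF \<eta>'(1)] by blast
  obtain n where "stepanov_norm \<theta> p K (\<lambda>x. f x - P n x) \<le> ennreal e"
    using ennreal_tendsto_0D[OF lim e(1)] unfolding eventually_sequentially by blast
  define Q where "Q = P n"
  define g where "g = (\<lambda>x. f x - Q x)"
  have Q: "trig_polynomial Q" by (simp add: Q_def P)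
  have Qm: "Q \<in> borel_measurable borel" by (rule trig_polynomial_measurable[OF Q])
  have g: "g \<in> borel_measurable borel" unfolding g_def by (intro borel_measurable_diff f Qm)
  have Ng: "N g \<le> ennreal \<eta>''"
    using \<open>stepanov_norm \<theta> p K (\<lambda>x. f x - P n x) \<le> ennreal e\<close> e
    by (simp add: stepanov_norm_le_iff g_def Q_def)
  obtain T where T: "finite T" "\<And>t. \<exists>s\<in>T. \<forall>x. cmod (Q x - Q (x - (t - s))) \<le> d"
    using trig_polynomial_totally_bounded[OF Q d(1)] by blast
  have "\<exists>s\<in>T. osc f (t - s) \<le> ennreal \<eta>" for t
  proof -
    obtain s where s: "s \<in> T" "\<And>x. cmod (Q x - Q (x - (t - s))) \<le> d" using T(2) by blast
    let ?u = "t - s"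
    have "osc f ?u = N (\<lambda>x. (g x - g (x - ?u)) + (Q x - Q (x - ?u)))" by (simp add: osc_def g_def)
    also have "\<dots> \<le> c2 * (N (\<lambda>x. g x - g (x - ?u)) + N (\<lambda>x. Q x - Q (x - ?u)))"
      by (intro N_add borel_measurable_difference g Qm)
    also have "\<dots> \<le> c2 * (ennreal \<eta>' + ennreal \<eta>')"
    proof (intro mult_left_mono add_mono)
      have "N (\<lambda>x. g x - g (x - ?u)) \<le> c2 * (N g + N (\<lambda>x. g (x - ?u)))"
        by (intro N_diff g borel_measurable_translate)
      also have "\<dots> \<le> c2 * (ennreal \<eta>'' + ennreal \<eta>'')"
        unfolding N_translate[OF g] using Ng by (intro mult_left_mono add_mono) auto
      finally show "N (\<lambda>x. g x - g (x - ?u)) \<le> ennreal \<eta>'" by (simp only: \<eta>''(2))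
      show "N (\<lambda>x. Q x - Q (x - ?u)) \<le> ennreal \<eta>'"
        using N_bounded[OF s(2)] d by simp
    qed simp
    finally show ?thesis using s(1) \<eta>'(2) by auto
  qed
  with T(1) show "\<exists>T. finite T \<and> (\<forall>t. \<exists>s\<in>T. osc f (t - s) \<le> ennreal \<eta>)" by blast
qed

end

section \<open>Regularisation\<close>

text \<open>Convexity gives the tangent inequality for positive \<open>x\<close>; at the endpoint
  \<open>x = 0\<close> the left-hand side is \<open>(1 - p) * m powr p\<close>.\<close>

lemma powr_above_tangent:
  fixes x m p :: real
  assumes "p \<ge> 1" "m > 0" "x \<ge> 0"
  shows "m powr p + p * m powr (p - 1) * (x - m) \<le> x powr p"
proof (cases "x = 0")
  case True
  have "m powr (p - 1) * m = m powr p" using assms(2) by (simp add: powr_diff)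
  then have "m powr p + p * m powr (p - 1) * (x - m) = (1 - p) * m powr p"
    using True by (simp add: algebra_simps)
  also have "\<dots> \<le> 0" using assms(1) by (simp add: mult_le_0_iff)
  finally show ?thesis using True by simp
next
  case False
  have "(\<lambda>x. x powr p) x - (\<lambda>x. x powr p) m \<ge> p * m powr (p - 1) * (x - m)"
  proof (rule convex_on_imp_above_tangent[OF powr_convex[OF assms(1)]])
    show "((\<lambda>x. x powr p) has_real_derivative p * m powr (p - 1)) (at m within {0<..})"
      using has_real_derivative_powr[OF assms(2)] by (rule has_field_derivative_at_within)
  qed (use assms False in \<open>auto simp: interior_open\<close>)
  then show ?thesis by simp
qed

text \<open>Jensen's inequality: integrate the tangent inequality at the mean \<open>m\<close> of
  \<open>cmod F\<close>, whose linear term integrates to 0. For non-integrable \<open>F\<close> the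
  integral is 0 by convention.\<close>

lemma norm_integral_powr_le:
  fixes F :: "'b \<Rightarrow> complex"
  assumes F: "F \<in> borel_measurable \<nu>" and \<nu>: "emeasure \<nu> (space \<nu>) = 1" and "p \<ge> 1"
  shows "ennreal (cmod (\<integral>x. F x \<partial>\<nu>) powr p) \<le> (\<integral>\<^sup>+x. ennreal (cmod (F x) powr p) \<partial>\<nu>)"
proof (cases "integrable \<nu> F")
  case False
  then show ?thesis by (simp add: not_integrable_integral_eq)
next
  case int: True
  interpret finite_measure \<nu> by standard (simp add: \<nu>)
  have \<nu>1: "measure \<nu> (space \<nu>) = 1" using \<nu> by (simp add: measure_def)
  define r where "r = (\<lambda>x. cmod (F x))"
  have r: "integrable \<nu> r" unfolding r_def by (intro integrable_norm int)
  define m where "m = (\<integral>x. r x \<partial>\<nu>)"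
  have le: "cmod (\<integral>x. F x \<partial>\<nu>) \<le> m" unfolding m_def r_def by (rule integral_norm_bound)
  have "m \<ge> 0" unfolding m_def r_def by simp
  show ?thesis
  proof (cases "m = 0 \<or> (\<integral>\<^sup>+x. ennreal (cmod (F x) powr p) \<partial>\<nu>) = \<infinity>")
    case True
    with le show ?thesis by auto
  next
    case False
    with \<open>m \<ge> 0\<close> have "m > 0" and fin: "(\<integral>\<^sup>+x. ennreal (r x powr p) \<partial>\<nu>) < \<infinity>"
      by (auto simp: r_def less_top)
    have rp: "integrable \<nu> (\<lambda>x. r x powr p)"
      using F fin by (intro integrableI_nonneg) (auto simp: r_def)
    have "m powr p = (\<integral>x. m powr p + p * m powr (p - 1) * (r x - m) \<partial>\<nu>)"
      using r by (simp add: \<nu>1 m_def)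
    also have "\<dots> \<le> (\<integral>x. r x powr p \<partial>\<nu>)"
      using r rp \<open>m > 0\<close> assms(3)
      by (intro integral_mono powr_above_tangent) (auto simp: r_def)
    finally have "ennreal (m powr p) \<le> ennreal (\<integral>x. r x powr p \<partial>\<nu>)" by (rule ennreal_leI)
    also have "\<dots> = (\<integral>\<^sup>+x. ennreal (r x powr p) \<partial>\<nu>)"
      using rp by (intro nn_integral_eq_integral[symmetric]) auto
    finally have "ennreal (m powr p) \<le> (\<integral>\<^sup>+x. ennreal (cmod (F x) powr p) \<partial>\<nu>)" by (simp add: r_def)
    moreover have "ennreal (cmod (\<integral>x. F x \<partial>\<nu>) powr p) \<le> ennreal (m powr p)"
      using le assms(3) by (intro ennreal_leI powr_mono2) auto
    ultimately show ?thesis by (rule order_trans[rotated])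
  qed
qed

context stepanov
begin

text \<open>Averaging \<open>f\<close> over \<open>x + U\<close> for a small neighbourhood \<open>U\<close> of \<open>0\<close> gives a bounded function \<open>g\<close> that
  is close to \<open>f\<close>, and whose oscillation is controlled uniformly by that of \<open>f\<close>. The average is over
  \<open>x + U\<close> rather than \<open>x - U\<close>, so that invariance of \<open>\<theta>\<close> under \<open>x \<mapsto> - x\<close> is not needed.\<close>

lemma regularisation:
  assumes floc: "f \<in> Lp_loc \<theta> p" and ap: "compactly_ap f" and "\<eta> > 0"
  obtains \<upsilon> g where "\<upsilon> > 0" "g \<in> borel_measurable borel" "N (\<lambda>x. f x - g x) \<le> ennreal \<eta>"
    "\<And>x. ennreal (cmod (g x) powr p) \<le> N f / ennreal \<upsilon>"
    "\<And>x t. ennreal (cmod (g x - g (x - t)) powr p) \<le> osc f t / ennreal \<upsilon>"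
proof -
  have f [measurable]: "f \<in> borel_measurable borel" using floc by (simp add: Lp_loc_iff)
  obtain V where V: "open V" "0 \<in> V" "\<And>v. v \<in> V \<Longrightarrow> osc f v \<le> ennreal \<eta>"
    using ennreal_tendsto_0D[OF osc_tendsto[OF floc ap] \<open>\<eta> > 0\<close>] unfolding eventually_nhds by blast
  obtain z where z: "z \<in> interior K" using K_interior by blast
  \<comment> \<open>Shifting by an interior point \<open>z\<close> of \<open>K\<close> fits
    \<open>x + U\<close> into a single window, so that integrals over \<open>x + U\<close> are
    bounded by \<open>N\<close>.\<close>
  define U where "U = V \<inter> {x. x - (- z) \<in> interior K}"
  have "open U" unfolding U_def by (intro open_Int V(1) open_translation open_interior)
  have U [measurable]: "U \<in> sets borel" using \<open>open U\<close> by simp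
  have "0 \<in> U" using V(2) z by (simp add: U_def)
  have UK: "{y. y - x \<in> U} \<subseteq> {y. y - (x - z) \<in> K}" for x
    using interior_subset by (fastforce simp: U_def algebra_simps)
  define \<upsilon> where "\<upsilon> = measure \<theta> U"
  have "emeasure \<theta> U \<le> emeasure \<theta> {y. y - (- z) \<in> K}"
    using UK[of 0] translate_K_borel[of "- z"] by (intro emeasure_mono) auto
  also have "\<dots> < \<infinity>" unfolding emeasure_translation[OF K_borel] emeasure_K by simp
  finally have eU: "emeasure \<theta> U = ennreal \<upsilon>" unfolding \<upsilon>_def by (intro emeasure_eq_ennreal_measure) simp
  have "\<upsilon> > 0" using emeasure_open_pos[OF \<open>open U\<close>] \<open>0 \<in> U\<close> unfolding eU by auto
  define \<nu> where "\<nu> = uniform_measure \<theta> U"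
  have sets_\<nu> [measurable_cong, simp]: "sets \<nu> = sets borel" by (simp add: \<nu>_def)
  have space_\<nu> [simp]: "space \<nu> = UNIV" by (simp add: \<nu>_def)
  have \<nu>1: "emeasure \<nu> (space \<nu>) = 1"
  proof -
    have "emeasure \<nu> (space \<nu>) = emeasure \<theta> (U \<inter> UNIV) / emeasure \<theta> U"
      unfolding \<nu>_def space_uniform_measure space_haar using U by (intro emeasure_uniform_measure) auto
    also have "\<dots> = 1" using \<open>\<upsilon> > 0\<close> by (simp add: eU divide_ennreal)
    finally show ?thesis .
  qed
  interpret \<nu>: finite_measure \<nu>
  proof
    show "emeasure \<nu> (space \<nu>) \<noteq> \<infinity>" unfolding \<nu>1 by simp
  qed
  interpret \<theta>: sigma_finite_measure \<theta> by (rule sigma_finite_haar)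
  interpret pair_sigma_finite \<theta> \<nu> ..
  have avg_le: "(\<integral>\<^sup>+u. ennreal (cmod (H (x + u)) powr p) \<partial>\<nu>) \<le> N H / ennreal \<upsilon>"
    if [measurable]: "H \<in> borel_measurable borel" for H x
  proof -
    have "(\<integral>\<^sup>+u. ennreal (cmod (H (x + u)) powr p) \<partial>\<nu>) =
        (\<integral>\<^sup>+u. ennreal (cmod (H (x + u)) powr p) * indicator U u \<partial>\<theta>) / ennreal \<upsilon>"
      unfolding \<nu>_def eU[symmetric] by (intro nn_integral_uniform_measure) simp_all
    also have "(\<integral>\<^sup>+u. ennreal (cmod (H (x + u)) powr p) * indicator U u \<partial>\<theta>) =
        (\<integral>\<^sup>+y. ennreal (cmod (H (x + (y - x))) powr p) * indicator U (y - x) \<partial>\<theta>)"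
      by (rule nn_integral_translation[symmetric, of "\<lambda>u. ennreal (cmod (H (x + u)) powr p) * indicator U u"]) measurable
    also have "\<dots> = L {y. y - x \<in> U} H"
      unfolding L_def by (intro nn_integral_cong) (auto split: split_indicator)
    also have "\<dots> \<le> L {y. y - (x - z) \<in> K} H" by (rule L_mono[OF UK])
    also have "\<dots> \<le> N H" by (rule L_le_N)
    finally show ?thesis by (simp add: divide_right_mono_ennreal)
  qed
  have plus_\<nu>: "(\<lambda>u. H (x + u)) \<in> borel_measurable \<nu>" if [measurable]: "H \<in> borel_measurable borel" for H :: "'a \<Rightarrow> complex" and x
    by measurable
  have int: "integrable \<nu> (\<lambda>u. f (x + u))" for x
  proof (rule integrableI_bounded)
    have "(\<integral>\<^sup>+u. ennreal (cmod (f (x + u))) \<partial>\<nu>) \<le> (\<integral>\<^sup>+u. 1 + ennreal (cmod (f (x + u)) powr p) \<partial>\<nu>)"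
    proof (rule nn_integral_mono)
      fix u
      have "a \<le> 1 + a powr p" if "a \<ge> 0" for a :: real
      proof (cases "a \<le> 1")
        case False
        then have "a powr 1 \<le> a powr p" using p by (intro powr_mono) auto
        with False show ?thesis by simp
      qed (use that in \<open>simp add: add_increasing2\<close>)
      then have "ennreal (cmod (f (x + u))) \<le> ennreal (1 + cmod (f (x + u)) powr p)" by (intro ennreal_leI) simp
      then show "ennreal (cmod (f (x + u))) \<le> 1 + ennreal (cmod (f (x + u)) powr p)" by simp
    qed
    also have "\<dots> = 1 + (\<integral>\<^sup>+u. ennreal (cmod (f (x + u)) powr p) \<partial>\<nu>)"
      using \<nu>1 by (subst nn_integral_add) simp_all
    also have "\<dots> \<le> 1 + N f / ennreal \<upsilon>" by (intro add_left_mono avg_le f)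
    also have "\<dots> < \<infinity>"
      using N_finite[OF floc ap] \<open>\<upsilon> > 0\<close> by (simp add: ennreal_divide_eq_top_iff less_top[symmetric])
    finally show "(\<integral>\<^sup>+u. ennreal (norm (f (x + u))) \<partial>\<nu>) < \<infinity>" .
  qed (rule plus_\<nu>[OF f])
  define g where "g = (\<lambda>x. \<integral>u. f (x + u) \<partial>\<nu>)"
  have plus: "(\<lambda>z. fst z + snd z) \<in> borel_measurable (borel \<Otimes>\<^sub>M borel :: ('a \<times> 'a) measure)"
    unfolding borel_prod by (intro borel_measurable_continuous_onI continuous_intros)
  have joint: "(\<lambda>z. f (fst z + snd z)) \<in> borel_measurable (borel \<Otimes>\<^sub>M \<nu>)"
    using measurable_compose[OF plus f] by (simp add: measurable_cong_sets[OF sets_pair_measure_cong[OF refl sets_\<nu>] refl])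
  have g [measurable]: "g \<in> borel_measurable borel"
    unfolding g_def using joint by (intro \<nu>.borel_measurable_lebesgue_integral) (simp add: split_beta')
  have bounded: "ennreal (cmod (g x) powr p) \<le> N f / ennreal \<upsilon>" for x
    unfolding g_def by (rule order_trans[OF norm_integral_powr_le[OF plus_\<nu>[OF f] \<nu>1 p] avg_le[OF f]])
  have osc: "ennreal (cmod (g x - g (x - t)) powr p) \<le> osc f t / ennreal \<upsilon>" for x t
  proof -
    let ?H = "\<lambda>y. f y - f (y - t)"
    have H: "?H \<in> borel_measurable borel" by (rule borel_measurable_difference[OF f])
    have "g x - g (x - t) = (\<integral>u. f (x + u) - f (x - t + u) \<partial>\<nu>)"
      unfolding g_def by (intro Bochner_Integration.integral_diff[symmetric] int)
    also have "\<dots> = (\<integral>u. ?H (x + u) \<partial>\<nu>)" by (simp add: algebra_simps)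
    finally have eq: "g x - g (x - t) = (\<integral>u. ?H (x + u) \<partial>\<nu>)" .
    show ?thesis
      unfolding eq osc_def by (rule order_trans[OF norm_integral_powr_le[OF plus_\<nu>[OF H] \<nu>1 p] avg_le[OF H]])
  qed
  have close: "N (\<lambda>x. f x - g x) \<le> ennreal \<eta>"
  proof (rule N_leI)
    fix y
    let ?A = "{x. x - y \<in> K}"
    have A [measurable]: "?A \<in> sets borel" by (rule translate_K_borel)
    \<comment> \<open>Jensen moves the power inside the average over \<open>u\<close>. After Fubini
      the inner integral for fixed \<open>u \<in> U\<close> is a window integral of
      \<open>f x - f (x + u)\<close>, at most \<open>osc f (- u)\<close>.\<close>
    have pt: "ennreal (cmod (f x - g x) powr p) \<le> (\<integral>\<^sup>+u. ennreal (cmod (f x - f (x + u)) powr p) \<partial>\<nu>)" for x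
    proof -
      have "(\<integral>u. f x - f (x + u) \<partial>\<nu>) = (\<integral>u. f x \<partial>\<nu>) - (\<integral>u. f (x + u) \<partial>\<nu>)"
        by (intro Bochner_Integration.integral_diff int) simp
      also have "(\<integral>u. f x \<partial>\<nu>) = f x" using \<nu>1 by (simp add: measure_def)
      finally have "f x - g x = (\<integral>u. f x - f (x + u) \<partial>\<nu>)" by (simp add: g_def)
      moreover have "(\<lambda>u. f x - f (x + u)) \<in> borel_measurable \<nu>"
        by (intro borel_measurable_diff plus_\<nu>[OF f]) simp
      ultimately show ?thesis using norm_integral_powr_le[OF _ \<nu>1 p] by simp
    qed
    have "L ?A (\<lambda>x. f x - g x) \<le> (\<integral>\<^sup>+x. (\<integral>\<^sup>+u. ennreal (cmod (f x - f (x + u)) powr p) \<partial>\<nu>) * indicator ?A x \<partial>\<theta>)"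
      unfolding L_def by (intro nn_integral_mono mult_right_mono pt) simp
    also have "\<dots> = (\<integral>\<^sup>+x. (\<integral>\<^sup>+u. ennreal (cmod (f x - f (x + u)) powr p) * indicator ?A x \<partial>\<nu>) \<partial>\<theta>)"
      by (intro nn_integral_cong nn_integral_multc[symmetric]) (use plus_\<nu>[OF f] in measurable)
    also have "\<dots> = (\<integral>\<^sup>+u. (\<integral>\<^sup>+x. ennreal (cmod (f x - f (x + u)) powr p) * indicator ?A x \<partial>\<theta>) \<partial>\<nu>)"
    proof (rule Fubini'[symmetric])
      have [measurable]: "(\<lambda>z. f (fst z + snd z)) \<in> borel_measurable (\<theta> \<Otimes>\<^sub>M \<nu>)"
        using joint by (simp add: measurable_cong_sets[OF sets_pair_measure_cong[OF sets_haar refl] refl])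
      have [measurable]: "(\<lambda>z. f (fst z)) \<in> borel_measurable (\<theta> \<Otimes>\<^sub>M \<nu>)" by measurable
      show "(\<lambda>(x, u). ennreal (cmod (f x - f (x + u)) powr p) * indicator ?A x) \<in> borel_measurable (\<theta> \<Otimes>\<^sub>M \<nu>)"
        unfolding split_beta' by measurable
    qed
    also have "\<dots> \<le> (\<integral>\<^sup>+u. ennreal \<eta> \<partial>\<nu>)"
    proof (rule nn_integral_mono_AE)
      have "L ?A (\<lambda>x. f x - f (x + u)) \<le> ennreal \<eta>" if "u \<in> U" for u
      proof -
        have "L ?A (\<lambda>x. f x - f (x + u)) \<le> osc f (- u)"
          using L_le_N[of y "\<lambda>x. f x - f (x + u)"] by (simp add: osc_def)
        also have "\<dots> \<le> ennreal \<eta>" using V(3)[of u] that by (simp add: osc_minus[OF f] U_def)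
        finally show ?thesis .
      qed
      then show "AE u in \<nu>. (\<integral>\<^sup>+x. ennreal (cmod (f x - f (x + u)) powr p) * indicator ?A x \<partial>\<theta>) \<le> ennreal \<eta>"
        unfolding \<nu>_def L_def by (intro AE_uniform_measureI) auto
    qed
    also have "\<dots> = ennreal \<eta>" using \<nu>1 by simp
    finally show "L ?A (\<lambda>x. f x - g x) \<le> ennreal \<eta>" .
  qed
  show ?thesis by (rule that[OF \<open>\<upsilon> > 0\<close> g close bounded osc])
qed

lemma finitely_ap_imp_trig_approx:
  assumes floc: "f \<in> Lp_loc \<theta> p" and ap: "finitely_ap f" and "\<eta> > 0"
  shows "\<exists>P. trig_polynomial P \<and> N (\<lambda>x. f x - P x) \<le> ennreal \<eta>"
proof -
  have f: "f \<in> borel_measurable borel" using floc by (simp add: Lp_loc_iff)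
  have cap: "compactly_ap f" by (rule finitely_ap_imp_compactly_ap[OF ap])
  obtain \<eta>' where \<eta>': "\<eta>' > 0" "c2 * (ennreal \<eta>' + ennreal \<eta>') = ennreal \<eta>"
    using c2_half[OF \<open>\<eta> > 0\<close>] by blast
  obtain \<upsilon> g where "\<upsilon> > 0" and g: "g \<in> borel_measurable borel" and fg: "N (\<lambda>x. f x - g x) \<le> ennreal \<eta>'"
    and gN: "\<And>x. ennreal (cmod (g x) powr p) \<le> N f / ennreal \<upsilon>"
    and gosc: "\<And>x t. ennreal (cmod (g x - g (x - t)) powr p) \<le> osc f t / ennreal \<upsilon>"
    by (rule regularisation[OF floc cap \<eta>'(1)], rule that)
  have root: "a \<le> b" if "a powr p \<le> b powr p" "b \<ge> 0" for a b :: real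
  proof (rule ccontr)
    assume "\<not> a \<le> b"
    then have "b powr p < a powr p" using p that(2) by (intro powr_less_mono2) auto
    with that(1) show False by simp
  qed
  obtain B where B: "B \<ge> 0" "\<And>x. cmod (g x) \<le> B"
  proof -
    have "N f / ennreal \<upsilon> < \<infinity>"
      using N_finite[OF floc cap] \<open>\<upsilon> > 0\<close> by (simp add: ennreal_divide_eq_top_iff less_top[symmetric])
    then obtain b where b: "b \<ge> 0" "N f / ennreal \<upsilon> = ennreal b"
      by (metis ennreal_cases infinity_ennreal_def order_less_irrefl)
    have "cmod (g x) \<le> b powr (1 / p)" for x
    proof (rule root)
      have "cmod (g x) powr p \<le> b" using gN[of x] unfolding b(2) ennreal_le_iff[OF b(1)] .
      then show "cmod (g x) powr p \<le> (b powr (1 / p)) powr p" using b(1) p by (simp add: powr_powr)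
    qed simp
    then show ?thesis using that[of "b powr (1 / p)"] by simp
  qed
  define \<rho> where "\<rho> = (\<lambda>t. SUP x. cmod (g x - g (x - t)))"
  have "cmod (g x - g y) \<le> 2 * B" for x y
    using norm_triangle_ineq4[of "g x" "g y"] B(2)[of x] B(2)[of y] by linarith
  then have bdd: "bdd_above (range (\<lambda>x. cmod (g x - g (x - t))))" for t by (intro bdd_aboveI) auto
  have \<rho>_upper: "cmod (g x - g (x - t)) \<le> \<rho> t" for x t
    unfolding \<rho>_def by (rule cSUP_upper[OF _ bdd]) simp
  have \<rho>_least: "\<rho> t \<le> d" if "\<And>x. cmod (g x - g (x - t)) \<le> d" for t d
    unfolding \<rho>_def by (rule cSUP_least) (use that in auto)
  \<comment> \<open>Smallness of \<open>osc f\<close> in the integral sense becomes uniform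
    smallness of the oscillation of \<open>g\<close>. Total boundedness of \<rho> and its continuity
    at 0 are both read off from this.\<close>
  have \<rho>_osc: "\<rho> t \<le> d" if "osc f t \<le> ennreal (\<upsilon> * d powr p)" "d \<ge> 0" for t d
  proof (rule \<rho>_least)
    fix x
    have "ennreal (cmod (g x - g (x - t)) powr p) \<le> ennreal (\<upsilon> * d powr p) / ennreal \<upsilon>"
      using gosc that(1) by (meson divide_right_mono_ennreal order_trans)
    also have "\<dots> = ennreal (d powr p)" using \<open>\<upsilon> > 0\<close> by (simp add: divide_ennreal)
    finally have "cmod (g x - g (x - t)) powr p \<le> d powr p" by (simp add: ennreal_le_iff)
    then show "cmod (g x - g (x - t)) \<le> d" using that(2) by (rule root)
  qed
  have \<rho>_minus_le: "\<rho> (- t) \<le> \<rho> t" for t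
  proof (rule \<rho>_least)
    fix x
    show "cmod (g x - g (x - - t)) \<le> \<rho> t"
      using \<rho>_upper[of "x + t" t] by (simp add: norm_minus_commute)
  qed
  interpret tb_pseudonorm \<rho>
  proof
    show "\<rho> 0 = 0" by (simp add: \<rho>_def)
    show "\<rho> (- x) = \<rho> x" for x using \<rho>_minus_le[of x] \<rho>_minus_le[of "- x"] by simp
    show "\<rho> (s + t) \<le> \<rho> s + \<rho> t" for s t
    proof (rule \<rho>_least)
      fix x
      have "cmod (g x - g (x - (s + t))) = cmod ((g x - g (x - s)) + (g (x - s) - g (x - s - t)))"
        by (simp add: diff_diff_eq)
      also have "\<dots> \<le> \<rho> s + \<rho> t" by (intro order_trans[OF norm_triangle_ineq] add_mono \<rho>_upper)
      finally show "cmod (g x - g (x - (s + t))) \<le> \<rho> s + \<rho> t" .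
    qed
    fix e :: real assume "e > 0"
    then have "\<upsilon> * (e / 2) powr p > 0" using \<open>\<upsilon> > 0\<close> by simp
    then obtain T where T: "finite T" "\<And>t. \<exists>s\<in>T. osc f (t - s) \<le> ennreal (\<upsilon> * (e / 2) powr p)"
      using ap unfolding finitely_ap_def by blast
    have "\<exists>s\<in>T. \<rho> (t - s) < e" for t
    proof -
      obtain s where s: "s \<in> T" "osc f (t - s) \<le> ennreal (\<upsilon> * (e / 2) powr p)" using T(2) by blast
      then have "\<rho> (t - s) \<le> e / 2" using \<open>e > 0\<close> by (intro \<rho>_osc) auto
      with s(1) \<open>e > 0\<close> show ?thesis by force
    qed
    with T(1) show "\<exists>T. finite T \<and> (\<forall>x. \<exists>t\<in>T. \<rho> (x - t) < e)" by blast
  qed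
  have "g \<in> uc"
  proof (rule ucI)
    fix e :: real assume "e > 0"
    have "norm (g x - g y) \<le> \<rho> (x - y)" for x y using \<rho>_upper[of x "x - y"] by simp
    with \<open>e > 0\<close> show "\<exists>d>0. \<forall>x y. \<rho> (x - y) < d \<longrightarrow> norm (g x - g y) \<le> e"
      by (meson less_imp_le order_trans)
  qed
  \<comment> \<open>Bohr's theorem supplies characters that are continuous for \<rho>; they are
    continuous on the group because \<rho> tends to 0 at 0 along with \<open>osc f\<close>.\<close>
  have cont: "continuous_on UNIV F" if F: "F \<in> uc" for F :: "'a \<Rightarrow> complex"
    unfolding continuous_on_eq_continuous_at[OF open_UNIV] isCont_def
  proof (intro ballI tendstoI)
    fix a and e :: real assume "e > 0"
    then have "e / 2 > 0" by simp
    obtain d where d: "d > 0" "\<And>x y. \<rho> (x - y) < d \<Longrightarrow> norm (F x - F y) \<le> e / 2"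
      using ucD[OF F \<open>e / 2 > 0\<close>] by blast
    have "\<upsilon> * (d / 2) powr p > 0" using \<open>\<upsilon> > 0\<close> d(1) by simp
    from ennreal_tendsto_0D[OF osc_tendsto[OF floc cap] this]
    obtain V where V: "open V" "0 \<in> V" "\<And>v. v \<in> V \<Longrightarrow> osc f v \<le> ennreal (\<upsilon> * (d / 2) powr p)"
      unfolding eventually_nhds by blast
    have "dist (F x) (F a) < e" if "x - a \<in> V" for x
    proof -
      have "\<rho> (x - a) \<le> d / 2" using V(3)[OF that] d(1) by (intro \<rho>_osc) auto
      then have "norm (F x - F a) \<le> e / 2" using d by (intro d(2)) auto
      with \<open>e > 0\<close> show ?thesis by (simp add: dist_norm)
    qed
    with open_translation[OF V(1), of a] V(2) show "\<forall>\<^sub>F x in at a. dist (F x) (F a) < e"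
      unfolding eventually_at_topological by (intro exI[of _ "{x. x - a \<in> V}"]) auto
  qed
  \<comment> \<open>A uniform error \<open>d\<close> costs at most
    \<open>\<kappa> * d powr p\<close> in \<open>N\<close>, here exactly the share
    \<open>\<eta>'\<close>.\<close>
  obtain d where d: "d > 0" "\<kappa> * d powr p = \<eta>'" using radius[OF \<eta>'(1)] by blast
  obtain X c where X: "finite X" "X \<subseteq> chars" "\<And>x. cmod (g x - (\<Sum>\<gamma>\<in>X. c \<gamma> * \<gamma> x)) \<le> d"
    using Bohr_approximation[OF \<open>g \<in> uc\<close> d(1)] by blast
  define P where "P = (\<lambda>x. \<Sum>\<gamma>\<in>X. c \<gamma> * \<gamma> x)"
  have "continuous_character \<gamma>" if "\<gamma> \<in> X" for \<gamma>
    using cont[of \<gamma>] X(2) that by (auto simp: continuous_character_def chars_def)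
  then have P: "trig_polynomial P"
    unfolding trig_polynomial_def P_def using X(1) by blast
  have Pm: "P \<in> borel_measurable borel" by (rule trig_polynomial_measurable[OF P])
  have "N (\<lambda>x. f x - P x) = N (\<lambda>x. (f x - g x) + (g x - P x))" by simp
  also have "\<dots> \<le> c2 * (N (\<lambda>x. f x - g x) + N (\<lambda>x. g x - P x))"
    by (intro N_add borel_measurable_diff f g Pm)
  also have "\<dots> \<le> c2 * (ennreal \<eta>' + ennreal \<eta>')"
  proof (intro mult_left_mono add_mono fg)
    show "N (\<lambda>x. g x - P x) \<le> ennreal \<eta>'"
      using N_bounded[of "\<lambda>x. g x - P x" d] X(3) d by (simp add: P_def)
  qed simp
  finally show ?thesis using P \<eta>'(2) by auto
qed

lemma finitely_ap_iff_trig_limit: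
  assumes floc: "f \<in> Lp_loc \<theta> p"
  shows "finitely_ap f \<longleftrightarrow>
    (\<exists>P. (\<forall>n::nat. trig_polynomial (P n)) \<and> (\<lambda>n. stepanov_norm \<theta> p K (\<lambda>x. f x - P n x)) \<longlonglongrightarrow> 0)"
proof
  assume ap: "finitely_ap f"
  have "\<exists>P. trig_polynomial P \<and> stepanov_norm \<theta> p K (\<lambda>x. f x - P x) \<le> ennreal (1 / real (Suc n))" for n
    using finitely_ap_imp_trig_approx[OF floc ap, of "\<kappa> * (1 / real (Suc n)) powr p"] \<kappa>_pos
    by (simp add: stepanov_norm_le_iff)
  then obtain P where P: "\<And>n. trig_polynomial (P n)"
    "\<And>n. stepanov_norm \<theta> p K (\<lambda>x. f x - P n x) \<le> ennreal (1 / real (Suc n))" by metis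
  have "(\<lambda>n. 1 / real (Suc n)) \<longlonglongrightarrow> 0"
    using LIMSEQ_inverse_real_of_nat by (simp add: inverse_eq_divide)
  then have "(\<lambda>n. ennreal (1 / real (Suc n))) \<longlonglongrightarrow> ennreal 0" by (rule tendsto_ennrealI)
  then have lim: "(\<lambda>n. ennreal (1 / real (Suc n))) \<longlonglongrightarrow> 0" by simp
  have "(\<lambda>n. stepanov_norm \<theta> p K (\<lambda>x. f x - P n x)) \<longlonglongrightarrow> 0"
  proof (rule tendsto_sandwich[OF _ _ tendsto_const lim])
    show "\<forall>\<^sub>F n in sequentially. stepanov_norm \<theta> p K (\<lambda>x. f x - P n x) \<le> ennreal (1 / real (Suc n))"
      using P(2) by simp
  qed auto
  with P(1) show "\<exists>P. (\<forall>n::nat. trig_polynomial (P n)) \<and>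
      (\<lambda>n. stepanov_norm \<theta> p K (\<lambda>x. f x - P n x)) \<longlonglongrightarrow> 0" by blast
next
  assume "\<exists>P. (\<forall>n::nat. trig_polynomial (P n)) \<and>
      (\<lambda>n. stepanov_norm \<theta> p K (\<lambda>x. f x - P n x)) \<longlonglongrightarrow> 0"
  then obtain P where P: "\<And>n::nat. trig_polynomial (P n)"
    "(\<lambda>n. stepanov_norm \<theta> p K (\<lambda>x. f x - P n x)) \<longlonglongrightarrow> 0" by blast
  from floc have "f \<in> borel_measurable borel" by (simp add: Lp_loc_iff)
  then show "finitely_ap f" using P by (rule trig_limit_imp_finitely_ap)
qed

lemma stepanov_ap_iff_finitely_ap:
  "f \<in> Lp_loc \<theta> p \<Longrightarrow> stepanov_almost_periodic \<theta> p K f \<longleftrightarrow> finitely_ap f"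
  using stepanov_ap_iff compactly_ap_imp_finitely_ap finitely_ap_imp_compactly_ap by blast

end

theorem theorem2p9:
  fixes \<theta> :: "'a::{topological_ab_group_add, second_countable_topology, t2_space} measure"
    and p :: real and K :: "'a set" and f :: "'a \<Rightarrow> complex"
  assumes "locally_compact_space (euclidean :: 'a topology)"
    and "haar_measure \<theta>"
    and "1 \<le> p"
    and "K \<in> sets \<theta>" and "compact (closure K)" and "interior K \<noteq> {}"
    and "f \<in> Lp_loc \<theta> p"
  shows "(stepanov_almost_periodic \<theta> p K f \<longleftrightarrow>
            (\<exists>P. (\<forall>n::nat. trig_polynomial (P n)) \<and>
                 (\<lambda>n. stepanov_norm \<theta> p K (\<lambda>x. f x - P n x)) \<longlonglongrightarrow> 0)) \<and>
         (stepanov_almost_periodic \<theta> p K f \<longleftrightarrow>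
            stepanov_precompact \<theta> p K (range (\<lambda>t. translate t f)))"
proof -
  interpret stepanov \<theta> p K using assms by unfold_locales
  show ?thesis
    using stepanov_ap_iff_finitely_ap[OF assms(7)] finitely_ap_iff_trig_limit[OF assms(7)]
      precompact_iff[OF assms(7)] by blast
qed

end
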